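(* Let $l\ge 1$, let $\Lambda$ be a graded self-injective algebra of Loewy length $l+1$ given by a stable bound quiver $Q$ with Nakayama translation $\tau$, and let $\sigma$ be a graded automorphism of $\Lambda$. Then the quiver $\tilde Q^{\sigma}$ of the twisted trivial extension $\tilde\Lambda^{\sigma}=\Lambda\ltimes D\Lambda^{\sigma}$ is $\tilde Q$, the quiver of the trivial extension $\Lambda\ltimes D\Lambda$, i.e. the quiver obtained from $Q$ by adding an arrow from $i$ to $\tau i$ for each vertex $i$ of $Q$.
   Context: $k$ is a field and $D=\mathrm{Hom}_k(-,k)$. A graded algebra is $\Gamma=\bigoplus_{t\ge0}\Gamma_t$, generated by $\Gamma_0$ and $\Gamma_1$, with $\Gamma_0=\bigoplus_{i=1}^n ke_i$, where $1=e_1+\cdots+e_n$ is a decomposition into orthogonal primitive idempotents. Paths are composed from right to left: a path from $i$ to $j$ lies in $e_j(kQ)e_i$. A bound quiver $Q=(Q_0,Q_1,\rho)$ is a quiver with a set $\rho$ of relations (linear combinations of paths of length $\ge2$); the algebra it gives is $k(Q)=kQ/(\rho)$. A bound path is a path with nonzero image in $k(Q)$. The bound quiver is homogeneous if in each element of $\rho$ all paths have the same length. A homogeneous bound quiver is stable of Loewy length $l+1$ ($l\ge1$) if: (i) a permutation $\tau$ of $Q_0$ is given (the Nakayama translation); (ii) all maximal bound paths have the same length $l$; (iii) for each vertex $i$ there is a maximal bound path from $\tau i$ to $i$ and there is no bound path of length $l$ from $\tau i$ to $j$ for any $j\ne i$; (iv) any two maximal bound paths starting at the same vertex are linearly dependent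 in $k(Q)$. A finite-dimensional graded algebra is graded self-injective of Loewy length $l+1$ if and only if it is given by a stable bound quiver of Loewy length $l+1$. The trivial extension $\Lambda\ltimes M$ of $\Lambda$ by a $\Lambda$-bimodule $M$ is $\Lambda\oplus M$ with multiplication $(a,x)(b,y)=(ab,ay+xb)$. A graded automorphism is an algebra automorphism preserving degrees of homogeneous elements. For a graded automorphism $\sigma$ and a $\Lambda$-bimodule $M$, the twist $M^\sigma$ is the vector space $M$ with the same left multiplication and with right multiplication $x\cdot b=x\sigma(b)$.
   Formalization: The graded automorphism σ is additionally assumed to fix every vertex idempotent e_i; without this the claim fails, e.g. for k[x]/(x²)×k[y]/(y²) with σ swapping the factors, where the new arrows join the two vertices instead of being loops. *)

theory Defs
  imports
    "HOL-Algebra.Ideal_Product"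
    "HOL-Algebra.QuotRing"
    "HOL-Algebra.Module"
    "HOL-Library.FuncSet"
    "HOL-Library.Poly_Mapping"
    "Graph_Theory.Arc_Walk"
begin

text \<open>
  A quiver is a (finite) multidigraph; an arc \<open>a\<close> is an arrow from \<open>tail Q a\<close> to \<open>head Q a\<close>.
  A \<open>k\<close>-algebra, with \<open>k\<close> given by a type of class \<open>field\<close>, is a HOL-Algebra ring record
  extended by a scalar multiplication, i.e. a record of type \<open>('k, 'r) module\<close>.
\<close>

section \<open>Path algebras and bound quivers\<close>

text \<open>
  A path is a pair of its start vertex and the list of its arrows in the order in which they are
  traversed, so \<open>(u, [])\<close> is the trivial path at \<open>u\<close>.
\<close>

type_synonym ('v, 'a) path = "'v \<times> 'a list"

definition paths :: "('v, 'a) pre_digraph \<Rightarrow> ('v, 'a) path set" where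
  "paths Q = {p. \<exists>v. pre_digraph.awalk Q (fst p) (snd p) v}"

definition path_end :: "('v, 'a) pre_digraph \<Rightarrow> ('v, 'a) path \<Rightarrow> 'v" where
  "path_end Q p = pre_digraph.awlast Q (fst p) (snd p)"

abbreviation path_length :: "('v, 'a) path \<Rightarrow> nat" where
  "path_length p \<equiv> length (snd p)"

text \<open>
  Paths compose from right to left: in the product of \<open>q\<close> and \<open>p\<close>, the path \<open>p\<close> is traversed first.
\<close>

definition path_algebra ::
    "('v, 'a) pre_digraph \<Rightarrow> ('k::field, ('v, 'a) path \<Rightarrow>\<^sub>0 'k) module" where
  "path_algebra Q =
    \<lparr>carrier = {f. Poly_Mapping.keys f \<subseteq> paths Q},
     mult = (\<lambda>f g. \<Sum>q\<in>Poly_Mapping.keys f. \<Sum>p\<in>Poly_Mapping.keys g.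
       if path_end Q p = fst q
       then Poly_Mapping.single (fst p, snd p @ snd q)
              (Poly_Mapping.lookup f q * Poly_Mapping.lookup g p)
       else 0),
     one = (\<Sum>v\<in>verts Q. Poly_Mapping.single (v, []) 1),
     zero = 0,
     add = (+),
     smult = (\<lambda>c. Poly_Mapping.map ((*) c))\<rparr>"

definition quot_algebra ::
    "('k, 'r) module \<Rightarrow> 'r set \<Rightarrow> ('k, 'r set) module" where
  "quot_algebra A I =
    ring.extend (A Quot I) (module.fields (\<lambda>c X. \<Union>x\<in>X. I +>\<^bsub>A\<^esub> (c \<odot>\<^bsub>A\<^esub> x)))"

text \<open>The last conjunct is homogeneity.\<close>

definition homogeneous_bound_quiver ::
    "('v, 'a) pre_digraph \<Rightarrow> (('v, 'a) path \<Rightarrow>\<^sub>0 'k::field) set \<Rightarrow> bool" where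
  "homogeneous_bound_quiver Q \<rho> \<longleftrightarrow>
    fin_digraph Q \<and>
    \<rho> \<subseteq> carrier (path_algebra Q) \<and>
    (\<forall>f\<in>\<rho>. \<forall>p\<in>Poly_Mapping.keys f. path_length p \<ge> 2) \<and>
    (\<forall>f\<in>\<rho>. \<forall>p\<in>Poly_Mapping.keys f. \<forall>q\<in>Poly_Mapping.keys f. path_length p = path_length q)"

definition relation_ideal ::
    "('v, 'a) pre_digraph \<Rightarrow> (('v, 'a) path \<Rightarrow>\<^sub>0 'k::field) set \<Rightarrow> (('v, 'a) path \<Rightarrow>\<^sub>0 'k) set" where
  "relation_ideal Q \<rho> = Idl\<^bsub>path_algebra Q\<^esub> \<rho>"

definition bound_quiver_algebra ::
    "('v, 'a) pre_digraph \<Rightarrow> (('v, 'a) path \<Rightarrow>\<^sub>0 'k::field) set \<Rightarrow>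
     ('k, (('v, 'a) path \<Rightarrow>\<^sub>0 'k) set) module" where
  "bound_quiver_algebra Q \<rho> = quot_algebra (path_algebra Q) (relation_ideal Q \<rho>)"

definition residue ::
    "('v, 'a) pre_digraph \<Rightarrow> (('v, 'a) path \<Rightarrow>\<^sub>0 'k::field) set \<Rightarrow>
     (('v, 'a) path \<Rightarrow>\<^sub>0 'k) \<Rightarrow> (('v, 'a) path \<Rightarrow>\<^sub>0 'k) set" where
  "residue Q \<rho> f = relation_ideal Q \<rho> +>\<^bsub>path_algebra Q\<^esub> f"

definition path_class ::
    "('v, 'a) pre_digraph \<Rightarrow> (('v, 'a) path \<Rightarrow>\<^sub>0 'k::field) set \<Rightarrow> ('v, 'a) path \<Rightarrow>
     (('v, 'a) path \<Rightarrow>\<^sub>0 'k) set" where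
  "path_class Q \<rho> p = residue Q \<rho> (Poly_Mapping.single p 1)"

abbreviation vertex_idem ::
    "('v, 'a) pre_digraph \<Rightarrow> (('v, 'a) path \<Rightarrow>\<^sub>0 'k::field) set \<Rightarrow> 'v \<Rightarrow>
     (('v, 'a) path \<Rightarrow>\<^sub>0 'k) set" where
  "vertex_idem Q \<rho> v \<equiv> path_class Q \<rho> (v, [])"

definition degree_part ::
    "('v, 'a) pre_digraph \<Rightarrow> (('v, 'a) path \<Rightarrow>\<^sub>0 'k::field) set \<Rightarrow> nat \<Rightarrow>
     (('v, 'a) path \<Rightarrow>\<^sub>0 'k) set set" where
  "degree_part Q \<rho> t =
    residue Q \<rho> ` {f \<in> carrier (path_algebra Q). \<forall>p\<in>Poly_Mapping.keys f. path_length p = t}"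

section \<open>Stable bound quivers\<close>

definition bound_path ::
    "('v, 'a) pre_digraph \<Rightarrow> (('v, 'a) path \<Rightarrow>\<^sub>0 'k::field) set \<Rightarrow> ('v, 'a) path \<Rightarrow> bool" where
  "bound_path Q \<rho> p \<longleftrightarrow>
    p \<in> paths Q \<and> path_class Q \<rho> p \<noteq> \<zero>\<^bsub>bound_quiver_algebra Q \<rho>\<^esub>"

text \<open>\<open>p\<close> is a subpath of \<open>p'\<close> if \<open>p'\<close> is the composite of some path \<open>p1\<close>, then \<open>p\<close>, then some path.\<close>

definition subpath ::
    "('v, 'a) pre_digraph \<Rightarrow> ('v, 'a) path \<Rightarrow> ('v, 'a) path \<Rightarrow> bool" where
  "subpath Q p p' \<longleftrightarrow>
    (\<exists>p1 q. fst p1 = fst p' \<and> path_end Q p1 = fst p \<and> snd p' = snd p1 @ snd p @ q)"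

definition maximal_bound_path ::
    "('v, 'a) pre_digraph \<Rightarrow> (('v, 'a) path \<Rightarrow>\<^sub>0 'k::field) set \<Rightarrow> ('v, 'a) path \<Rightarrow> bool" where
  "maximal_bound_path Q \<rho> p \<longleftrightarrow>
    bound_path Q \<rho> p \<and> (\<forall>p'. bound_path Q \<rho> p' \<and> subpath Q p p' \<longrightarrow> p' = p)"

text \<open>\<open>stable_bound_quiver Q \<rho> \<tau> l\<close>: stable of Loewy length \<open>l + 1\<close>, with Nakayama translation \<open>\<tau>\<close>.\<close>

definition stable_bound_quiver ::
    "('v, 'a) pre_digraph \<Rightarrow> (('v, 'a) path \<Rightarrow>\<^sub>0 'k::field) set \<Rightarrow> ('v \<Rightarrow> 'v) \<Rightarrow> nat \<Rightarrow> bool" where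
  "stable_bound_quiver Q \<rho> \<tau> l \<longleftrightarrow>
    homogeneous_bound_quiver Q \<rho> \<and>
    bij_betw \<tau> (verts Q) (verts Q) \<and>
    (\<forall>p. maximal_bound_path Q \<rho> p \<longrightarrow> path_length p = l) \<and>
    (\<forall>i\<in>verts Q.
      (\<exists>p. maximal_bound_path Q \<rho> p \<and> fst p = \<tau> i \<and> path_end Q p = i) \<and>
      (\<forall>j\<in>verts Q. j \<noteq> i \<longrightarrow>
        \<not> (\<exists>p. bound_path Q \<rho> p \<and> path_length p = l \<and> fst p = \<tau> i \<and> path_end Q p = j))) \<and>
    (\<forall>p q. maximal_bound_path Q \<rho> p \<and> maximal_bound_path Q \<rho> q \<and> fst p = fst q \<longrightarrow>
      (\<exists>a b. (a, b) \<noteq> (0, 0) \<and>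
        a \<odot>\<^bsub>bound_quiver_algebra Q \<rho>\<^esub> path_class Q \<rho> p
          \<oplus>\<^bsub>bound_quiver_algebra Q \<rho>\<^esub> b \<odot>\<^bsub>bound_quiver_algebra Q \<rho>\<^esub> path_class Q \<rho> q
        = \<zero>\<^bsub>bound_quiver_algebra Q \<rho>\<^esub>))"

section \<open>Self-injective algebras\<close>

text \<open>
  The library's \<open>module\<close> locale needs a commutative base ring, so left modules over an arbitrary
  ring are introduced here. Their \<open>mult\<close> and \<open>one\<close> fields carry no meaning.
\<close>

definition left_module :: "('r, 'e) ring_scheme \<Rightarrow> ('r, 'm) module \<Rightarrow> bool" where
  "left_module R M \<longleftrightarrow>
    ring R \<and> abelian_group M \<and>
    (\<forall>a\<in>carrier R. \<forall>x\<in>carrier M. a \<odot>\<^bsub>M\<^esub> x \<in> carrier M) \<and>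
    (\<forall>a\<in>carrier R. \<forall>b\<in>carrier R. \<forall>x\<in>carrier M.
      (a \<oplus>\<^bsub>R\<^esub> b) \<odot>\<^bsub>M\<^esub> x = a \<odot>\<^bsub>M\<^esub> x \<oplus>\<^bsub>M\<^esub> b \<odot>\<^bsub>M\<^esub> x) \<and>
    (\<forall>a\<in>carrier R. \<forall>x\<in>carrier M. \<forall>y\<in>carrier M.
      a \<odot>\<^bsub>M\<^esub> (x \<oplus>\<^bsub>M\<^esub> y) = a \<odot>\<^bsub>M\<^esub> x \<oplus>\<^bsub>M\<^esub> a \<odot>\<^bsub>M\<^esub> y) \<and>
    (\<forall>a\<in>carrier R. \<forall>b\<in>carrier R. \<forall>x\<in>carrier M.
      (a \<otimes>\<^bsub>R\<^esub> b) \<odot>\<^bsub>M\<^esub> x = a \<odot>\<^bsub>M\<^esub> (b \<odot>\<^bsub>M\<^esub> x)) \<and>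
    (\<forall>x\<in>carrier M. \<one>\<^bsub>R\<^esub> \<odot>\<^bsub>M\<^esub> x = x)"

definition left_module_hom ::
    "('r, 'e) ring_scheme \<Rightarrow> ('r, 'm) module \<Rightarrow> ('r, 'n) module \<Rightarrow> ('m \<Rightarrow> 'n) set" where
  "left_module_hom R M N =
    {f \<in> carrier M \<rightarrow> carrier N.
      (\<forall>x\<in>carrier M. \<forall>y\<in>carrier M. f (x \<oplus>\<^bsub>M\<^esub> y) = f x \<oplus>\<^bsub>N\<^esub> f y) \<and>
      (\<forall>a\<in>carrier R. \<forall>x\<in>carrier M. f (a \<odot>\<^bsub>M\<^esub> x) = a \<odot>\<^bsub>N\<^esub> f x)}"

text \<open>
  HOL cannot quantify over the types of the test modules \<open>M\<close> and \<open>N\<close>. Their elements are taken in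
  the type of the ring elements; this covers all inclusions of left ideals in the ring, and hence,
  by Baer's criterion, gives injectivity with respect to arbitrary modules.
\<close>

definition injective_left_module :: "('r, 'e) ring_scheme \<Rightarrow> ('r, 'm) module \<Rightarrow> bool" where
  "injective_left_module R E \<longleftrightarrow>
    left_module R E \<and>
    (\<forall>(M :: ('r, 'r) module) (N :: ('r, 'r) module).
      left_module R M \<and> left_module R N \<longrightarrow>
      (\<forall>f\<in>left_module_hom R M N. \<forall>g\<in>left_module_hom R M E.
        inj_on f (carrier M) \<longrightarrow>
        (\<exists>h\<in>left_module_hom R N E. \<forall>x\<in>carrier M. h (f x) = g x)))"

definition regular_left_module :: "('r, 'e) ring_scheme \<Rightarrow> ('r, 'r) module" where
  "regular_left_module R = ring.extend (ring.truncate R) (module.fields (mult R))"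

definition finite_dimensional :: "('k::field, 'r) module \<Rightarrow> bool" where
  "finite_dimensional A \<longleftrightarrow>
    (\<exists>B. finite B \<and> B \<subseteq> carrier A \<and>
      (\<forall>x\<in>carrier A. \<exists>c. x = (\<Oplus>\<^bsub>A\<^esub>b\<in>B. c b \<odot>\<^bsub>A\<^esub> b)))"

text \<open>
  For a finite-dimensional graded algebra, injectivity of the regular module in the category of
  graded modules and in the category of all modules amount to the same.
\<close>

definition self_injective_algebra :: "('k::field, 'r) module \<Rightarrow> bool" where
  "self_injective_algebra A \<longleftrightarrow>
    finite_dimensional A \<and> injective_left_module A (regular_left_module A)"

section \<open>Graded automorphisms\<close>

definition graded_automorphism ::
    "('k::field, 'r) module \<Rightarrow> (nat \<Rightarrow> 'r set) \<Rightarrow> ('r \<Rightarrow> 'r) \<Rightarrow> bool" where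
  "graded_automorphism A deg \<sigma> \<longleftrightarrow>
    \<sigma> \<in> ring_iso A A \<and>
    (\<forall>c. \<forall>x\<in>carrier A. \<sigma> (c \<odot>\<^bsub>A\<^esub> x) = c \<odot>\<^bsub>A\<^esub> \<sigma> x) \<and>
    (\<forall>t. \<forall>x\<in>deg t. \<sigma> x \<in> deg t)"

section \<open>Bimodules and (twisted) trivial extensions\<close>

text \<open>
  A bimodule over a \<open>k\<close>-algebra; \<open>smult\<close> is the scalar multiplication by elements of \<open>k\<close>.
  The fields \<open>mult\<close> and \<open>one\<close> carry no meaning.
\<close>

record ('k, 'r, 'm) bimodule = "('k, 'm) module" +
  lact :: "'r \<Rightarrow> 'm \<Rightarrow> 'm"
  ract :: "'m \<Rightarrow> 'r \<Rightarrow> 'm"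

definition dual_bimodule :: "('k::field, 'r) module \<Rightarrow> ('k, 'r, 'r \<Rightarrow> 'k) bimodule" where
  "dual_bimodule A =
    \<lparr>carrier = {f \<in> carrier A \<rightarrow>\<^sub>E UNIV.
       (\<forall>x\<in>carrier A. \<forall>y\<in>carrier A. f (x \<oplus>\<^bsub>A\<^esub> y) = f x + f y) \<and>
       (\<forall>c. \<forall>x\<in>carrier A. f (c \<odot>\<^bsub>A\<^esub> x) = c * f x)},
     mult = undefined,
     one = undefined,
     zero = (\<lambda>x\<in>carrier A. 0),
     add = (\<lambda>f g. \<lambda>x\<in>carrier A. f x + g x),
     smult = (\<lambda>c f. \<lambda>x\<in>carrier A. c * f x),
     lact = (\<lambda>a f. \<lambda>x\<in>carrier A. f (x \<otimes>\<^bsub>A\<^esub> a)),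
     ract = (\<lambda>f a. \<lambda>x\<in>carrier A. f (a \<otimes>\<^bsub>A\<^esub> x))\<rparr>"

definition twist :: "('r \<Rightarrow> 'r) \<Rightarrow> ('k, 'r, 'm) bimodule \<Rightarrow> ('k, 'r, 'm) bimodule" where
  "twist \<sigma> M = M\<lparr>ract := (\<lambda>x b. ract M x (\<sigma> b))\<rparr>"

definition trivial_extension ::
    "('k::field, 'r) module \<Rightarrow> ('k, 'r, 'm) bimodule \<Rightarrow> ('k, 'r \<times> 'm) module" where
  "trivial_extension A M =
    \<lparr>carrier = carrier A \<times> carrier M,
     mult = (\<lambda>(a, x) (b, y). (a \<otimes>\<^bsub>A\<^esub> b, lact M a y \<oplus>\<^bsub>M\<^esub> ract M x b)),
     one = (\<one>\<^bsub>A\<^esub>, \<zero>\<^bsub>M\<^esub>),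
     zero = (\<zero>\<^bsub>A\<^esub>, \<zero>\<^bsub>M\<^esub>),
     add = (\<lambda>(a, x) (b, y). (a \<oplus>\<^bsub>A\<^esub> b, x \<oplus>\<^bsub>M\<^esub> y)),
     smult = (\<lambda>c (a, x). (c \<odot>\<^bsub>A\<^esub> a, c \<odot>\<^bsub>M\<^esub> x))\<rparr>"

section \<open>The quiver of an algebra\<close>

definition left_ideal :: "'r set \<Rightarrow> ('r, 'e) ring_scheme \<Rightarrow> bool" where
  "left_ideal I R \<longleftrightarrow> additive_subgroup I R \<and> (\<forall>a\<in>carrier R. \<forall>x\<in>I. a \<otimes>\<^bsub>R\<^esub> x \<in> I)"

definition maximal_left_ideal :: "'r set \<Rightarrow> ('r, 'e) ring_scheme \<Rightarrow> bool" where
  "maximal_left_ideal I R \<longleftrightarrow>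
    left_ideal I R \<and> I \<noteq> carrier R \<and>
    (\<forall>J. left_ideal J R \<and> I \<subseteq> J \<longrightarrow> J = I \<or> J = carrier R)"

definition jacobson_radical :: "('r, 'e) ring_scheme \<Rightarrow> 'r set" where
  "jacobson_radical R = {x \<in> carrier R. \<forall>I. maximal_left_ideal I R \<longrightarrow> x \<in> I}"

definition primitive_idempotent :: "('r, 'e) ring_scheme \<Rightarrow> 'r \<Rightarrow> bool" where
  "primitive_idempotent R e \<longleftrightarrow>
    e \<in> carrier R \<and> e \<otimes>\<^bsub>R\<^esub> e = e \<and> e \<noteq> \<zero>\<^bsub>R\<^esub> \<and>
    (\<forall>f\<in>carrier R. \<forall>g\<in>carrier R.
      f \<otimes>\<^bsub>R\<^esub> f = f \<and> g \<otimes>\<^bsub>R\<^esub> g = g \<and> f \<otimes>\<^bsub>R\<^esub> g = \<zero>\<^bsub>R\<^esub> \<and> g \<otimes>\<^bsub>R\<^esub> f = \<zero>\<^bsub>R\<^esub> \<and>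
      e = f \<oplus>\<^bsub>R\<^esub> g \<longrightarrow> f = \<zero>\<^bsub>R\<^esub> \<or> g = \<zero>\<^bsub>R\<^esub>)"

definition complete_primitive_idempotents ::
    "('r, 'e) ring_scheme \<Rightarrow> 'i set \<Rightarrow> ('i \<Rightarrow> 'r) \<Rightarrow> bool" where
  "complete_primitive_idempotents R I e \<longleftrightarrow>
    finite I \<and>
    (\<forall>i\<in>I. primitive_idempotent R (e i)) \<and>
    (\<forall>i\<in>I. \<forall>j\<in>I. i \<noteq> j \<longrightarrow> e i \<otimes>\<^bsub>R\<^esub> e j = \<zero>\<^bsub>R\<^esub>) \<and>
    (\<Oplus>\<^bsub>R\<^esub>i\<in>I. e i) = \<one>\<^bsub>R\<^esub>"

text \<open>The residue classes of the family \<open>b\<close>, indexed by \<open>I\<close>, form a \<open>k\<close>-basis of \<open>U/W\<close>.\<close>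

definition basis_modulo ::
    "('k::field, 'r) module \<Rightarrow> 'r set \<Rightarrow> 'r set \<Rightarrow> 'i set \<Rightarrow> ('i \<Rightarrow> 'r) \<Rightarrow> bool" where
  "basis_modulo A U W I b \<longleftrightarrow>
    finite I \<and> (\<forall>i\<in>I. b i \<in> U) \<and>
    (\<forall>x\<in>U. \<exists>!c. c \<in> I \<rightarrow>\<^sub>E UNIV \<and> x \<ominus>\<^bsub>A\<^esub> (\<Oplus>\<^bsub>A\<^esub>i\<in>I. c i \<odot>\<^bsub>A\<^esub> b i) \<in> W)"

definition corner :: "('r, 'e) ring_scheme \<Rightarrow> 'r \<Rightarrow> 'r set \<Rightarrow> 'r \<Rightarrow> 'r set" where
  "corner R f U e = (\<lambda>x. f \<otimes>\<^bsub>R\<^esub> x \<otimes>\<^bsub>R\<^esub> e) ` U"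

text \<open>
  \<open>G\<close> is the (ordinary) quiver of \<open>A\<close>, a vertex \<open>i\<close> standing for the idempotent \<open>e i\<close>. With \<open>J\<close> the
  Jacobson radical, the second conjunct says that \<open>A\<close> is basic and split, i.e. that \<open>A/J\<close> is a
  product of copies of \<open>k\<close> given by the \<open>e i\<close>; the third one says that the arrows from \<open>i\<close> to \<open>j\<close> are
  in bijection with a basis of \<open>e\<^sub>j (J/J\<^sup>2) e\<^sub>i\<close>.
\<close>

definition is_quiver_of ::
    "('v, 'b) pre_digraph \<Rightarrow> ('k::field, 'r) module \<Rightarrow> ('v \<Rightarrow> 'r) \<Rightarrow> bool" where
  "is_quiver_of G A e \<longleftrightarrow>
    (let J = jacobson_radical A in
      complete_primitive_idempotents A (verts G) e \<and>
      basis_modulo A (carrier A) J (verts G) e \<and>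
      fin_digraph G \<and>
      (\<forall>i\<in>verts G. \<forall>j\<in>verts G. \<exists>b.
        basis_modulo A (corner A (e j) J (e i)) (corner A (e j) (ideal_prod A J J) (e i))
          {a \<in> arcs G. tail G a = i \<and> head G a = j} b))"

text \<open>The quiver obtained from \<open>Q\<close> by adding an arrow \<open>Inr i\<close> from \<open>i\<close> to \<open>\<tau> i\<close> for each vertex \<open>i\<close>.\<close>

definition returning_quiver ::
    "('v, 'a) pre_digraph \<Rightarrow> ('v \<Rightarrow> 'v) \<Rightarrow> ('v, 'a + 'v) pre_digraph" where
  "returning_quiver Q \<tau> =
    \<lparr>verts = verts Q,
     arcs = Inl ` arcs Q \<union> Inr ` verts Q,
     tail = case_sum (tail Q) (\<lambda>i. i),
     head = case_sum (head Q) \<tau>\<rparr>"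

end

theory Submission
  imports Defs "HOL-Algebra.Multiplicative_Group"
begin

text \<open>
  Let \<open>\<Lambda>' = \<Lambda> \<ltimes> D\<Lambda>\<^sup>\<sigma>\<close> and let \<open>J\<close> be the radical of \<open>\<Lambda>\<close>. Every element of \<open>\<Lambda>'\<close> without
  diagonal part is nilpotent, so the radical of \<open>\<Lambda>'\<close> is \<open>J \<oplus> D\<Lambda>\<close>. An automorphism preserves the
  set \<open>J\<close> of nilpotent elements, so the square of this radical is \<open>J\<^sup>2 \<oplus> (J D\<Lambda> + D\<Lambda> J)\<close>
  whatever \<open>\<sigma>\<close> is, and \<open>J D\<Lambda> + D\<Lambda> J\<close> consists by duality of the functionals vanishing on the
  two-sided socle \<open>{y. J y = y J = 0}\<close>. By injectivity of the regular module, a nonzero element of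
  \<open>e\<^sub>j \<Lambda> e\<^sub>i\<close> in that socle is a multiple of the class of a maximal bound path from \<open>\<tau> j\<close> to \<open>j\<close>,
  and then \<open>i = \<tau> j\<close>. Hence the arrows of \<open>\<Lambda>'\<close> are those of \<open>Q\<close> and one arrow from \<open>j\<close> to \<open>\<tau> j\<close>
  for each vertex \<open>j\<close>.
\<close>

section \<open>Algebras over a field\<close>

text \<open>Beyond the radical, the quiver depends on the corners \<open>e j T e i\<close>. In the
  twisted dual, right multiplication by \<open>e i\<close> is precomposition with left
  multiplication by \<open>\<sigma> (e i)\<close>, and the theorem takes \<open>\<sigma>\<close> to
  fix the \<open>e i\<close>, so the corners are the untwisted ones; if \<open>\<sigma>\<close>
  permuted the vertices, the new arrow at \<open>i\<close> would end at \<open>\<tau>\<close> of the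
  image of \<open>i\<close>. Dualising swaps the two sides: a functional in \<open>e j D e i\<close>
  only sees the corner \<open>e i \<Lambda> e j\<close>, so a socle element from
  \<open>\<tau> i\<close> to \<open>i\<close> gives an arrow from \<open>i\<close> to
  \<open>\<tau> i\<close>.

  The algebra and its extension satisfy the same axioms: orthogonal idempotents with sum one and
  characters dual to them whose common kernel is nil. The radical and the primitivity of the
  idempotents are therefore settled once. Every basis claim is certified by dual functionals, with
  the subspace to be factored out as their common kernel, which avoids dimension counts. Finite
  dimension enters through a finite separating family of functionals and through the vanishing of
  long paths.\<close>

locale kalgebra = ring A for A :: "('k::field, 'r) module" (structure) +
  assumes smult_closed [simp, intro]: "x \<in> carrier A \<Longrightarrow> c \<odot> x \<in> carrier A"
    and smult_l_distr: "x \<in> carrier A \<Longrightarrow> (c + d) \<odot> x = c \<odot> x \<oplus> d \<odot> x"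
    and smult_r_distr: "x \<in> carrier A \<Longrightarrow> y \<in> carrier A \<Longrightarrow> c \<odot> (x \<oplus> y) = c \<odot> x \<oplus> c \<odot> y"
    and smult_smult: "x \<in> carrier A \<Longrightarrow> c \<odot> (d \<odot> x) = (c * d) \<odot> x"
    and smult_one [simp]: "x \<in> carrier A \<Longrightarrow> 1 \<odot> x = x"
    and smult_mult_l: "x \<in> carrier A \<Longrightarrow> y \<in> carrier A \<Longrightarrow> (c \<odot> x) \<otimes> y = c \<odot> (x \<otimes> y)"
    and smult_mult_r: "x \<in> carrier A \<Longrightarrow> y \<in> carrier A \<Longrightarrow> x \<otimes> (c \<odot> y) = c \<odot> (x \<otimes> y)"

text \<open>Unlike membership in \<open>dual_bimodule\<close>, this asks for no extensionality, so
  that coordinate functions such as \<open>\<chi> i\<close> qualify without being restricted to the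
  carrier.\<close>

definition functional :: "('k::field, 'r) module \<Rightarrow> ('r \<Rightarrow> 'k) \<Rightarrow> bool" where
  "functional A f \<longleftrightarrow>
    (\<forall>x\<in>carrier A. \<forall>y\<in>carrier A. f (x \<oplus>\<^bsub>A\<^esub> y) = f x + f y) \<and>
    (\<forall>c. \<forall>x\<in>carrier A. f (c \<odot>\<^bsub>A\<^esub> x) = c * f x)"

definition subspace :: "('k::field, 'r) module \<Rightarrow> 'r set \<Rightarrow> bool" where
  "subspace A U \<longleftrightarrow>
    U \<subseteq> carrier A \<and> \<zero>\<^bsub>A\<^esub> \<in> U \<and> (\<forall>x\<in>U. \<forall>y\<in>U. x \<oplus>\<^bsub>A\<^esub> y \<in> U) \<and> (\<forall>c. \<forall>x\<in>U. c \<odot>\<^bsub>A\<^esub> x \<in> U)"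

lemma functional_add:
  "functional A f \<Longrightarrow> x \<in> carrier A \<Longrightarrow> y \<in> carrier A \<Longrightarrow> f (x \<oplus>\<^bsub>A\<^esub> y) = f x + f y"
  by (simp add: functional_def)

lemma functional_smult:
  "functional A f \<Longrightarrow> x \<in> carrier A \<Longrightarrow> f (c \<odot>\<^bsub>A\<^esub> x) = c * f x"
  by (simp add: functional_def)

lemma subspaceD:
  assumes "subspace A U"
  shows "U \<subseteq> carrier A" "\<zero>\<^bsub>A\<^esub> \<in> U"
    "x \<in> U \<Longrightarrow> y \<in> U \<Longrightarrow> x \<oplus>\<^bsub>A\<^esub> y \<in> U" "x \<in> U \<Longrightarrow> c \<odot>\<^bsub>A\<^esub> x \<in> U"
  using assms by (auto simp: subspace_def)

context kalgebra
begin

lemma smult_zero_left [simp]: "x \<in> carrier A \<Longrightarrow> 0 \<odot> x = \<zero>"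
  using smult_l_distr[of x 0 0] add.l_cancel_one[of "0 \<odot> x" "0 \<odot> x"] by simp

lemma smult_zero_right [simp]: "c \<odot> \<zero> = \<zero>"
  using smult_r_distr[of \<zero> \<zero> c] add.l_cancel_one[of "c \<odot> \<zero>" "c \<odot> \<zero>"] by simp

lemma smult_minus_one: "x \<in> carrier A \<Longrightarrow> (-1) \<odot> x = \<ominus> x"
proof -
  assume x: "x \<in> carrier A"
  have "(-1) \<odot> x \<oplus> x = \<zero>"
    using smult_l_distr[of x "-1" 1] x by simp
  then show ?thesis using x by (simp add: minus_equality)
qed

lemma minus_eq_smult: "x \<in> carrier A \<Longrightarrow> y \<in> carrier A \<Longrightarrow> x \<ominus> y = x \<oplus> (-1) \<odot> y"
  by (simp add: smult_minus_one a_minus_def)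

lemma smult_eq_one_smult: "x \<in> carrier A \<Longrightarrow> c \<odot> x = (c \<odot> \<one>) \<otimes> x"
  by (simp add: smult_mult_l)

lemma smult_eq_zeroD:
  assumes "c \<odot> x = \<zero>" "c \<noteq> 0" "x \<in> carrier A"
  shows "x = \<zero>"
proof -
  have "inverse c \<odot> (c \<odot> x) = x" using assms(2,3) by (simp add: smult_smult)
  then show ?thesis using assms(1) by simp
qed

lemma functional_zero: "functional A f \<Longrightarrow> f \<zero> = 0"
  using functional_smult[of A f \<zero> 0] by simp

lemma functional_minus:
  "functional A f \<Longrightarrow> x \<in> carrier A \<Longrightarrow> y \<in> carrier A \<Longrightarrow> f (x \<ominus> y) = f x - f y"
  by (simp add: minus_eq_smult functional_add functional_smult)

lemma functional_finsum:
  assumes "functional A f" "finite I" "b \<in> I \<rightarrow> carrier A"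
  shows "f (\<Oplus>i\<in>I. b i) = (\<Sum>i\<in>I. f (b i))"
  using assms(2,3)
proof (induction I rule: finite_induct)
  case empty
  then show ?case by (simp add: functional_zero[OF assms(1)])
next
  case (insert i I)
  then show ?case by (simp add: functional_add[OF assms(1)] Pi_iff)
qed

lemma subspace_finsum:
  assumes "subspace A U" "finite I" "b \<in> I \<rightarrow> U"
  shows "(\<Oplus>i\<in>I. b i) \<in> U"
  using assms(2,3)
proof (induction I rule: finite_induct)
  case empty
  then show ?case by (simp add: subspaceD[OF assms(1)])
next
  case (insert i I)
  then have "b \<in> I \<rightarrow> carrier A" "b i \<in> carrier A" using subspaceD(1)[OF assms(1)] by auto
  with insert show ?case by (simp add: subspaceD[OF assms(1)])
qed

lemma subspace_minus:
  "subspace A U \<Longrightarrow> x \<in> U \<Longrightarrow> y \<in> U \<Longrightarrow> x \<ominus> y \<in> U"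
  using subspaceD[of A U] minus_eq_smult[of x y] by (simp add: subset_iff)

lemma subspace_carrier: "subspace A (carrier A)"
  by (simp add: subspace_def)

lemma ideal_of_subspace:
  assumes "subspace A I" "\<And>x a. x \<in> I \<Longrightarrow> a \<in> carrier A \<Longrightarrow> a \<otimes> x \<in> I"
    "\<And>x a. x \<in> I \<Longrightarrow> a \<in> carrier A \<Longrightarrow> x \<otimes> a \<in> I"
  shows "ideal I A"
proof -
  note I = subspaceD[OF assms(1)]
  have "\<ominus> x \<in> I" if "x \<in> I" for x
    using I(4)[OF that, of "-1"] that I(1) by (simp add: smult_minus_one subset_iff)
  then have "subgroup I (add_monoid A)"
    using I by (intro add.subgroupI) (auto simp: a_inv_def)
  then show ?thesis using assms(2,3) by (intro idealI ring_axioms)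
qed

text \<open>Applying \<open>\<phi> i\<close> to a combination of the \<open>b j\<close> reads off
  its coefficient at \<open>i\<close>. So the values \<open>\<phi> i x\<close> are the only
  coefficients that can work modulo the common kernel \<open>W\<close>, and they do work.\<close>

lemma basis_moduloI:
  assumes "finite I" "subspace A U" "\<And>i. i \<in> I \<Longrightarrow> b i \<in> U"
    and \<phi>: "\<And>i. i \<in> I \<Longrightarrow> functional A (\<phi> i)"
    and \<phi>b: "\<And>i j. i \<in> I \<Longrightarrow> j \<in> I \<Longrightarrow> \<phi> i (b j) = (if i = j then 1 else 0)"
    and W: "\<And>x. x \<in> U \<Longrightarrow> x \<in> W \<longleftrightarrow> (\<forall>i\<in>I. \<phi> i x = 0)"
  shows "basis_modulo A U W I b"
  unfolding basis_modulo_def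
proof (intro conjI ballI)
  fix x assume x: "x \<in> U"
  have bc: "b i \<in> carrier A" if "i \<in> I" for i
    using assms(3)[OF that] subspaceD(1)[OF assms(2)] by auto
  have comb: "(\<Oplus>i\<in>I. c i \<odot> b i) \<in> U" for c
    using assms(1-3) by (intro subspace_finsum) (auto intro: subspaceD(4))
  have \<phi>_comb: "\<phi> i (\<Oplus>i\<in>I. c i \<odot> b i) = c i" if i: "i \<in> I" for c i
  proof -
    have "\<phi> i (\<Oplus>i\<in>I. c i \<odot> b i) = (\<Sum>j\<in>I. \<phi> i (c j \<odot> b j))"
      using assms(1) bc by (intro functional_finsum \<phi> i) auto
    also have "\<dots> = (\<Sum>j\<in>I. if i = j then c j else 0)"
      by (intro sum.cong refl) (simp add: functional_smult[OF \<phi>[OF i]] bc \<phi>b i)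
    finally show ?thesis using assms(1) i by simp
  qed
  have iff: "x \<ominus> (\<Oplus>i\<in>I. c i \<odot> b i) \<in> W \<longleftrightarrow> (\<forall>i\<in>I. c i = \<phi> i x)" for c
  proof -
    have "x \<in> carrier A" "(\<Oplus>i\<in>I. c i \<odot> b i) \<in> carrier A"
      using x comb subspaceD(1)[OF assms(2)] by auto
    then show ?thesis
      using W[OF subspace_minus[OF assms(2) x comb]]
      by (auto simp: functional_minus[OF \<phi>] \<phi>_comb)
  qed
  show "\<exists>!c. c \<in> I \<rightarrow>\<^sub>E UNIV \<and> x \<ominus> (\<Oplus>i\<in>I. c i \<odot> b i) \<in> W"
  proof (rule ex1I[of _ "\<lambda>i\<in>I. \<phi> i x"])
    show "(\<lambda>i\<in>I. \<phi> i x) \<in> I \<rightarrow>\<^sub>E UNIV \<and> x \<ominus> (\<Oplus>i\<in>I. (\<lambda>i\<in>I. \<phi> i x) i \<odot> b i) \<in> W"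
      by (simp add: iff)
    fix c assume "c \<in> I \<rightarrow>\<^sub>E UNIV \<and> x \<ominus> (\<Oplus>i\<in>I. c i \<odot> b i) \<in> W"
    then show "c = (\<lambda>i\<in>I. \<phi> i x)"
      by (intro extensionalityI[of c I]) (auto simp: iff PiE_def)
  qed
qed (use assms(1,3) in auto)

end

section \<open>Split basic algebras\<close>

text \<open>The \<open>\<chi> i\<close> are the projections of the algebra onto the factors of its
  semisimple quotient, a product of copies of the field. Both the bound quiver algebra and its
  trivial extension are instances.\<close>

locale split_basic_algebra = kalgebra A for A :: "('k::field, 'r) module" (structure) +
  fixes V :: "'v set" and e :: "'v \<Rightarrow> 'r" and \<chi> :: "'v \<Rightarrow> 'r \<Rightarrow> 'k"
  assumes finite_V: "finite V"
    and e_closed [simp]: "i \<in> V \<Longrightarrow> e i \<in> carrier A"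
    and e_orth: "i \<in> V \<Longrightarrow> j \<in> V \<Longrightarrow> e i \<otimes> e j = (if i = j then e i else \<zero>)"
    and sum_e: "(\<Oplus>i\<in>V. e i) = \<one>"
    and functional_\<chi>: "i \<in> V \<Longrightarrow> functional A (\<chi> i)"
    and \<chi>_mult: "i \<in> V \<Longrightarrow> x \<in> carrier A \<Longrightarrow> y \<in> carrier A \<Longrightarrow> \<chi> i (x \<otimes> y) = \<chi> i x * \<chi> i y"
    and \<chi>_e: "i \<in> V \<Longrightarrow> j \<in> V \<Longrightarrow> \<chi> i (e j) = (if i = j then 1 else 0)"
    and nil: "x \<in> carrier A \<Longrightarrow> (\<And>i. i \<in> V \<Longrightarrow> \<chi> i x = 0) \<Longrightarrow> \<exists>n::nat. x [^] n = \<zero>"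
begin

text \<open>This kernel turns out to be the Jacobson radical
  (\<open>jacobson_radical_eq_rad\<close>); being given by linear equations, it is easy to compute
  with.\<close>

definition rad :: "'r set" where
  "rad = {x \<in> carrier A. \<forall>i\<in>V. \<chi> i x = 0}"

lemma rad_closed: "x \<in> rad \<Longrightarrow> x \<in> carrier A"
  by (simp add: rad_def)

lemma subspace_rad: "subspace A rad"
  by (auto simp: subspace_def rad_def functional_zero functional_add functional_smult functional_\<chi>)

lemma rad_mult_l [simp]: "x \<in> rad \<Longrightarrow> a \<in> carrier A \<Longrightarrow> a \<otimes> x \<in> rad"
  by (auto simp: rad_def \<chi>_mult)

lemma rad_mult_r [simp]: "x \<in> rad \<Longrightarrow> a \<in> carrier A \<Longrightarrow> x \<otimes> a \<in> rad"
  by (auto simp: rad_def \<chi>_mult)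

lemma \<chi>_one: "i \<in> V \<Longrightarrow> \<chi> i \<one> = 1"
  using \<chi>_mult[of i \<one> "e i"] by (simp add: \<chi>_e)

lemma \<chi>_pow: "i \<in> V \<Longrightarrow> x \<in> carrier A \<Longrightarrow> \<chi> i (x [^] (n::nat)) = \<chi> i x ^ n"
  by (induction n) (simp_all add: \<chi>_one \<chi>_mult)

text \<open>A character maps a nilpotent element to a nilpotent scalar, hence to 0; the converse is
  the axiom \<open>nil\<close>. Nilpotency does not mention the characters, so this is how
  \<open>rad\<close> is seen to be invariant under automorphisms.\<close>

lemma nilpotent_iff_rad: "x \<in> carrier A \<Longrightarrow> (\<exists>n::nat. x [^] n = \<zero>) \<longleftrightarrow> x \<in> rad"
proof
  assume x: "x \<in> carrier A" and "\<exists>n::nat. x [^] n = \<zero>"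
  then obtain n :: nat where "x [^] n = \<zero>" by blast
  then have "\<chi> i x ^ n = 0" if "i \<in> V" for i
    using \<chi>_pow[OF that x, of n] functional_zero[OF functional_\<chi>[OF that]] by simp
  then show "x \<in> rad" using x by (auto simp: rad_def)
qed (use nil in \<open>auto simp: rad_def\<close>)

lemma idempotent_rad: "x \<in> rad \<Longrightarrow> x \<otimes> x = x \<Longrightarrow> x = \<zero>"
proof -
  assume x: "x \<in> rad" "x \<otimes> x = x"
  obtain n :: nat where n: "x [^] n = \<zero>" using nilpotent_iff_rad x(1) rad_closed by blast
  \<comment> \<open>Positive exponents only: \<open>n\<close> may be 0, and then
    \<open>x [^] n\<close> is the unit and not \<open>x\<close>.\<close>
  have "x [^] Suc k = x" for k :: nat
    using x rad_closed[OF x(1)] by (induction k) simp_all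
  moreover have "x [^] Suc n = \<zero>" using n rad_closed[OF x(1)] by simp
  ultimately show ?thesis by metis
qed

section \<open>Identification with the Jacobson radical\<close>

lemma left_idealD:
  assumes "left_ideal I A"
  shows "I \<subseteq> carrier A" "\<zero> \<in> I" "x \<in> I \<Longrightarrow> y \<in> I \<Longrightarrow> x \<oplus> y \<in> I"
    "x \<in> I \<Longrightarrow> a \<in> carrier A \<Longrightarrow> a \<otimes> x \<in> I"
  using assms
  by (auto simp: left_ideal_def additive_subgroup.a_closed additive_subgroup.zero_closed
      dest: additive_subgroup.a_subset)

lemma left_idealI:
  assumes "I \<subseteq> carrier A" "\<zero> \<in> I" "\<And>x y. x \<in> I \<Longrightarrow> y \<in> I \<Longrightarrow> x \<oplus> y \<in> I"
    "\<And>x a. x \<in> I \<Longrightarrow> a \<in> carrier A \<Longrightarrow> a \<otimes> x \<in> I"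
  shows "left_ideal I A"
proof -
  have "\<ominus> x \<in> I" if "x \<in> I" for x
  proof -
    have "\<ominus> x = (\<ominus> \<one>) \<otimes> x" using that assms(1) by (auto simp: l_minus)
    then show ?thesis using assms(4) that by simp
  qed
  then have "additive_subgroup I A"
    using assms by (intro additive_subgroup.intro add.subgroupI) (auto simp: a_inv_def)
  then show ?thesis using assms by (simp add: left_ideal_def)
qed

lemma left_ideal_one: "left_ideal I A \<Longrightarrow> \<one> \<in> I \<Longrightarrow> I = carrier A"
  using left_idealD[of I] by (metis r_one subsetI subset_antisym)

text \<open>The kernel has codimension one: an element outside it can be rescaled to have value 1,
  and then differs from the unit by an element of the kernel.\<close>

lemma maximal_left_ideal_ker_\<chi>:
  assumes i: "i \<in> V"
  shows "maximal_left_ideal {x \<in> carrier A. \<chi> i x = 0} A"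
  unfolding maximal_left_ideal_def
proof (intro conjI allI impI)
  note f = functional_\<chi>[OF i]
  show "left_ideal {x \<in> carrier A. \<chi> i x = 0} A"
    by (intro left_idealI) (auto simp: functional_zero[OF f] functional_add[OF f] \<chi>_mult i)
  show "{x \<in> carrier A. \<chi> i x = 0} \<noteq> carrier A"
    using \<chi>_one[OF i] by force
  fix L assume L: "left_ideal L A \<and> {x \<in> carrier A. \<chi> i x = 0} \<subseteq> L"
  show "L = {x \<in> carrier A. \<chi> i x = 0} \<or> L = carrier A"
  proof (cases "L \<subseteq> {x \<in> carrier A. \<chi> i x = 0}")
    case False
    then obtain x where x: "x \<in> L" "\<chi> i x \<noteq> 0" "x \<in> carrier A" using left_idealD(1) L by auto
    define y where "y = inverse (\<chi> i x) \<odot> x"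
    have "y = (inverse (\<chi> i x) \<odot> \<one>) \<otimes> x" using x by (simp add: y_def smult_mult_l)
    then have "y \<in> L" using x L left_idealD(4) by simp
    moreover have "y \<in> carrier A" "\<chi> i y = 1"
      using x by (simp_all add: y_def functional_smult[OF f])
    ultimately have y: "y \<in> L" "y \<in> carrier A" "\<chi> i y = 1" .
    have "\<one> \<ominus> y \<in> L"
      using L y by (auto simp: functional_minus[OF f] \<chi>_one[OF i])
    then have "(\<one> \<ominus> y) \<oplus> y \<in> L" using left_idealD(3) L y by blast
    moreover have "(\<one> \<ominus> y) \<oplus> y = \<one>" using y by (simp add: minus_eq a_assoc l_neg)
    ultimately show ?thesis using left_ideal_one L by auto
  qed (use L in auto)
qed

text \<open>If \<open>x\<close> were not in \<open>I\<close>, maximality would write the unit as an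
  element of \<open>I\<close> plus a left multiple \<open>y\<close> of \<open>x\<close>. As
  \<open>y\<close> is nilpotent, this forces the unit into \<open>I\<close>.\<close>

lemma rad_subset_maximal_left_ideal:
  assumes I: "maximal_left_ideal I A" and x: "x \<in> rad"
  shows "x \<in> I"
proof (rule ccontr)
  assume "x \<notin> I"
  have li: "left_ideal I A" and ne: "I \<noteq> carrier A" using I by (auto simp: maximal_left_ideal_def)
  note I' = left_idealD[OF li]
  define L where "L = {m \<oplus> a \<otimes> x | m a. m \<in> I \<and> a \<in> carrier A}"
  have xc: "x \<in> carrier A" using x by (rule rad_closed)
  have "left_ideal L A"
  proof (rule left_idealI)
    show "L \<subseteq> carrier A" using I'(1) xc by (auto simp: L_def)
    show "\<zero> \<in> L" unfolding L_def using I'(2) xc by (force intro: exI[of _ \<zero>])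
    fix y assume "y \<in> L"
    then obtain m a where y: "y = m \<oplus> a \<otimes> x" "m \<in> I" "a \<in> carrier A" by (auto simp: L_def)
    have m: "m \<in> carrier A" using y I' by auto
    {
      fix z assume "z \<in> L"
      then obtain m' a' where z: "z = m' \<oplus> a' \<otimes> x" "m' \<in> I" "a' \<in> carrier A"
        by (auto simp: L_def)
      have m': "m' \<in> carrier A" using z I' by auto
      have "y \<oplus> z = (m \<oplus> m') \<oplus> (a \<oplus> a') \<otimes> x"
        using y z xc m m' by (simp add: l_distr a_ac)
      then show "y \<oplus> z \<in> L" unfolding L_def using y z I' by blast
    }
    fix b assume b: "b \<in> carrier A"
    have "b \<otimes> y = b \<otimes> m \<oplus> (b \<otimes> a) \<otimes> x" using y m b xc by (simp add: r_distr m_assoc)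
    then show "b \<otimes> y \<in> L" unfolding L_def using y b I' by blast
  qed
  moreover have "I \<subseteq> L"
  proof
    fix m assume "m \<in> I"
    moreover have "m \<oplus> \<zero> \<otimes> x = m" using xc \<open>m \<in> I\<close> I' by auto
    ultimately show "m \<in> L" unfolding L_def by force
  qed
  moreover have "x \<in> L"
  proof -
    have "x = \<zero> \<oplus> \<one> \<otimes> x" using xc by simp
    then show ?thesis unfolding L_def using I'(2) by blast
  qed
  ultimately have "L = carrier A"
    using I \<open>x \<notin> I\<close> unfolding maximal_left_ideal_def by blast
  then obtain m a where ma: "\<one> = m \<oplus> a \<otimes> x" "m \<in> I" "a \<in> carrier A"
    unfolding L_def using one_closed by blast
  define y where "y = a \<otimes> x"
  have y: "y \<in> rad" "y \<in> carrier A" using ma x xc by (auto simp: y_def)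
  have my: "\<one> \<ominus> y = m" using ma y I' by (auto simp: y_def minus_eq a_assoc r_neg)
  \<comment> \<open>This replaces the geometric series: passing from \<open>k\<close> to
    \<open>Suc k\<close> adds \<open>y [^] k\<close> times \<open>\<one> \<ominus> y\<close>, which
    lies in the left ideal.\<close>
  have "\<one> \<ominus> y [^] k \<in> I" for k :: nat
  proof (induction k)
    case 0
    then show ?case using I' by (simp add: minus_eq r_neg)
  next
    case (Suc k)
    have "y [^] k \<otimes> (\<one> \<ominus> y) = y [^] k \<ominus> y [^] Suc k"
      using y by (simp add: minus_eq r_distr r_minus)
    then have "\<one> \<ominus> y [^] Suc k = (\<one> \<ominus> y [^] k) \<oplus> y [^] k \<otimes> (\<one> \<ominus> y)"
      using y by (simp add: minus_eq a_assoc) (simp add: a_assoc[symmetric] l_neg)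
    then show ?case using Suc I' ma my y by auto
  qed
  moreover obtain n :: nat where "y [^] n = \<zero>" using nilpotent_iff_rad y by blast
  ultimately have "\<one> \<in> I" by (metis minus_eq minus_zero one_closed r_zero)
  then show False using left_ideal_one li ne by blast
qed

lemma jacobson_radical_eq_rad: "jacobson_radical A = rad"
  using rad_subset_maximal_left_ideal maximal_left_ideal_ker_\<chi>
  unfolding jacobson_radical_def by (auto simp: rad_def)

lemma e_nonzero: "i \<in> V \<Longrightarrow> e i \<noteq> \<zero>"
  using \<chi>_e[of i i] functional_zero[OF functional_\<chi>, of i] by auto

text \<open>In an orthogonal splitting of \<open>e i\<close>, all characters except
  \<open>\<chi> i\<close> vanish on both summands, and \<open>\<chi> i\<close> vanishes on one of
  them. That summand is an idempotent in \<open>rad\<close>, hence zero.\<close>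

lemma primitive_idempotent_e:
  assumes i: "i \<in> V"
  shows "primitive_idempotent A (e i)"
  unfolding primitive_idempotent_def
proof (intro conjI ballI impI)
  fix f g
  assume fg: "f \<in> carrier A" "g \<in> carrier A"
    and H: "f \<otimes> f = f \<and> g \<otimes> g = g \<and> f \<otimes> g = \<zero> \<and> g \<otimes> f = \<zero> \<and> e i = f \<oplus> g"
  have ij: "\<chi> j f = 0 \<and> \<chi> j g = (if i = j then 1 else 0) \<or>
      \<chi> j g = 0 \<and> \<chi> j f = (if i = j then 1 else 0)" if j: "j \<in> V" for j
  proof -
    have "\<chi> j f * \<chi> j g = 0"
      using \<chi>_mult[OF j fg] H functional_zero[OF functional_\<chi>[OF j]] by simp
    moreover have "\<chi> j f + \<chi> j g = (if i = j then 1 else 0)"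
      using \<chi>_e[OF j i] H functional_add[OF functional_\<chi>[OF j] fg] by (auto split: if_splits)
    ultimately show ?thesis by auto
  qed
  then have "f \<in> rad \<or> g \<in> rad"
    using fg i unfolding rad_def by (smt (verit, best) mem_Collect_eq)
  then show "f = \<zero> \<or> g = \<zero>" using idempotent_rad H by blast
qed (use i e_orth[OF i i] e_nonzero in auto)

lemma complete_primitive_idempotents_e: "complete_primitive_idempotents A V e"
  by (simp add: complete_primitive_idempotents_def finite_V primitive_idempotent_e e_orth sum_e)

lemma basis_modulo_rad: "basis_modulo A (carrier A) rad V e"
  by (rule basis_moduloI[where \<phi> = \<chi>])
    (auto simp: finite_V subspace_carrier functional_\<chi> \<chi>_e rad_def)

end

section \<open>The dual space\<close>

lemma carrier_dual_iff:
  "f \<in> carrier (dual_bimodule A) \<longleftrightarrow> f \<in> extensional (carrier A) \<and> functional A f"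
  by (auto simp: dual_bimodule_def functional_def PiE_def)

lemma dual_eqI:
  assumes "f \<in> carrier (dual_bimodule A)" "g \<in> carrier (dual_bimodule A)"
    and "\<And>x. x \<in> carrier A \<Longrightarrow> f x = g x"
  shows "f = g"
  using assms by (intro extensionalityI[of f "carrier A"]) (auto simp: carrier_dual_iff)

lemma dual_functional: "f \<in> carrier (dual_bimodule A) \<Longrightarrow> functional A f"
  by (simp add: carrier_dual_iff)

context kalgebra
begin

lemma functional_restrict: "functional A f \<Longrightarrow> (\<lambda>x\<in>carrier A. f x) \<in> carrier (dual_bimodule A)"
  by (auto simp: carrier_dual_iff functional_def)

lemma dual_zero_closed: "(\<lambda>x\<in>carrier A. 0) \<in> carrier (dual_bimodule A)"
  by (auto simp: carrier_dual_iff functional_def)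

lemma dual_add_closed:
  assumes "f \<in> carrier (dual_bimodule A)" "g \<in> carrier (dual_bimodule A)"
  shows "(\<lambda>x\<in>carrier A. f x + g x) \<in> carrier (dual_bimodule A)"
  using assms by (auto simp: carrier_dual_iff functional_def algebra_simps)

lemma dual_smult_closed:
  assumes "f \<in> carrier (dual_bimodule A)"
  shows "(\<lambda>x\<in>carrier A. c * f x) \<in> carrier (dual_bimodule A)"
  using assms by (auto simp: carrier_dual_iff functional_def algebra_simps)

lemma dual_uminus_closed:
  assumes "f \<in> carrier (dual_bimodule A)"
  shows "(\<lambda>x\<in>carrier A. - f x) \<in> carrier (dual_bimodule A)"
  using assms by (auto simp: carrier_dual_iff functional_def)

lemma dual_lact_closed:
  assumes "f \<in> carrier (dual_bimodule A)" "a \<in> carrier A"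
  shows "(\<lambda>x\<in>carrier A. f (x \<otimes> a)) \<in> carrier (dual_bimodule A)"
  using assms by (auto simp: carrier_dual_iff functional_def l_distr smult_mult_l)

lemma dual_ract_closed:
  assumes "f \<in> carrier (dual_bimodule A)" "a \<in> carrier A"
  shows "(\<lambda>x\<in>carrier A. f (a \<otimes> x)) \<in> carrier (dual_bimodule A)"
  using assms by (auto simp: carrier_dual_iff functional_def r_distr smult_mult_r)

lemma smult_finsum:
  "finite I \<Longrightarrow> b \<in> I \<rightarrow> carrier A \<Longrightarrow> c \<odot> (\<Oplus>i\<in>I. b i) = (\<Oplus>i\<in>I. c \<odot> b i)"
  by (induction I rule: finite_induct) (simp_all add: smult_r_distr Pi_iff)

text \<open>A spanning set of least size is a basis; its coordinate functions do the job.\<close>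

lemma finite_separating_functionals:
  assumes "finite_dimensional A"
  obtains G where "finite G" "G \<subseteq> carrier (dual_bimodule A)"
    "\<forall>x\<in>carrier A. (\<forall>g\<in>G. g x = 0) \<longrightarrow> x = \<zero>"
proof -
  let ?spans = "\<lambda>B. finite B \<and> B \<subseteq> carrier A \<and>
    (\<forall>x\<in>carrier A. \<exists>c. x = (\<Oplus>b\<in>B. c b \<odot> b))"
  obtain B where B: "?spans B" and least: "\<And>B'. ?spans B' \<Longrightarrow> card B \<le> card B'"
  proof -
    obtain B0 where "?spans B0" using assms unfolding finite_dimensional_def by blast
    from ex_has_least_nat[of ?spans, OF this, of card] that show thesis by (elim exE conjE) presburger
  qed
  have fin: "finite B" and Bc: "B \<subseteq> carrier A" using B by auto
  define L where "L c = (\<Oplus>b\<in>B. c b \<odot> b)" for c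
  have cB: "(\<lambda>b. c b \<odot> b) \<in> B \<rightarrow> carrier A" for c using Bc by auto
  have L_closed: "L c \<in> carrier A" for c unfolding L_def by (intro finsum_closed cB)
  have L_add: "L (\<lambda>b. c b + d b) = L c \<oplus> L d" for c d
    unfolding L_def finsum_addf[OF cB cB, symmetric]
    using Bc by (intro finsum_cong') (auto simp: smult_l_distr)
  have L_smult: "L (\<lambda>b. k * c b) = k \<odot> L c" for k c
    unfolding L_def smult_finsum[OF fin cB]
    using Bc by (intro finsum_cong') (auto simp: smult_smult)
  have indep: "c b = 0" if Lc: "L c = \<zero>" and b: "b \<in> B" for c b
  proof (rule ccontr)
    assume nz: "c b \<noteq> 0"
    have "?spans (B - {b})"
    proof (intro conjI ballI)
      fix x assume "x \<in> carrier A"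
      then obtain d where d: "x = L d" using B unfolding L_def by blast
      define d' where "d' = (\<lambda>a. d a + (- (d b / c b)) * c a)"
      have "L d' = L d" unfolding d'_def L_add L_smult Lc by (simp add: L_closed)
      moreover have "L d' = (\<Oplus>a\<in>insert b (B - {b}). d' a \<odot> a)"
        using b by (simp add: L_def insert_absorb)
      moreover have "\<dots> = d' b \<odot> b \<oplus> (\<Oplus>a\<in>B - {b}. d' a \<odot> a)"
        using b Bc fin by (intro finsum_insert) auto
      moreover have "d' b = 0" using nz by (simp add: d'_def)
      moreover have "(\<Oplus>a\<in>B - {b}. d' a \<odot> a) \<in> carrier A" using Bc by (intro finsum_closed) auto
      ultimately have "x = (\<Oplus>a\<in>B - {b}. d' a \<odot> a)" using d b Bc by auto
      then show "\<exists>c. x = (\<Oplus>a\<in>B - {b}. c a \<odot> a)" by blast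
    qed (use fin Bc in auto)
    then show False using least fin b by (metis card_Diff1_less not_le)
  qed
  \<comment> \<open>Any choice of coordinates is linear in \<open>x\<close>, because by independence
    the coordinates on \<open>B\<close> are unique.\<close>
  define coef where "coef x = (SOME c. x = L c)" for x
  have L_coef: "L (coef x) = x" if "x \<in> carrier A" for x
    using B that someI_ex[of "\<lambda>c. x = L c"] unfolding coef_def L_def by metis
  have L_inj: "c b = d b" if Lcd: "L c = L d" and b: "b \<in> B" for c d b
  proof -
    have "L (\<lambda>b. c b + (-1) * d b) = \<zero>"
      unfolding L_add L_smult Lcd by (simp add: L_closed smult_minus_one r_neg)
    from indep[OF this b] show ?thesis by simp
  qed
  have coef_functional: "functional A (\<lambda>x. coef x b)" if b: "b \<in> B" for b
    unfolding functional_def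
  proof (intro conjI ballI allI)
    fix x y assume "x \<in> carrier A" "y \<in> carrier A"
    then have "L (coef (x \<oplus> y)) = L (\<lambda>b. coef x b + coef y b)" by (simp add: L_coef L_add)
    then show "coef (x \<oplus> y) b = coef x b + coef y b" using L_inj b by blast
  next
    fix c x assume "x \<in> carrier A"
    then have "L (coef (c \<odot> x)) = L (\<lambda>b. c * coef x b)" by (simp add: L_coef L_smult)
    then show "coef (c \<odot> x) b = c * coef x b" using L_inj b by blast
  qed
  show thesis
  proof (rule that[of "(\<lambda>b. \<lambda>x\<in>carrier A. coef x b) ` B"])
    show "(\<lambda>b. \<lambda>x\<in>carrier A. coef x b) ` B \<subseteq> carrier (dual_bimodule A)"
      using coef_functional functional_restrict by blast
    show "\<forall>x\<in>carrier A. (\<forall>g\<in>(\<lambda>b. \<lambda>x\<in>carrier A. coef x b) ` B. g x = 0) \<longrightarrow> x = \<zero>"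
    proof (intro ballI impI)
      fix x assume x: "x \<in> carrier A" "\<forall>g\<in>(\<lambda>b. \<lambda>x\<in>carrier A. coef x b) ` B. g x = 0"
      then have "coef x b = 0" if "b \<in> B" for b using that by auto
      then have "L (coef x) = (\<Oplus>b\<in>B. \<zero>)"
        unfolding L_def using Bc by (intro finsum_cong') auto
      then show "x = \<zero>" using L_coef[OF x(1)] by simp
    qed
  qed (use fin in auto)
qed

text \<open>The classical fact that a functional vanishing on the common kernel of finitely many
  others lies in their span. The span is replaced by any subspace \<open>W\<close> containing them,
  and \<open>S\<close> is variable because the induction passes to the kernel of one functional
  inside \<open>S\<close>.\<close>

lemma functional_in_span:
  assumes "finite G" "G \<subseteq> carrier (dual_bimodule A)" "f \<in> carrier (dual_bimodule A)"
    and W: "G \<subseteq> W" "W \<subseteq> carrier (dual_bimodule A)" "(\<lambda>x\<in>carrier A. 0) \<in> W"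
      "\<And>g h. g \<in> W \<Longrightarrow> h \<in> W \<Longrightarrow> (\<lambda>x\<in>carrier A. g x + h x) \<in> W"
      "\<And>c g. g \<in> W \<Longrightarrow> (\<lambda>x\<in>carrier A. c * g x) \<in> W"
    and "subspace A S" "\<And>x. x \<in> S \<Longrightarrow> \<forall>g\<in>G. g x = 0 \<Longrightarrow> f x = 0"
  shows "\<exists>w\<in>W. \<forall>x\<in>S. f x = w x"
  using assms(1,2) W(1) assms(9,10)
proof (induction G arbitrary: S rule: finite_induct)
  case empty
  then show ?case using W(3) subspaceD(1)[OF empty(3)] by (intro bexI[OF _ W(3)]) auto
next
  case (insert g G)
  note S = subspaceD[OF insert.prems(3)]
  have g: "functional A g" and f: "functional A f"
    using insert.prems(1) assms(3) dual_functional by auto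
  have S': "subspace A {x \<in> S. g x = 0}"
    using S functional_zero[OF g] functional_add[OF g] functional_smult[OF g]
    by (auto simp: subspace_def subset_iff)
  obtain w where w: "w \<in> W" "\<And>x. x \<in> S \<Longrightarrow> g x = 0 \<Longrightarrow> f x = w x"
    using insert.IH[OF _ _ S'] insert.prems by auto
  have wf: "functional A w" using w W(2) dual_functional by blast
  show ?case
  proof (cases "\<forall>x\<in>S. g x = 0")
    case False
    then obtain z where z: "z \<in> S" "g z \<noteq> 0" by blast
    \<comment> \<open>With this constant \<open>w\<close> plus \<open>c\<close> times
      \<open>g\<close> agrees with \<open>f\<close> at \<open>z\<close>; every other point of
      \<open>S\<close> differs from a multiple of \<open>z\<close> by a point where \<open>g\<close>
      vanishes.\<close>
    define c where "c = (f z - w z) / g z"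
    have "f x = w x + c * g x" if x: "x \<in> S" for x
    proof -
      have xz: "x \<in> carrier A" "z \<in> carrier A" using x z S by auto
      let ?y = "x \<ominus> (g x / g z) \<odot> z"
      have "?y \<in> S" by (rule subspace_minus[OF insert.prems(3) x S(4)[OF z(1)]])
      moreover have "g ?y = 0"
        using z xz by (simp add: functional_minus[OF g] functional_smult[OF g])
      ultimately have "f ?y = w ?y" using w by blast
      then have "f x - (g x / g z) * f z = w x - (g x / g z) * w z"
        using xz by (simp add: functional_minus[OF f] functional_smult[OF f]
            functional_minus[OF wf] functional_smult[OF wf])
      then show ?thesis using z by (simp add: c_def field_simps)
    qed
    moreover have "(\<lambda>x\<in>carrier A. w x + (\<lambda>x\<in>carrier A. c * g x) x) \<in> W"
      using insert.prems(2) by (intro W(4) W(5) w(1)) auto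
    moreover have "x \<in> carrier A" if "x \<in> S" for x using that S(1) by auto
    ultimately show ?thesis
      by (intro bexI[of _ "\<lambda>x\<in>carrier A. w x + (\<lambda>x\<in>carrier A. c * g x) x"] ballI) simp_all
  qed (use w in blast)
qed

text \<open>The functionals \<open>g (x \<otimes> y)\<close> and \<open>g (y \<otimes> x)\<close>,
  with \<open>g\<close> from a finite separating family and \<open>y\<close> in \<open>Y\<close>,
  form a finite set whose common kernel is the two-sided annihilator of \<open>Y\<close>. In the
  application, \<open>W\<close> consists of the functionals that lie in the radical square of the
  extension.\<close>

lemma functional_in_action_span:
  assumes "finite_dimensional A" "finite Y" "Y \<subseteq> carrier A" "f \<in> carrier (dual_bimodule A)"
    and W: "W \<subseteq> carrier (dual_bimodule A)" "(\<lambda>x\<in>carrier A. 0) \<in> W"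
      "\<And>g h. g \<in> W \<Longrightarrow> h \<in> W \<Longrightarrow> (\<lambda>x\<in>carrier A. g x + h x) \<in> W"
      "\<And>c g. g \<in> W \<Longrightarrow> (\<lambda>x\<in>carrier A. c * g x) \<in> W"
    and YW: "\<And>y g. y \<in> Y \<Longrightarrow> g \<in> carrier (dual_bimodule A) \<Longrightarrow> (\<lambda>x\<in>carrier A. g (x \<otimes> y)) \<in> W"
      "\<And>y g. y \<in> Y \<Longrightarrow> g \<in> carrier (dual_bimodule A) \<Longrightarrow> (\<lambda>x\<in>carrier A. g (y \<otimes> x)) \<in> W"
    and f0: "\<And>x. x \<in> carrier A \<Longrightarrow> (\<And>y. y \<in> Y \<Longrightarrow> x \<otimes> y = \<zero> \<and> y \<otimes> x = \<zero>) \<Longrightarrow> f x = 0"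
  shows "f \<in> W"
proof -
  obtain G where G: "finite G" "G \<subseteq> carrier (dual_bimodule A)"
    and sep: "\<forall>x\<in>carrier A. (\<forall>g\<in>G. g x = 0) \<longrightarrow> x = \<zero>"
    using finite_separating_functionals[OF assms(1)] .
  define H where "H = (\<lambda>(g, y). \<lambda>x\<in>carrier A. g (x \<otimes> y)) ` (G \<times> Y) \<union>
    (\<lambda>(g, y). \<lambda>x\<in>carrier A. g (y \<otimes> x)) ` (G \<times> Y)"
  have "\<exists>w\<in>W. \<forall>x\<in>carrier A. f x = w x"
  proof (rule functional_in_span[where G = H, OF _ _ assms(4) _ W subspace_carrier])
    show "finite H" using G assms(2) by (simp add: H_def)
    have "(\<lambda>x\<in>carrier A. g (x \<otimes> y)) \<in> W" "(\<lambda>x\<in>carrier A. g (y \<otimes> x)) \<in> W"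
      if "g \<in> G" "y \<in> Y" for g y
      using YW that G(2) by auto
    then show "H \<subseteq> W" unfolding H_def by auto
    then show "H \<subseteq> carrier (dual_bimodule A)" using W(1) by blast
    fix x assume x: "x \<in> carrier A" and H0: "\<forall>h\<in>H. h x = 0"
    show "f x = 0"
    proof (rule f0[OF x])
      fix y assume y: "y \<in> Y"
      have yc: "y \<in> carrier A" using y assms(3) by auto
      have "g (x \<otimes> y) = 0 \<and> g (y \<otimes> x) = 0" if g: "g \<in> G" for g
      proof -
        have "(\<lambda>x\<in>carrier A. g (x \<otimes> y)) \<in> H" "(\<lambda>x\<in>carrier A. g (y \<otimes> x)) \<in> H"
          using g y unfolding H_def by force+
        then show ?thesis using H0 x by force
      qed
      moreover have "x \<otimes> y \<in> carrier A" "y \<otimes> x \<in> carrier A" using x yc by simp_all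
      ultimately show "x \<otimes> y = \<zero> \<and> y \<otimes> x = \<zero>" using sep by blast
    qed
  qed
  then obtain w where "w \<in> W" "\<And>x. x \<in> carrier A \<Longrightarrow> f x = w x" by blast
  then show ?thesis using dual_eqI[OF assms(4), of w] W(1) by auto
qed

end

section \<open>Twisted trivial extensions\<close>

locale twisted_kalgebra = kalgebra A for A :: "('k::field, 'r) module" (structure) +
  fixes \<sigma> :: "'r \<Rightarrow> 'r"
  assumes \<sigma>_hom: "\<sigma> \<in> ring_hom A A"
    and \<sigma>_smult: "x \<in> carrier A \<Longrightarrow> \<sigma> (c \<odot> x) = c \<odot> \<sigma> x"
begin

abbreviation D where "D \<equiv> dual_bimodule A"
abbreviation T where "T \<equiv> trivial_extension A (twist \<sigma> D)"

lemma \<sigma>_closed [simp]: "x \<in> carrier A \<Longrightarrow> \<sigma> x \<in> carrier A"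
  using ring_hom_closed[OF \<sigma>_hom] .

lemma \<sigma>_mult: "x \<in> carrier A \<Longrightarrow> y \<in> carrier A \<Longrightarrow> \<sigma> (x \<otimes> y) = \<sigma> x \<otimes> \<sigma> y"
  using ring_hom_mult[OF \<sigma>_hom] .

lemma \<sigma>_add: "x \<in> carrier A \<Longrightarrow> y \<in> carrier A \<Longrightarrow> \<sigma> (x \<oplus> y) = \<sigma> x \<oplus> \<sigma> y"
  using ring_hom_add[OF \<sigma>_hom] .

lemma \<sigma>_one [simp]: "\<sigma> \<one> = \<one>"
  using ring_hom_one[OF \<sigma>_hom] .

lemma \<sigma>_zero [simp]: "\<sigma> \<zero> = \<zero>"
  using \<sigma>_smult[of \<one> 0] by simp

lemma T_simps:
  "carrier T = carrier A \<times> carrier D"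
  "\<zero>\<^bsub>T\<^esub> = (\<zero>, \<lambda>x\<in>carrier A. 0)"
  "\<one>\<^bsub>T\<^esub> = (\<one>, \<lambda>x\<in>carrier A. 0)"
  "(a, f) \<oplus>\<^bsub>T\<^esub> (b, g) = (a \<oplus> b, \<lambda>x\<in>carrier A. f x + g x)"
  "c \<odot>\<^bsub>T\<^esub> (a, f) = (c \<odot> a, \<lambda>x\<in>carrier A. c * f x)"
  by (simp_all add: trivial_extension_def twist_def dual_bimodule_def)

lemma T_mult:
  "(a, f) \<otimes>\<^bsub>T\<^esub> (b, g) = (a \<otimes> b, \<lambda>x\<in>carrier A. g (x \<otimes> a) + f (\<sigma> b \<otimes> x))"
  by (auto simp: trivial_extension_def twist_def dual_bimodule_def)

lemma T_mult_closed:
  assumes "a \<in> carrier A" "f \<in> carrier D" "b \<in> carrier A" "g \<in> carrier D"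
  shows "(\<lambda>x\<in>carrier A. g (x \<otimes> a) + f (\<sigma> b \<otimes> x)) \<in> carrier D"
proof -
  have "(\<lambda>x\<in>carrier A. (\<lambda>x\<in>carrier A. g (x \<otimes> a)) x + (\<lambda>x\<in>carrier A. f (\<sigma> b \<otimes> x)) x) \<in> carrier D"
    using assms by (intro dual_add_closed dual_lact_closed dual_ract_closed) auto
  moreover have "(\<lambda>x\<in>carrier A. (\<lambda>x\<in>carrier A. g (x \<otimes> a)) x + (\<lambda>x\<in>carrier A. f (\<sigma> b \<otimes> x)) x)
     = (\<lambda>x\<in>carrier A. g (x \<otimes> a) + f (\<sigma> b \<otimes> x))" by auto
  ultimately show ?thesis by simp
qed

lemma dual_zero: "f \<in> carrier D \<Longrightarrow> f \<zero> = 0"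
  by (rule functional_zero[OF dual_functional])

lemma dual_restrict: "f \<in> carrier D \<Longrightarrow> restrict f (carrier A) = f"
  by (simp add: carrier_dual_iff extensional_restrict)

lemma dual_add: "f \<in> carrier D \<Longrightarrow> x \<in> carrier A \<Longrightarrow> y \<in> carrier A \<Longrightarrow> f (x \<oplus> y) = f x + f y"
  by (rule functional_add[OF dual_functional])

lemma dual_smult: "f \<in> carrier D \<Longrightarrow> x \<in> carrier A \<Longrightarrow> f (c \<odot> x) = c * f x"
  by (rule functional_smult[OF dual_functional])

lemma ring_T: "ring T"
proof (rule ringI)
  show "abelian_group T"
  proof (rule abelian_groupI)
    fix u assume "u \<in> carrier T"
    then obtain a f where u: "u = (a, f)" "a \<in> carrier A" "f \<in> carrier D" by (auto simp: T_simps)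
    have "(\<ominus> a, \<lambda>x\<in>carrier A. - f x) \<in> carrier T"
      using u by (simp add: T_simps dual_uminus_closed)
    moreover have "(\<ominus> a, \<lambda>x\<in>carrier A. - f x) \<oplus>\<^bsub>T\<^esub> u = \<zero>\<^bsub>T\<^esub>"
      using u by (auto simp: T_simps l_neg)
    ultimately show "\<exists>y\<in>carrier T. y \<oplus>\<^bsub>T\<^esub> u = \<zero>\<^bsub>T\<^esub>" by blast
  qed (auto simp: T_simps dual_add_closed dual_zero_closed a_ac dual_restrict add_ac
        cong: restrict_cong)
  show "monoid T"
  proof (rule monoidI)
    fix u v w assume "u \<in> carrier T" "v \<in> carrier T" "w \<in> carrier T"
    then obtain a f b g c h where uvw: "u = (a, f)" "a \<in> carrier A" "f \<in> carrier D"
      "v = (b, g)" "b \<in> carrier A" "g \<in> carrier D" "w = (c, h)" "c \<in> carrier A" "h \<in> carrier D"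
      by (auto simp: T_simps)
    show "u \<otimes>\<^bsub>T\<^esub> v \<otimes>\<^bsub>T\<^esub> w = u \<otimes>\<^bsub>T\<^esub> (v \<otimes>\<^bsub>T\<^esub> w)"
      using uvw by (auto simp: T_mult m_assoc \<sigma>_mult add_ac cong: restrict_cong)
  qed (auto simp: T_simps T_mult T_mult_closed dual_zero_closed dual_restrict
        cong: restrict_cong)
  fix u v w assume "u \<in> carrier T" "v \<in> carrier T" "w \<in> carrier T"
  then obtain a f b g c h where uvw: "u = (a, f)" "a \<in> carrier A" "f \<in> carrier D"
    "v = (b, g)" "b \<in> carrier A" "g \<in> carrier D" "w = (c, h)" "c \<in> carrier A" "h \<in> carrier D"
    by (auto simp: T_simps)
  show "(u \<oplus>\<^bsub>T\<^esub> v) \<otimes>\<^bsub>T\<^esub> w = u \<otimes>\<^bsub>T\<^esub> w \<oplus>\<^bsub>T\<^esub> v \<otimes>\<^bsub>T\<^esub> w"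
    using uvw by (auto simp: T_mult T_simps l_distr r_distr dual_add[OF uvw(9)] add_ac cong: restrict_cong)
  show "w \<otimes>\<^bsub>T\<^esub> (u \<oplus>\<^bsub>T\<^esub> v) = w \<otimes>\<^bsub>T\<^esub> u \<oplus>\<^bsub>T\<^esub> w \<otimes>\<^bsub>T\<^esub> v"
    using uvw by (auto simp: T_mult T_simps l_distr r_distr dual_add[OF uvw(9)] \<sigma>_add add_ac cong: restrict_cong)
qed

lemma kalgebra_T: "kalgebra T"
proof -
  interpret T: ring T by (rule ring_T)
  show ?thesis
  proof
    fix u v :: "'r \<times> ('r \<Rightarrow> 'k)" and c d
    assume "u \<in> carrier T"
    then obtain a f where u: "u = (a, f)" "a \<in> carrier A" "f \<in> carrier D" by (auto simp: T_simps)
    show "c \<odot>\<^bsub>T\<^esub> u \<in> carrier T" using u by (simp add: T_simps dual_smult_closed)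
    show "(c + d) \<odot>\<^bsub>T\<^esub> u = c \<odot>\<^bsub>T\<^esub> u \<oplus>\<^bsub>T\<^esub> d \<odot>\<^bsub>T\<^esub> u"
      using u by (auto simp: T_simps smult_l_distr distrib_right cong: restrict_cong)
    show "c \<odot>\<^bsub>T\<^esub> (d \<odot>\<^bsub>T\<^esub> u) = (c * d) \<odot>\<^bsub>T\<^esub> u"
      using u by (auto simp: T_simps smult_smult mult.assoc cong: restrict_cong)
    show "1 \<odot>\<^bsub>T\<^esub> u = u"
      using u by (auto simp: T_simps dual_restrict cong: restrict_cong)
    assume "v \<in> carrier T"
    then obtain b g where v: "v = (b, g)" "b \<in> carrier A" "g \<in> carrier D" by (auto simp: T_simps)
    show "c \<odot>\<^bsub>T\<^esub> (u \<oplus>\<^bsub>T\<^esub> v) = c \<odot>\<^bsub>T\<^esub> u \<oplus>\<^bsub>T\<^esub> c \<odot>\<^bsub>T\<^esub> v"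
      using u v by (auto simp: T_simps smult_r_distr distrib_left cong: restrict_cong)
    show "(c \<odot>\<^bsub>T\<^esub> u) \<otimes>\<^bsub>T\<^esub> v = c \<odot>\<^bsub>T\<^esub> (u \<otimes>\<^bsub>T\<^esub> v)"
      using u v by (auto simp: T_simps T_mult smult_mult_l smult_mult_r dual_smult[OF u(3)] dual_smult[OF v(3)] distrib_left
          cong: restrict_cong)
    show "u \<otimes>\<^bsub>T\<^esub> (c \<odot>\<^bsub>T\<^esub> v) = c \<odot>\<^bsub>T\<^esub> (u \<otimes>\<^bsub>T\<^esub> v)"
      using u v by (auto simp: T_simps T_mult smult_mult_l smult_mult_r dual_smult[OF u(3)] dual_smult[OF v(3)] \<sigma>_smult
          distrib_left cong: restrict_cong)
  qed
qed

end

section \<open>Ideals, corners and the two-sided socle\<close>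

context split_basic_algebra
begin

lemma ideal_rad: "ideal rad A"
  by (rule ideal_of_subspace[OF subspace_rad]) simp_all

lemma ideal_prod_rad: "ideal (ideal_prod A rad rad) A"
  by (intro ideal_prod_is_ideal ideal_rad)

text \<open>A scalar \<open>c\<close> acts as multiplication by the ring element
  \<open>c \<odot> \<one>\<close>.\<close>

lemma subspace_ideal:
  assumes "ideal I A"
  shows "subspace A I"
proof -
  interpret I: ideal I A by fact
  have "c \<odot> x \<in> I" if "x \<in> I" for c x
    using I.I_l_closed[OF that, of "c \<odot> \<one>"] I.a_Hcarr[OF that] by (simp add: smult_mult_l)
  then show ?thesis by (auto simp: subspace_def I.a_Hcarr)
qed

text \<open>Multiplication by the two idempotents is a projection that maps a two-sided ideal into
  itself, so its image is its set of fixed points.\<close>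

lemma corner_ideal:
  assumes "ideal I A" "i \<in> V" "j \<in> V"
  shows "corner A (e j) I (e i) = {x \<in> I. e j \<otimes> x \<otimes> e i = x}" (is "_ = ?R")
proof -
  interpret I: ideal I A by fact
  have "e j \<otimes> (e j \<otimes> x \<otimes> e i) \<otimes> e i = e j \<otimes> x \<otimes> e i" if "x \<in> carrier A" for x
  proof -
    have "e j \<otimes> (e j \<otimes> x \<otimes> e i) \<otimes> e i = (e j \<otimes> e j) \<otimes> x \<otimes> (e i \<otimes> e i)"
      using that assms by (simp add: m_assoc)
    then show ?thesis using assms by (simp add: e_orth)
  qed
  moreover have "e j \<otimes> x \<otimes> e i \<in> I" if "x \<in> I" for x
    using I.I_r_closed[OF I.I_l_closed[OF that]] assms by simp
  ultimately have "corner A (e j) I (e i) \<subseteq> ?R"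
    using I.a_Hcarr by (auto simp: corner_def)
  moreover have "?R \<subseteq> corner A (e j) I (e i)" by (force simp: corner_def)
  ultimately show ?thesis by blast
qed

lemma subspace_corner:
  assumes "ideal I A" "i \<in> V" "j \<in> V"
  shows "subspace A (corner A (e j) I (e i))"
proof -
  have I: "subspace A I" using assms(1) by (rule subspace_ideal)
  have "x \<in> carrier A" if "x \<in> I" for x using subspaceD(1)[OF I] that by auto
  then show ?thesis
    using subspaceD[OF I] assms unfolding corner_ideal[OF assms]
    by (auto simp: subspace_def smult_mult_l smult_mult_r r_distr l_distr)
qed

text \<open>Annihilation is required on both sides because \<open>J D\<close> and \<open>D J\<close>
  both contribute to the radical square of the extension; this space is what their sum is dual
  to.\<close>

definition bisocle :: "'r set" where
  "bisocle = {y \<in> carrier A. \<forall>z\<in>rad. y \<otimes> z = \<zero> \<and> z \<otimes> y = \<zero>}"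

lemma bisocle_closed: "y \<in> bisocle \<Longrightarrow> y \<in> carrier A"
  by (simp add: bisocle_def)

lemma bisocle_mult:
  assumes "y \<in> bisocle" "a \<in> carrier A" "b \<in> carrier A"
  shows "a \<otimes> y \<otimes> b \<in> bisocle"
proof -
  have "a \<otimes> y \<otimes> b \<otimes> z = \<zero> \<and> z \<otimes> (a \<otimes> y \<otimes> b) = \<zero>" if z: "z \<in> rad" for z
  proof -
    have c: "y \<in> carrier A" "z \<in> carrier A" using assms z rad_closed bisocle_closed by auto
    have "a \<otimes> y \<otimes> b \<otimes> z = a \<otimes> (y \<otimes> (b \<otimes> z))" "z \<otimes> (a \<otimes> y \<otimes> b) = ((z \<otimes> a) \<otimes> y) \<otimes> b"
      using c assms by (simp_all add: m_assoc)
    moreover have "y \<otimes> (b \<otimes> z) = \<zero>" "(z \<otimes> a) \<otimes> y = \<zero>"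
      using assms z unfolding bisocle_def by auto
    ultimately show ?thesis using assms by simp
  qed
  then show ?thesis using assms by (simp add: bisocle_def)
qed

text \<open>Modulo the radical, \<open>a \<otimes> e j\<close> is the multiple
  \<open>\<chi> j a\<close> of \<open>e j\<close>, and the radical annihilates \<open>y\<close>. So
  the line spanned by \<open>y\<close> is a left submodule whose structure depends only on
  \<open>j\<close>.\<close>

lemma bisocle_left_action:
  assumes y: "y \<in> bisocle" and j: "j \<in> V" and ey: "e j \<otimes> y = y" and a: "a \<in> carrier A"
  shows "a \<otimes> y = \<chi> j a \<odot> y"
proof -
  have yc: "y \<in> carrier A" using y by (rule bisocle_closed)
  let ?z = "a \<otimes> e j \<ominus> \<chi> j a \<odot> e j"
  have "?z \<in> rad"
    using a j by (auto simp: rad_def functional_minus[OF functional_\<chi>]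
        functional_smult[OF functional_\<chi>] \<chi>_mult \<chi>_e)
  then have "?z \<otimes> y = \<zero>" using y by (simp add: bisocle_def)
  moreover have "?z \<otimes> y = a \<otimes> y \<ominus> \<chi> j a \<odot> y"
    using a j yc ey by (simp add: minus_eq l_distr l_minus m_assoc smult_mult_l)
  ultimately show ?thesis using a yc by (simp add: r_right_minus_eq)
qed

lemma bisocle_right_action:
  assumes y: "y \<in> bisocle" and i: "i \<in> V" and ye: "y \<otimes> e i = y" and a: "a \<in> carrier A"
  shows "y \<otimes> a = \<chi> i a \<odot> y"
proof -
  have yc: "y \<in> carrier A" using y by (rule bisocle_closed)
  let ?z = "e i \<otimes> a \<ominus> \<chi> i a \<odot> e i"
  have "?z \<in> rad"
    using a i by (auto simp: rad_def functional_minus[OF functional_\<chi>]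
        functional_smult[OF functional_\<chi>] \<chi>_mult \<chi>_e)
  then have "y \<otimes> ?z = \<zero>" using y by (simp add: bisocle_def)
  moreover have "y \<otimes> ?z = y \<otimes> a \<ominus> \<chi> i a \<odot> y"
  proof -
    have "y \<otimes> ?z = (y \<otimes> e i) \<otimes> a \<ominus> \<chi> i a \<odot> (y \<otimes> e i)"
      using a i yc by (simp add: minus_eq r_distr r_minus m_assoc smult_mult_r)
    then show ?thesis by (simp add: ye)
  qed
  ultimately show ?thesis using a yc by (simp add: r_right_minus_eq)
qed

text \<open>
  Sending \<open>y\<close> to \<open>s\<close> is a homomorphism between one-dimensional submodules of the regular module; by
  injectivity it is right multiplication by some element, which acts on \<open>y\<close> as a scalar.
\<close>

lemma bisocle_corner_unique:
  assumes inj: "injective_left_module A (regular_left_module A)"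
    and i: "i \<in> V" and j: "j \<in> V"
    and y: "y \<in> bisocle" "e j \<otimes> y = y" "y \<otimes> e i = y" "y \<noteq> \<zero>"
    and s: "s \<in> bisocle" "e j \<otimes> s = s"
  shows "\<exists>c. s = c \<odot> y"
proof -
  let ?E = "regular_left_module A"
  have yc: "y \<in> carrier A" and sc: "s \<in> carrier A" using y s by (auto intro: bisocle_closed)
  have E: "left_module A ?E" using inj by (simp add: injective_left_module_def)
  have E_simps: "carrier ?E = carrier A" "add ?E = add A" "zero ?E = \<zero>" "smult ?E = mult A"
    by (simp_all add: regular_left_module_def ring.defs module.defs)
  \<comment> \<open>Only the carrier is shrunk to the line of multiples of \<open>y\<close>; all
    operations remain those of the regular module.\<close>
  define M where "M = ?E\<lparr>carrier := range (\<lambda>c. c \<odot> y)\<rparr>"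
  have M_simps: "carrier M = range (\<lambda>c. c \<odot> y)" "add M = add A" "zero M = \<zero>" "smult M = mult A"
    by (simp_all add: M_def E_simps)
  have act: "a \<otimes> (c \<odot> y) = (\<chi> j a * c) \<odot> y" if "a \<in> carrier A" for a c
    using that bisocle_left_action[OF y(1) j y(2) that] yc
    by (simp add: smult_mult_r smult_smult mult.commute)
  have M: "left_module A M"
    unfolding left_module_def
  proof (intro conjI ballI)
    show "abelian_group M"
    proof (rule abelian_groupI)
      fix u v assume "u \<in> carrier M" "v \<in> carrier M"
      then obtain c d where "u = c \<odot> y" "v = d \<odot> y" by (auto simp: M_simps)
      then have "u \<oplus> v = (c + d) \<odot> y" using yc by (simp add: smult_l_distr)
      then show "u \<oplus>\<^bsub>M\<^esub> v \<in> carrier M" by (auto simp: M_simps)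
    next
      have "\<zero> = 0 \<odot> y" using yc by simp
      then show "\<zero>\<^bsub>M\<^esub> \<in> carrier M" unfolding M_simps by blast
    next
      fix u assume "u \<in> carrier M"
      then obtain c where c: "u = c \<odot> y" by (auto simp: M_simps)
      have "(-c) \<odot> y \<oplus> u = \<zero>" using yc smult_l_distr[of y "-c" c] c by simp
      then show "\<exists>v\<in>carrier M. v \<oplus>\<^bsub>M\<^esub> u = \<zero>\<^bsub>M\<^esub>" by (auto simp: M_simps)
    qed (use yc in \<open>auto simp: M_simps a_ac\<close>)
    show "a \<odot>\<^bsub>M\<^esub> u \<in> carrier M" if "a \<in> carrier A" "u \<in> carrier M" for a u
      using that by (auto simp: M_simps act)
  qed (use yc ring_axioms in \<open>auto simp: M_simps m_assoc l_distr r_distr\<close>)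
  have y_inj: "c = d" if "c \<odot> y = d \<odot> y" for c d
  proof (rule ccontr)
    assume "c \<noteq> d"
    have "(c - d) \<odot> y = c \<odot> y \<ominus> d \<odot> y"
      using smult_l_distr[OF yc, of c "-d"] smult_smult[OF yc, of "-1" d] yc
      by (simp add: minus_eq_smult)
    then have "(c - d) \<odot> y = \<zero>" using that yc by (simp add: r_right_minus_eq)
    then show False using smult_eq_zeroD \<open>c \<noteq> d\<close> yc y(4) by simp
  qed
  \<comment> \<open>The chosen scalar is unique because \<open>y\<close> is nonzero.\<close>
  define g where "g u = (SOME c. u = c \<odot> y) \<odot> s" for u
  have g: "g (c \<odot> y) = c \<odot> s" for c
  proof -
    have "(SOME d. c \<odot> y = d \<odot> y) = c" using y_inj by (intro some_equality) auto
    then show ?thesis by (simp add: g_def)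
  qed
  have "g \<in> left_module_hom A M ?E"
    unfolding left_module_hom_def
  proof (intro CollectI conjI ballI)
    show "g \<in> carrier M \<rightarrow> carrier ?E" using sc g by (auto simp: M_simps E_simps)
    fix u assume "u \<in> carrier M"
    then obtain c where c: "u = c \<odot> y" by (auto simp: M_simps)
    {
      fix v assume "v \<in> carrier M"
      then obtain d where d: "v = d \<odot> y" by (auto simp: M_simps)
      have "u \<oplus> v = (c + d) \<odot> y" using c d yc by (simp add: smult_l_distr)
      then have "g (u \<oplus> v) = (c + d) \<odot> s" using g by simp
      then show "g (u \<oplus>\<^bsub>M\<^esub> v) = g u \<oplus>\<^bsub>?E\<^esub> g v"
        using c d g sc by (simp add: M_simps E_simps smult_l_distr)
    }
    fix a assume a: "a \<in> carrier A"
    have "a \<otimes> (c \<odot> s) = (\<chi> j a * c) \<odot> s"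
      using a bisocle_left_action[OF s(1) j s(2) a] sc
      by (simp add: smult_mult_r smult_smult mult.commute)
    then show "g (a \<odot>\<^bsub>M\<^esub> u) = a \<odot>\<^bsub>?E\<^esub> g u"
      using a c g by (simp add: M_simps E_simps act)
  qed
  moreover have "(\<lambda>u. u) \<in> left_module_hom A M ?E"
    using yc by (auto simp: left_module_hom_def M_simps E_simps)
  moreover have "inj_on (\<lambda>u. u) (carrier M)" by simp
  ultimately obtain h where h: "h \<in> left_module_hom A ?E ?E" "\<forall>u\<in>carrier M. h u = g u"
    using inj M E unfolding injective_left_module_def by blast
  have "1 \<odot> y \<in> carrier M" unfolding M_simps by blast
  then have "h y = s" using h(2) g[of 1] yc sc by simp
  moreover have "h (y \<otimes> \<one>) = y \<otimes> h \<one>" and h1: "h \<one> \<in> carrier A"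
    using h(1) yc one_closed unfolding left_module_hom_def E_simps by blast+
  ultimately have "s = \<chi> i (h \<one>) \<odot> y"
    using bisocle_right_action[OF y(1) i y(3) h1] yc by simp
  then show ?thesis by blast
qed

end

section \<open>The quiver of a twisted trivial extension\<close>

text \<open>
  \<open>x a\<close> is the class of the arrow \<open>a\<close>, \<open>\<alpha> a\<close> the coordinate function modulo \<open>rad\<^sup>2\<close> belonging to it,
  and \<open>s i\<close> the class of a maximal bound path from \<open>\<tau> i\<close> to \<open>i\<close>.
\<close>

locale nakayama_algebra = split_basic_algebra A "verts Q" e \<chi>
  for A :: "('k::field, 'r) module" (structure) and Q :: "('v, 'a) pre_digraph" and e \<chi> +
  fixes x :: "'a \<Rightarrow> 'r" and \<alpha> :: "'a \<Rightarrow> 'r \<Rightarrow> 'k" and \<tau> :: "'v \<Rightarrow> 'v" and s :: "'v \<Rightarrow> 'r"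
  assumes fin_Q: "fin_digraph Q"
    and fin_dim: "finite_dimensional A"
    and injective: "injective_left_module A (regular_left_module A)"
    and x_rad: "a \<in> arcs Q \<Longrightarrow> x a \<in> rad"
    and x_corner: "a \<in> arcs Q \<Longrightarrow> e (head Q a) \<otimes> x a \<otimes> e (tail Q a) = x a"
    and functional_\<alpha>: "a \<in> arcs Q \<Longrightarrow> functional A (\<alpha> a)"
    and \<alpha>_x: "a \<in> arcs Q \<Longrightarrow> b \<in> arcs Q \<Longrightarrow> \<alpha> a (x b) = (if a = b then 1 else 0)"
    and \<alpha>_corner: "a \<in> arcs Q \<Longrightarrow> i \<in> verts Q \<Longrightarrow> j \<in> verts Q \<Longrightarrow> y \<in> carrier A \<Longrightarrow>
      \<not> (tail Q a = i \<and> head Q a = j) \<Longrightarrow> \<alpha> a (e j \<otimes> y \<otimes> e i) = 0"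
    and rad_square: "ideal_prod A rad rad = {y \<in> rad. \<forall>a\<in>arcs Q. \<alpha> a y = 0}"
    and bisocleI: "y \<in> carrier A \<Longrightarrow>
      (\<And>a. a \<in> arcs Q \<Longrightarrow> y \<otimes> x a = \<zero> \<and> x a \<otimes> y = \<zero>) \<Longrightarrow> y \<in> bisocle"
    and \<tau>_bij: "bij_betw \<tau> (verts Q) (verts Q)"
    and s_bisocle: "i \<in> verts Q \<Longrightarrow> s i \<in> bisocle"
    and s_nonzero: "i \<in> verts Q \<Longrightarrow> s i \<noteq> \<zero>"
    and s_corner: "i \<in> verts Q \<Longrightarrow> e i \<otimes> s i \<otimes> e (\<tau> i) = s i"
begin

lemma \<tau>_closed [simp]: "i \<in> verts Q \<Longrightarrow> \<tau> i \<in> verts Q"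
  using \<tau>_bij by (auto simp: bij_betw_def)

lemma cornerD:
  assumes "e j \<otimes> y \<otimes> e i = y" "y \<in> carrier A" "i \<in> verts Q" "j \<in> verts Q"
  shows "e j \<otimes> y = y" "y \<otimes> e i = y"
proof -
  have "e j \<otimes> (e j \<otimes> y \<otimes> e i) = (e j \<otimes> e j) \<otimes> y \<otimes> e i"
    "(e j \<otimes> y \<otimes> e i) \<otimes> e i = e j \<otimes> y \<otimes> (e i \<otimes> e i)"
    using assms(2-4) by (simp_all add: m_assoc)
  then show "e j \<otimes> y = y" "y \<otimes> e i = y" using assms by (simp_all add: e_orth)
qed

text \<open>The elements \<open>y\<close> and \<open>s j\<close> are only known to share the left
  idempotent \<open>e j\<close>, which suffices for \<open>bisocle_corner_unique\<close> to make
  \<open>s j\<close> a multiple of \<open>y\<close>. As \<open>s j\<close> is nonzero, it is then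
  fixed by \<open>e i\<close> on the right as well as by \<open>e (\<tau> j)\<close>, and these
  would annihilate each other for distinct vertices.\<close>

lemma bisocle_corner:
  assumes i: "i \<in> verts Q" and j: "j \<in> verts Q"
    and y: "y \<in> bisocle" "e j \<otimes> y \<otimes> e i = y" "y \<noteq> \<zero>"
  shows "i = \<tau> j \<and> (\<exists>c. y = c \<odot> s j)"
proof -
  have yc: "y \<in> carrier A" and sc: "s j \<in> carrier A"
    using y s_bisocle[OF j] by (auto intro: bisocle_closed)
  note ye = cornerD[OF y(2) yc i j] and se = cornerD[OF s_corner[OF j] sc \<tau>_closed[OF j] j]
  obtain c where c: "s j = c \<odot> y"
    using bisocle_corner_unique[OF injective i j y(1) ye y(3) s_bisocle[OF j] se(1)] by blast
  have c0: "c \<noteq> 0" using c s_nonzero[OF j] yc by auto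
  then have "y = inverse c \<odot> s j" using yc by (simp add: c smult_smult)
  moreover have "i = \<tau> j"
  proof (rule ccontr)
    assume "i \<noteq> \<tau> j"
    have "s j \<otimes> e i = s j \<otimes> (e (\<tau> j) \<otimes> e i)"
      using se(2) sc i j by (simp add: m_assoc[symmetric])
    then have "s j \<otimes> e i = \<zero>" using \<open>i \<noteq> \<tau> j\<close> i j sc by (simp add: e_orth)
    moreover have "s j \<otimes> e i = s j" using ye yc i by (simp add: c smult_mult_l)
    ultimately show False using s_nonzero[OF j] by simp
  qed
  ultimately show ?thesis by blast
qed

lemma fin_digraph_returning_quiver: "fin_digraph (returning_quiver Q \<tau>)"
proof -
  interpret fin_digraph Q by (rule fin_Q)
  show ?thesis by unfold_locales (auto simp: returning_quiver_def)
qed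

end

section \<open>Radical, radical square and corners of the twisted extension\<close>

locale twisted_nakayama_algebra =
  nakayama_algebra A Q e \<chi> x \<alpha> \<tau> s + twisted_kalgebra A \<sigma>
  for A :: "('k::field, 'r) module" (structure) and Q :: "('v, 'a) pre_digraph"
    and e \<chi> x \<alpha> \<tau> s \<sigma> +
  assumes \<sigma>_bij: "bij_betw \<sigma> (carrier A) (carrier A)"
    and \<sigma>_e: "i \<in> verts Q \<Longrightarrow> \<sigma> (e i) = e i"
begin

lemma \<sigma>_pow: "y \<in> carrier A \<Longrightarrow> \<sigma> (y [^] (n::nat)) = \<sigma> y [^] n"
  by (induction n) (simp_all add: \<sigma>_mult)

text \<open>Nilpotency is preserved and reflected by an injective algebra map.\<close>

lemma \<sigma>_rad_iff:
  assumes y: "y \<in> carrier A"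
  shows "\<sigma> y \<in> rad \<longleftrightarrow> y \<in> rad"
proof -
  have "\<sigma> z = \<zero> \<longleftrightarrow> z = \<zero>" if "z \<in> carrier A" for z
    using \<sigma>_bij that \<sigma>_zero by (metis bij_betw_def inj_onD zero_closed)
  then show ?thesis
    using y by (simp add: nilpotent_iff_rad[symmetric] \<sigma>_pow[symmetric])
qed

text \<open>Used to undo the twist: right multiplication of a functional by the preimage
  \<open>y\<close> is precomposition with left multiplication by \<open>z\<close> itself.\<close>

lemma rad_eq_\<sigma>: "z \<in> rad \<Longrightarrow> \<exists>y\<in>rad. z = \<sigma> y"
  using \<sigma>_bij \<sigma>_rad_iff rad_closed by (metis bij_betw_def imageE)

sublocale T: kalgebra T
  by (rule kalgebra_T)

lemma dual_mult_T_right: "a \<in> carrier A \<Longrightarrow> f \<in> carrier D \<Longrightarrow>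
    (a, \<lambda>z\<in>carrier A. 0) \<otimes>\<^bsub>T\<^esub> (\<zero>, f) = (\<zero>, \<lambda>z\<in>carrier A. f (z \<otimes> a))"
  by (auto simp: T_mult cong: restrict_cong)

lemma dual_mult_T_left: "a \<in> carrier A \<Longrightarrow> f \<in> carrier D \<Longrightarrow>
    (\<zero>, f) \<otimes>\<^bsub>T\<^esub> (a, \<lambda>z\<in>carrier A. 0) = (\<zero>, \<lambda>z\<in>carrier A. f (\<sigma> a \<otimes> z))"
  by (auto simp: T_mult cong: restrict_cong)

lemma T_fst_simps:
  assumes "a \<in> carrier A" "b \<in> carrier A"
  shows "(a, \<lambda>z\<in>carrier A. 0) \<oplus>\<^bsub>T\<^esub> (b, \<lambda>z\<in>carrier A. 0) = (a \<oplus> b, \<lambda>z\<in>carrier A. 0)"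
    "(a, \<lambda>z\<in>carrier A. 0) \<otimes>\<^bsub>T\<^esub> (b, \<lambda>z\<in>carrier A. 0) = (a \<otimes> b, \<lambda>z\<in>carrier A. 0)"
  unfolding T_simps(4) T_mult prod.inject by (intro conjI refl restrict_ext; use assms in simp)+

lemma finsum_T_fst:
  "finite I \<Longrightarrow> b \<in> I \<rightarrow> carrier A \<Longrightarrow>
    (\<Oplus>\<^bsub>T\<^esub>i\<in>I. (b i, \<lambda>z\<in>carrier A. 0)) = (\<Oplus>i\<in>I. b i, \<lambda>z\<in>carrier A. 0)"
proof (induction I rule: finite_induct)
  case empty
  then show ?case by (simp only: T.finsum_empty finsum_empty T_simps(2))
next
  case (insert i I)
  then have b: "(\<lambda>i. (b i, \<lambda>z\<in>carrier A. 0)) \<in> insert i I \<rightarrow> carrier T"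
    by (auto simp: T_simps dual_zero_closed)
  have "(\<Oplus>\<^bsub>T\<^esub>i\<in>insert i I. (b i, \<lambda>z\<in>carrier A. 0)) =
      (b i, \<lambda>z\<in>carrier A. 0) \<oplus>\<^bsub>T\<^esub> (\<Oplus>\<^bsub>T\<^esub>i\<in>I. (b i, \<lambda>z\<in>carrier A. 0))"
    by (rule T.finsum_insert) (use insert.hyps b in \<open>auto simp del: restrict_apply\<close>)
  also have "(\<Oplus>\<^bsub>T\<^esub>i\<in>I. (b i, \<lambda>z\<in>carrier A. 0)) = (\<Oplus>i\<in>I. b i, \<lambda>z\<in>carrier A. 0)"
    by (rule insert.IH) (use insert.prems in auto)
  also have "(b i, \<lambda>z\<in>carrier A. 0) \<oplus>\<^bsub>T\<^esub> (\<Oplus>i\<in>I. b i, \<lambda>z\<in>carrier A. 0) =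
      (b i \<oplus> (\<Oplus>i\<in>I. b i), \<lambda>z\<in>carrier A. 0)"
    using insert.prems by (intro T_fst_simps) auto
  also have "\<dots> = (\<Oplus>i\<in>insert i I. b i, \<lambda>z\<in>carrier A. 0)"
    using insert.prems insert.hyps by (subst finsum_insert) auto
  finally show ?case .
qed

lemma T_pow:
  "a \<in> carrier A \<Longrightarrow> f \<in> carrier D \<Longrightarrow> \<exists>g\<in>carrier D. (a, f) [^]\<^bsub>T\<^esub> (n::nat) = (a [^] n, g)"
proof (induction n)
  case 0
  then show ?case by (simp add: T_simps dual_zero_closed)
next
  case (Suc n)
  then obtain g where "g \<in> carrier D" "(a, f) [^]\<^bsub>T\<^esub> n = (a [^] n, g)" by blast
  with Suc.prems show ?case by (auto simp: T_mult intro!: T_mult_closed)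
qed

text \<open>The dual is an ideal of square zero. Pulling the characters back along the first
  projection therefore enlarges their common kernel by nilpotent elements only.\<close>

sublocale T: split_basic_algebra T "verts Q" "\<lambda>i. (e i, \<lambda>z\<in>carrier A. 0)" "\<lambda>i u. \<chi> i (fst u)"
proof
  fix i j assume ij: "i \<in> verts Q" "j \<in> verts Q"
  show "(e i, \<lambda>z\<in>carrier A. 0) \<in> carrier T" using ij by (simp add: T_simps dual_zero_closed)
  show "(e i, \<lambda>z\<in>carrier A. 0) \<otimes>\<^bsub>T\<^esub> (e j, \<lambda>z\<in>carrier A. 0)
      = (if i = j then (e i, \<lambda>z\<in>carrier A. 0) else \<zero>\<^bsub>T\<^esub>)"
    using ij by (auto simp: T_mult T_simps e_orth cong: restrict_cong)
  show "functional T (\<lambda>u. \<chi> i (fst u))"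
    using functional_\<chi>[OF ij(1)] by (auto simp: functional_def T_simps)
  show "\<chi> i (fst (e j, \<lambda>z\<in>carrier A. 0)) = (if i = j then 1 else 0)"
    using ij by (simp add: \<chi>_e)
next
  fix i u v assume "i \<in> verts Q" "u \<in> carrier T" "v \<in> carrier T"
  then show "\<chi> i (fst (u \<otimes>\<^bsub>T\<^esub> v)) = \<chi> i (fst u) * \<chi> i (fst v)"
    by (auto simp: T_simps T_mult \<chi>_mult)
next
  fix u assume "u \<in> carrier T" and *: "\<And>i. i \<in> verts Q \<Longrightarrow> \<chi> i (fst u) = 0"
  then obtain a f where u: "u = (a, f)" "a \<in> carrier A" "f \<in> carrier D" by (auto simp: T_simps)
  obtain n :: nat where n: "a [^] n = \<zero>" using nil[of a] u * by auto
  obtain g where g: "g \<in> carrier D" "u [^]\<^bsub>T\<^esub> n = (\<zero>, g)" using T_pow[OF u(2,3), of n] n u(1) by auto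
  \<comment> \<open>The \<open>n\<close>-th power lies in the dual, so squaring it once more gives
    zero.\<close>
  have "u [^]\<^bsub>T\<^esub> (n + n) = (\<zero>, g) \<otimes>\<^bsub>T\<^esub> (\<zero>, g)"
    using u g by (simp add: T.nat_pow_mult[symmetric] T_simps)
  also have "\<dots> = \<zero>\<^bsub>T\<^esub>" using g by (auto simp: T_mult T_simps dual_zero cong: restrict_cong)
  finally show "\<exists>n::nat. u [^]\<^bsub>T\<^esub> n = \<zero>\<^bsub>T\<^esub>" by blast
qed (simp_all add: finite_V finsum_T_fst sum_e T_simps)

lemma rad_T: "T.rad = rad \<times> carrier D"
  by (auto simp: T.rad_def rad_def T_simps)

text \<open>A product of two radical elements has a dual component with one summand from each side,
  and radical factors kill the two-sided socle inside both. Conversely, finite-dimensional duality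
  leaves no room for further functionals vanishing on that socle.\<close>

lemma rad_square_T:
  "ideal_prod T T.rad T.rad = ideal_prod A rad rad \<times> {f \<in> carrier D. \<forall>y\<in>bisocle. f y = 0}"
    (is "?L = ?R")
proof (intro subset_antisym subsetI)
  fix u assume "u \<in> ?L"
  then show "u \<in> ?R"
  proof (induction u rule: ideal_prod.induct)
    case (prod u v)
    then obtain a f b g where uv: "u = (a, f)" "a \<in> rad" "f \<in> carrier D"
      "v = (b, g)" "b \<in> rad" "g \<in> carrier D" by (auto simp: rad_T)
    have c: "a \<in> carrier A" "b \<in> carrier A" using uv rad_closed by auto
    have \<sigma>b: "\<sigma> b \<in> rad" using uv c by (simp add: \<sigma>_rad_iff)
    have "g (y \<otimes> a) + f (\<sigma> b \<otimes> y) = 0" if "y \<in> bisocle" for y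
      using that uv \<sigma>b unfolding bisocle_def by (simp add: dual_zero)
    moreover have "a \<otimes> b \<in> ideal_prod A rad rad" using uv by (intro ideal_prod.prod)
    ultimately show ?case using uv c by (auto simp: T_mult T_mult_closed bisocle_closed)
  next
    case (sum u v)
    then show ?case
      by (auto simp: T_simps dual_add_closed bisocle_closed intro!: ideal_prod.sum)
  qed
next
  fix u assume "u \<in> ?R"
  then obtain a f where u: "u = (a, f)" "a \<in> ideal_prod A rad rad" "f \<in> carrier D"
    "\<And>y. y \<in> bisocle \<Longrightarrow> f y = 0" by auto
  note L = subspaceD[OF T.subspace_ideal[OF T.ideal_prod_rad]]
  have "(a, \<lambda>z\<in>carrier A. 0) \<in> ?L"
    using u(2)
  proof (induction a rule: ideal_prod.induct)
    case (prod a b)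
    have ab: "a \<in> carrier A" "b \<in> carrier A" using prod rad_closed by auto
    have "(a, \<lambda>z\<in>carrier A. 0) \<otimes>\<^bsub>T\<^esub> (b, \<lambda>z\<in>carrier A. 0) \<in> ?L"
      using prod by (intro ideal_prod.prod) (auto simp: rad_T dual_zero_closed)
    then show ?case unfolding T_fst_simps(2)[OF ab] .
  next
    case (sum a b)
    have "(a, \<lambda>z\<in>carrier A. 0) \<oplus>\<^bsub>T\<^esub> (b, \<lambda>z\<in>carrier A. 0) \<in> ?L"
      using sum by (intro ideal_prod.sum)
    moreover have "a \<in> carrier A" "b \<in> carrier A"
      using sum.hyps subspaceD(1)[OF subspace_ideal[OF ideal_prod_rad]] by auto
    ultimately show ?case by (simp only: T_fst_simps(1))
  qed
  \<comment> \<open>The functionals in the radical square form the subspace \<open>W\<close> of the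
    duality lemma. The acting set is the set of arrow classes, since it has to be finite; by
    \<open>bisocleI\<close> its annihilator lies in the two-sided socle.\<close>
  moreover have "f \<in> {f \<in> carrier D. (\<zero>, f) \<in> ?L}"
  proof (rule functional_in_action_span[OF fin_dim, of "x ` arcs Q"])
    show "finite (x ` arcs Q)" using fin_Q by (simp add: fin_digraph.finite_arcs)
    show "x ` arcs Q \<subseteq> carrier A" using x_rad rad_closed by auto
    show "f \<in> carrier D" by fact
    show "(\<lambda>z\<in>carrier A. 0) \<in> {f \<in> carrier D. (\<zero>, f) \<in> ?L}"
      using L(2) by (simp add: T_simps dual_zero_closed)
    fix g assume "g \<in> {f \<in> carrier D. (\<zero>, f) \<in> ?L}"
    then have g: "g \<in> carrier D" "(\<zero>, g) \<in> ?L" by auto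
    show "(\<lambda>z\<in>carrier A. c * g z) \<in> {f \<in> carrier D. (\<zero>, f) \<in> ?L}" for c
      using L(4)[OF g(2), of c] g(1) by (simp add: T_simps dual_smult_closed)
    fix h assume "h \<in> {f \<in> carrier D. (\<zero>, f) \<in> ?L}"
    then have h: "h \<in> carrier D" "(\<zero>, h) \<in> ?L" by auto
    show "(\<lambda>z\<in>carrier A. g z + h z) \<in> {f \<in> carrier D. (\<zero>, f) \<in> ?L}"
      using L(3)[OF g(2) h(2)] g(1) h(1) by (simp add: T_simps dual_add_closed)
  next
    fix y g assume "y \<in> x ` arcs Q" and g: "g \<in> carrier D"
    then have y: "y \<in> rad" "y \<in> carrier A" using x_rad rad_closed by auto
    have "(y, \<lambda>z\<in>carrier A. 0) \<otimes>\<^bsub>T\<^esub> (\<zero>, g) \<in> ?L"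
      using y g subspaceD(2)[OF subspace_rad]
      by (intro ideal_prod.prod) (auto simp: rad_T dual_zero_closed)
    then show "(\<lambda>z\<in>carrier A. g (z \<otimes> y)) \<in> {f \<in> carrier D. (\<zero>, f) \<in> ?L}"
      using y g by (simp add: dual_mult_T_right dual_lact_closed)
    \<comment> \<open>The right action by \<open>y'\<close> is evaluation after multiplication by
      \<open>\<sigma> y'\<close>, so it is the preimage that has to be multiplied with.\<close>
    obtain y' where y': "y' \<in> rad" "y = \<sigma> y'" using rad_eq_\<sigma> y by blast
    have "(\<zero>, g) \<otimes>\<^bsub>T\<^esub> (y', \<lambda>z\<in>carrier A. 0) \<in> ?L"
      using y' g subspaceD(2)[OF subspace_rad]
      by (intro ideal_prod.prod) (auto simp: rad_T dual_zero_closed)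
    then show "(\<lambda>z\<in>carrier A. g (y \<otimes> z)) \<in> {f \<in> carrier D. (\<zero>, f) \<in> ?L}"
      using y y' g rad_closed by (simp add: dual_mult_T_left dual_ract_closed)
  next
    fix y assume "y \<in> carrier A" "\<And>z. z \<in> x ` arcs Q \<Longrightarrow> y \<otimes> z = \<zero> \<and> z \<otimes> y = \<zero>"
    then show "f y = 0" by (intro u(4) bisocleI) auto
  qed auto
  ultimately have "(a, \<lambda>z\<in>carrier A. 0) \<oplus>\<^bsub>T\<^esub> (\<zero>, f) \<in> ?L" using L(3) by blast
  moreover have "a \<in> carrier A"
    using u(2) subspaceD(1)[OF subspace_ideal[OF ideal_prod_rad]] by auto
  ultimately show "u \<in> ?L" using u by (simp add: T_simps dual_restrict cong: restrict_cong)
qed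

text \<open>The twist disappears because \<open>\<sigma>\<close> fixes \<open>e i\<close>. On
  functionals left and right change places: the index pair \<open>(j, i)\<close> on the dual becomes
  \<open>(i, j)\<close> on the argument.\<close>

lemma corner_T:
  assumes "a \<in> carrier A" "f \<in> carrier D" "i \<in> verts Q" "j \<in> verts Q"
  shows "(e j, \<lambda>z\<in>carrier A. 0) \<otimes>\<^bsub>T\<^esub> (a, f) \<otimes>\<^bsub>T\<^esub> (e i, \<lambda>z\<in>carrier A. 0)
    = (e j \<otimes> a \<otimes> e i, \<lambda>z\<in>carrier A. f (e i \<otimes> z \<otimes> e j))"
  using assms by (auto simp: T_mult \<sigma>_e cong: restrict_cong)

text \<open>Supplies the new arrow at \<open>i\<close>. Some functional is nonzero at
  \<open>s i\<close>; composing it with the projection to the corner of \<open>s i\<close> keeps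
  that value, which is then scaled to 1.\<close>

lemma socle_functional:
  assumes i: "i \<in> verts Q"
  shows "\<exists>\<phi>\<in>carrier D. \<phi> (s i) = 1 \<and> (\<lambda>z\<in>carrier A. \<phi> (e i \<otimes> z \<otimes> e (\<tau> i))) = \<phi>"
proof -
  have sc: "s i \<in> carrier A" using s_bisocle[OF i] by (rule bisocle_closed)
  obtain G where "finite G" and G: "G \<subseteq> carrier D"
    and sep: "\<forall>y\<in>carrier A. (\<forall>g\<in>G. g y = 0) \<longrightarrow> y = \<zero>"
    using finite_separating_functionals[OF fin_dim] .
  have "\<not> (\<forall>g\<in>G. g (s i) = 0)" using sep sc s_nonzero[OF i] by auto
  then obtain g where g: "g \<in> carrier D" "g (s i) \<noteq> 0" using G by auto
  define \<phi> where "\<phi> = (\<lambda>z\<in>carrier A. inverse (g (s i)) * g (e i \<otimes> z \<otimes> e (\<tau> i)))"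
  have "\<phi> \<in> carrier D"
    unfolding \<phi>_def
    using i g dual_add[OF g(1)] dual_smult[OF g(1)]
    by (auto simp: carrier_dual_iff functional_def r_distr l_distr distrib_left
        smult_mult_r smult_mult_l)
  moreover have "\<phi> (s i) = 1" using sc g i by (simp add: \<phi>_def s_corner)
  moreover have "(\<lambda>z\<in>carrier A. \<phi> (e i \<otimes> z \<otimes> e (\<tau> i))) = \<phi>"
  proof -
    have "e i \<otimes> (e i \<otimes> z \<otimes> e (\<tau> i)) \<otimes> e (\<tau> i) = e i \<otimes> z \<otimes> e (\<tau> i)" if "z \<in> carrier A" for z
    proof -
      have "e i \<otimes> (e i \<otimes> z \<otimes> e (\<tau> i)) \<otimes> e (\<tau> i) = (e i \<otimes> e i) \<otimes> z \<otimes> (e (\<tau> i) \<otimes> e (\<tau> i))"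
        using that i by (simp add: m_assoc)
      then show ?thesis using i by (simp add: e_orth)
    qed
    then show ?thesis using i unfolding \<phi>_def by (auto cong: restrict_cong)
  qed
  ultimately show ?thesis by blast
qed

text \<open>An old arrow is represented by its class, with coordinate \<open>\<alpha> a\<close> on
  the first component; the new arrow at \<open>k\<close> is represented by the functional
  \<open>\<phi> k\<close>, with evaluation at \<open>s k\<close> as coordinate. By the description
  of the radical square, these coordinates cut it out inside each corner.\<close>

theorem is_quiver_of_T:
  "is_quiver_of (returning_quiver Q \<tau>) T (\<lambda>i. (e i, \<lambda>z\<in>carrier A. 0))"
proof -
  let ?G = "returning_quiver Q \<tau>" and ?e = "\<lambda>i. (e i, \<lambda>z\<in>carrier A. 0)"
  have verts_G: "verts ?G = verts Q" by (simp add: returning_quiver_def)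
  obtain \<phi> where \<phi>: "\<And>i. i \<in> verts Q \<Longrightarrow> \<phi> i \<in> carrier D" "\<And>i. i \<in> verts Q \<Longrightarrow> \<phi> i (s i) = 1"
    "\<And>i. i \<in> verts Q \<Longrightarrow> (\<lambda>z\<in>carrier A. \<phi> i (e i \<otimes> z \<otimes> e (\<tau> i))) = \<phi> i"
    using socle_functional by metis
  define b where "b = case_sum (\<lambda>a. (x a, \<lambda>z\<in>carrier A. 0)) (\<lambda>k. (\<zero>, \<phi> k))"
  have "basis_modulo T (corner T (?e j) T.rad (?e i)) (corner T (?e j) (ideal_prod T T.rad T.rad) (?e i))
      {a \<in> arcs ?G. tail ?G a = i \<and> head ?G a = j} b" (is "basis_modulo T ?U ?W ?I b")
    if i: "i \<in> verts Q" and j: "j \<in> verts Q" for i j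
  proof (rule T.basis_moduloI[where
        \<phi> = "case_sum (\<lambda>a u. \<alpha> a (fst u)) (\<lambda>k u. snd u (s k))"])
    \<comment> \<open>There is at most one new arrow from \<open>i\<close> to \<open>j\<close>, and
      it exists exactly when \<open>j\<close> is \<open>\<tau> i\<close>.\<close>
    have I: "?I = Inl ` {a \<in> arcs Q. tail Q a = i \<and> head Q a = j} \<union> (if \<tau> i = j then {Inr i} else {})"
      using i by (auto simp: returning_quiver_def)
    have U: "?U = {(a, f). a \<in> rad \<and> f \<in> carrier D \<and> e j \<otimes> a \<otimes> e i = a \<and>
        (\<lambda>z\<in>carrier A. f (e i \<otimes> z \<otimes> e j)) = f}"
      using rad_closed unfolding T.corner_ideal[OF T.ideal_rad i j]
      by (auto simp: rad_T corner_T i j)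
    show "finite ?I" using fin_digraph.finite_arcs[OF fin_digraph_returning_quiver] by simp
    show "subspace T ?U" by (rule T.subspace_corner[OF T.ideal_rad i j])
    show "b k \<in> ?U" if "k \<in> ?I" for k
    proof (cases k)
      case (Inl a)
      then have "a \<in> arcs Q" "tail Q a = i" "head Q a = j" using that by (auto simp: I split: if_splits)
      then have "x a \<in> rad" "e j \<otimes> x a \<otimes> e i = x a" using x_rad x_corner by auto
      moreover have "(\<lambda>z\<in>carrier A. (\<lambda>z\<in>carrier A. 0) (e i \<otimes> z \<otimes> e j)) = (\<lambda>z\<in>carrier A. 0 :: 'k)"
        using i j by (intro restrict_ext) simp
      ultimately show ?thesis unfolding U Inl b_def by (simp add: dual_zero_closed)
    next
      case (Inr k')
      then have "k' = i" "j = \<tau> i" using that by (auto simp: I split: if_splits)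
      then show ?thesis
        using i \<phi>(1,3)[OF i] subspaceD(2)[OF subspace_rad] unfolding U Inr b_def by simp
    qed
    show "functional T (case_sum (\<lambda>a u. \<alpha> a (fst u)) (\<lambda>k u. snd u (s k)) k)" if "k \<in> ?I" for k
    proof (cases k)
      case (Inl a)
      then show ?thesis
        using that functional_\<alpha>[of a] unfolding I by (auto simp: functional_def T_simps split: if_splits)
    next
      case (Inr k')
      then show ?thesis
        using that i bisocle_closed[OF s_bisocle[OF i]] unfolding I
        by (auto simp: functional_def T_simps split: if_splits)
    qed
    show "case_sum (\<lambda>a u. \<alpha> a (fst u)) (\<lambda>k u. snd u (s k)) k (b k') = (if k = k' then 1 else 0)"
      if "k \<in> ?I" "k' \<in> ?I" for k k'
      using that i j \<phi>(2) bisocle_closed[OF s_bisocle[OF i]] functional_zero[OF functional_\<alpha>]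
      unfolding I b_def by (auto simp: \<alpha>_x split: if_splits)
    fix u assume "u \<in> ?U"
    then obtain a f where u: "u = (a, f)" "a \<in> rad" "f \<in> carrier D" "e j \<otimes> a \<otimes> e i = a"
      "(\<lambda>z\<in>carrier A. f (e i \<otimes> z \<otimes> e j)) = f" unfolding U by auto
    have ac: "a \<in> carrier A" using u rad_closed by blast
    have "u \<in> ?W \<longleftrightarrow> u \<in> ideal_prod T T.rad T.rad"
      unfolding T.corner_ideal[OF T.ideal_prod_rad i j] using u ac i j by (simp add: corner_T)
    also have "\<dots> \<longleftrightarrow> (\<forall>c\<in>arcs Q. \<alpha> c a = 0) \<and> (\<forall>y\<in>bisocle. f y = 0)"
      unfolding rad_square_T rad_square using u by auto
    \<comment> \<open>The coordinates at arrows with other end points vanish on the whole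
      corner.\<close>
    also have "(\<forall>c\<in>arcs Q. \<alpha> c a = 0) \<longleftrightarrow> (\<forall>c\<in>{c \<in> arcs Q. tail Q c = i \<and> head Q c = j}. \<alpha> c a = 0)"
      using \<alpha>_corner[OF _ i j ac] u(4) by auto
    \<comment> \<open>The functional \<open>f\<close> depends only on the part of its argument in
      \<open>e i A e j\<close>. By \<open>bisocle_corner\<close>, with the two vertices exchanged,
      the socle in that corner is zero unless \<open>j\<close> is \<open>\<tau> i\<close>, and then
      it is the line through \<open>s i\<close>.\<close>
    also have "(\<forall>y\<in>bisocle. f y = 0) \<longleftrightarrow> (\<tau> i = j \<longrightarrow> f (s i) = 0)"
    proof (intro iffI impI ballI)
      fix y assume s0: "\<tau> i = j \<longrightarrow> f (s i) = 0" and y: "y \<in> bisocle"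
      let ?y = "e i \<otimes> y \<otimes> e j"
      have yc: "y \<in> carrier A" using y by (rule bisocle_closed)
      have fy: "f y = f ?y" using fun_cong[OF u(5), of y] yc by simp
      have y': "?y \<in> bisocle" using bisocle_mult y i j by simp
      have "e i \<otimes> ?y \<otimes> e j = (e i \<otimes> e i) \<otimes> y \<otimes> (e j \<otimes> e j)" using yc i j by (simp add: m_assoc)
      then have "e i \<otimes> ?y \<otimes> e j = ?y" using i j by (simp add: e_orth)
      note * = bisocle_corner[OF j i y' this]
      have "f ?y = 0"
      proof (cases "?y = \<zero>")
        case True
        then show ?thesis using u by (simp add: dual_zero)
      next
        case False
        then obtain c where "j = \<tau> i" "?y = c \<odot> s i" using * by blast
        then show ?thesis using s0 dual_smult[OF u(3) bisocle_closed[OF s_bisocle[OF i]]] by simp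
      qed
      then show "f y = 0" using fy by simp
    qed (use s_bisocle[OF i] in auto)
    finally have W: "u \<in> ?W \<longleftrightarrow> (\<forall>c\<in>{c \<in> arcs Q. tail Q c = i \<and> head Q c = j}. \<alpha> c a = 0) \<and>
        (\<tau> i = j \<longrightarrow> f (s i) = 0)" .
    show "u \<in> ?W \<longleftrightarrow> (\<forall>k\<in>?I. case_sum (\<lambda>a u. \<alpha> a (fst u)) (\<lambda>k u. snd u (s k)) k u = 0)"
      unfolding W I using u(1) by auto
  qed
  then show ?thesis
    unfolding is_quiver_of_def Let_def T.jacobson_radical_eq_rad verts_G
    using T.complete_primitive_idempotents_e T.basis_modulo_rad fin_digraph_returning_quiver by blast
qed

end

section \<open>The path algebra\<close>

text \<open>A finitely supported function is the sum of its monomials. All supports stay inside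
  \<open>S\<close>, so that inductions over the path algebra only meet genuine paths.\<close>

lemma poly_mapping_single_induct [consumes 1, case_names zero single add]:
  fixes f :: "'p \<Rightarrow>\<^sub>0 'k::comm_monoid_add"
  assumes "Poly_Mapping.keys f \<subseteq> S"
    and "P 0" "\<And>p c. p \<in> S \<Longrightarrow> P (Poly_Mapping.single p c)"
    and add: "\<And>g h. Poly_Mapping.keys g \<subseteq> S \<Longrightarrow> Poly_Mapping.keys h \<subseteq> S \<Longrightarrow> P g \<Longrightarrow> P h \<Longrightarrow> P (g + h)"
  shows "P f"
proof -
  have "Poly_Mapping.keys (\<Sum>p\<in>U. Poly_Mapping.single p (Poly_Mapping.lookup f p)) \<subseteq> S \<and>
      P (\<Sum>p\<in>U. Poly_Mapping.single p (Poly_Mapping.lookup f p))" if "U \<subseteq> S" "finite U" for U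
    using that(2,1)
  proof (induction U rule: finite_induct)
    case (insert p U)
    have "Poly_Mapping.keys (Poly_Mapping.single p (Poly_Mapping.lookup f p)) \<subseteq> S" using insert.prems by simp
    moreover have "P (Poly_Mapping.single p (Poly_Mapping.lookup f p))"
      using assms(3) insert.prems by simp
    moreover note insert.IH
    ultimately show ?case
      using insert.prems insert.hyps
        add[of "Poly_Mapping.single p (Poly_Mapping.lookup f p)"
          "\<Sum>p\<in>U. Poly_Mapping.single p (Poly_Mapping.lookup f p)"]
        keys_add[of "Poly_Mapping.single p (Poly_Mapping.lookup f p)"
          "\<Sum>p\<in>U. Poly_Mapping.single p (Poly_Mapping.lookup f p)"]
      by (simp del: keys_single) blast
  qed (use assms(2) in simp)
  moreover have "f = (\<Sum>p\<in>Poly_Mapping.keys f. Poly_Mapping.single p (Poly_Mapping.lookup f p))"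
    by (rule poly_mapping_eqI)
      (simp add: lookup_sum lookup_single when_def in_keys_iff sum.delta[OF finite_keys])
  ultimately show ?thesis using assms(1) finite_keys by metis
qed

lemma lookup_map_mult: "Poly_Mapping.lookup (Poly_Mapping.map ((*) c) f) p = c * Poly_Mapping.lookup f p" for c :: "'k::field"
  by (simp add: Poly_Mapping.map.rep_eq when_def)

lemma map_mult_single:
  "Poly_Mapping.map ((*) c) (Poly_Mapping.single p d) = Poly_Mapping.single p (c * d)" for c :: "'k::field"
  by (rule poly_mapping_eqI) (simp add: lookup_map_mult lookup_single when_def)

lemma map_mult_zero [simp]: "Poly_Mapping.map ((*) c) 0 = 0" for c :: "'k::field"
  by (rule poly_mapping_eqI) (simp add: lookup_map_mult)

lemma map_mult_add:
  "Poly_Mapping.map ((*) c) (f + g) = Poly_Mapping.map ((*) c) f + Poly_Mapping.map ((*) c) g"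
  for c :: "'k::field"
  by (rule poly_mapping_eqI) (simp add: lookup_map_mult lookup_add distrib_left)

lemma keys_map_mult: "Poly_Mapping.keys (Poly_Mapping.map ((*) c) f) \<subseteq> Poly_Mapping.keys f"
  for c :: "'k::field"
  by (auto simp: in_keys_iff lookup_map_mult)

section \<open>Concatenation of paths and bilinearity of their product\<close>

lemma awlast_append:
  "pre_digraph.awlast Q u (es @ es') = pre_digraph.awlast Q (pre_digraph.awlast Q u es) es'"
  by (induction es arbitrary: u) (auto simp: pre_digraph.awalk_verts.simps pre_digraph.awalk_verts_non_Nil)

lemma path_end_append:
  "path_end Q p = fst q \<Longrightarrow> path_end Q (fst p, snd p @ snd q) = path_end Q q"
  by (simp add: path_end_def awlast_append)

lemma path_end_Nil [simp]: "path_end Q (v, []) = v"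
  by (simp add: path_end_def pre_digraph.awalk_verts.simps)

lemma path_end_single [simp]: "path_end Q (v, [a]) = head Q a"
  by (simp add: path_end_def pre_digraph.awalk_verts.simps)

abbreviation pmult ::
    "('v, 'a) pre_digraph \<Rightarrow> (('v, 'a) path \<Rightarrow>\<^sub>0 'k::field) \<Rightarrow> (('v, 'a) path \<Rightarrow>\<^sub>0 'k) \<Rightarrow> (('v, 'a) path \<Rightarrow>\<^sub>0 'k)" where
  "pmult Q \<equiv> mult (path_algebra Q)"

lemma path_algebra_simps:
  "carrier (path_algebra Q) = {f. Poly_Mapping.keys f \<subseteq> paths Q}"
  "one (path_algebra Q) = (\<Sum>v\<in>verts Q. Poly_Mapping.single (v, []) 1)"
  "zero (path_algebra Q) = 0"
  "add (path_algebra Q) = (+)"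
  "smult (path_algebra Q) = (\<lambda>c. Poly_Mapping.map ((*) c))"
  by (simp_all add: path_algebra_def)

text \<open>The product sums over the supports of its factors, which change under addition. Common
  larger index sets allow products to be added term by term.\<close>

lemma pmult_superset:
  assumes "finite S" "Poly_Mapping.keys f \<subseteq> S" "finite S'" "Poly_Mapping.keys g \<subseteq> S'"
  shows "pmult Q f g = (\<Sum>q\<in>S. \<Sum>p\<in>S'. if path_end Q p = fst q
    then Poly_Mapping.single (fst p, snd p @ snd q) (Poly_Mapping.lookup f q * Poly_Mapping.lookup g p) else 0)"
proof -
  have "pmult Q f g = (\<Sum>q\<in>Poly_Mapping.keys f. \<Sum>p\<in>S'. if path_end Q p = fst q
    then Poly_Mapping.single (fst p, snd p @ snd q) (Poly_Mapping.lookup f q * Poly_Mapping.lookup g p) else 0)"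
    unfolding path_algebra_def monoid.simps using assms(3,4)
    by (intro sum.cong[OF refl] sum.mono_neutral_left) (auto simp: in_keys_iff)
  also have "\<dots> = (\<Sum>q\<in>S. \<Sum>p\<in>S'. if path_end Q p = fst q
    then Poly_Mapping.single (fst p, snd p @ snd q) (Poly_Mapping.lookup f q * Poly_Mapping.lookup g p) else 0)"
    using assms(1,2) by (intro sum.mono_neutral_left) (auto simp: in_keys_iff intro!: sum.neutral)
  finally show ?thesis .
qed

lemma pmult_add_left: "pmult Q (f + f') g = pmult Q f g + pmult Q f' g"
proof -
  let ?S = "Poly_Mapping.keys f \<union> Poly_Mapping.keys f'" and ?S' = "Poly_Mapping.keys g"
  have "pmult Q (f + f') g = (\<Sum>q\<in>?S. \<Sum>p\<in>?S'. if path_end Q p = fst q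
    then Poly_Mapping.single (fst p, snd p @ snd q) (Poly_Mapping.lookup (f + f') q * Poly_Mapping.lookup g p) else 0)"
    using keys_add[of f f'] by (intro pmult_superset) auto
  also have "\<dots> = pmult Q f g + pmult Q f' g"
    by (subst (1 2) pmult_superset[of ?S _ ?S'])
      (auto simp: sum.distrib[symmetric] lookup_add distrib_right single_add intro!: sum.cong)
  finally show ?thesis .
qed

lemma pmult_add_right: "pmult Q f (g + g') = pmult Q f g + pmult Q f g'"
proof -
  let ?S = "Poly_Mapping.keys f" and ?S' = "Poly_Mapping.keys g \<union> Poly_Mapping.keys g'"
  have "pmult Q f (g + g') = (\<Sum>q\<in>?S. \<Sum>p\<in>?S'. if path_end Q p = fst q
    then Poly_Mapping.single (fst p, snd p @ snd q) (Poly_Mapping.lookup f q * Poly_Mapping.lookup (g + g') p) else 0)"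
    using keys_add[of g g'] by (intro pmult_superset) auto
  also have "\<dots> = pmult Q f g + pmult Q f g'"
    by (subst (1 2) pmult_superset[of ?S _ ?S'])
      (auto simp: sum.distrib[symmetric] lookup_add distrib_left single_add intro!: sum.cong)
  finally show ?thesis .
qed

lemma pmult_zero [simp]: "pmult Q 0 g = 0" "pmult Q f 0 = 0"
  using pmult_add_left[of Q 0 0 g] pmult_add_right[of Q f 0 0] by simp_all

lemma pmult_single:
  "pmult Q (Poly_Mapping.single q c) (Poly_Mapping.single p d) =
    (if path_end Q p = fst q then Poly_Mapping.single (fst p, snd p @ snd q) (c * d) else 0)"
  by (subst pmult_superset[of "{q}" _ "{p}"]) auto

lemma pmult_sum_left: "pmult Q (\<Sum>i\<in>I. f i) g = (\<Sum>i\<in>I. pmult Q (f i) g)"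
  by (induction I rule: infinite_finite_induct) (simp_all add: pmult_add_left)

lemma pmult_sum_right: "pmult Q f (\<Sum>i\<in>I. g i) = (\<Sum>i\<in>I. pmult Q f (g i))"
  by (induction I rule: infinite_finite_induct) (simp_all add: pmult_add_right)

lemma pmult_bilinear_induct:
  fixes f g :: "('v, 'a) path \<Rightarrow>\<^sub>0 'k::field"
  assumes "Poly_Mapping.keys f \<subseteq> S" "Poly_Mapping.keys g \<subseteq> S'"
    and "\<And>q c p d. q \<in> S \<Longrightarrow> p \<in> S' \<Longrightarrow> P (Poly_Mapping.single q c) (Poly_Mapping.single p d)"
    and "\<And>f f' g. P f g \<Longrightarrow> P f' g \<Longrightarrow> P (f + f') g"
    and "\<And>f g g'. P f g \<Longrightarrow> P f g' \<Longrightarrow> P f (g + g')"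
    and "\<And>f. P f 0" "\<And>g. P 0 g"
  shows "P f g"
  using assms(1)
proof (induction f rule: poly_mapping_single_induct)
  case (single q c)
  show ?case
    using assms(2) by (induction g rule: poly_mapping_single_induct) (use single assms(3,5,6) in auto)
qed (use assms in auto)

text \<open>Additivity reduces the claim to three paths, one factor at a time. For paths both
  bracketings impose the same two matching conditions, since appending does not change the end of
  the path traversed last.\<close>

lemma pmult_assoc: "pmult Q (pmult Q f g) h = pmult Q f (pmult Q g h)"
proof -
  have *: "pmult Q (pmult Q f (Poly_Mapping.single q b)) (Poly_Mapping.single p c) =
    pmult Q f (pmult Q (Poly_Mapping.single q b) (Poly_Mapping.single p c))" for f q b p c
    using subset_UNIV
    by (induction f rule: poly_mapping_single_induct)
      (auto simp: pmult_single pmult_add_left path_end_append mult.assoc)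
  have "pmult Q (pmult Q f g) (Poly_Mapping.single p c) = pmult Q f (pmult Q g (Poly_Mapping.single p c))"
    for p c
    using subset_UNIV[of "Poly_Mapping.keys g"]
    by (induction g rule: poly_mapping_single_induct)
      (auto simp: * pmult_add_left pmult_add_right)
  note ** = this
  show ?thesis
    using subset_UNIV[of "Poly_Mapping.keys h"]
    by (induction h rule: poly_mapping_single_induct) (auto simp: pmult_add_right **)
qed

lemma pmult_smult:
  "pmult Q (Poly_Mapping.map ((*) c) f) g = Poly_Mapping.map ((*) c) (pmult Q f g)"
  "pmult Q f (Poly_Mapping.map ((*) c) g) = Poly_Mapping.map ((*) c) (pmult Q f g)"
  by (rule pmult_bilinear_induct[of f UNIV g UNIV];
      auto simp: pmult_add_left pmult_add_right map_mult_add pmult_single map_mult_single mult.assoc mult.left_commute)+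

lemma keys_sum_subset:
  "(\<And>i. i \<in> I \<Longrightarrow> Poly_Mapping.keys (h i) \<subseteq> K) \<Longrightarrow> Poly_Mapping.keys (\<Sum>i\<in>I. h i) \<subseteq> K"
  for h :: "'i \<Rightarrow> 'p \<Rightarrow>\<^sub>0 'm::comm_monoid_add"
proof (induction I rule: infinite_finite_induct)
  case (insert i I)
  then show ?case using keys_add[of "h i" "\<Sum>i\<in>I. h i"] by fastforce
qed auto

lemma keys_pmult:
  "Poly_Mapping.keys (pmult Q f g) \<subseteq>
    {(fst p, snd p @ snd q) | q p. q \<in> Poly_Mapping.keys f \<and> p \<in> Poly_Mapping.keys g \<and> path_end Q p = fst q}"
    (is "_ \<subseteq> ?K")
proof -
  have *: "Poly_Mapping.keys (if path_end Q p = fst q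
      then Poly_Mapping.single (fst p, snd p @ snd q) (Poly_Mapping.lookup f q * Poly_Mapping.lookup g p)
      else 0) \<subseteq> ?K"
    if "q \<in> Poly_Mapping.keys f" "p \<in> Poly_Mapping.keys g" for q p
  proof (cases "path_end Q p = fst q")
    case True
    then have "(fst p, snd p @ snd q) \<in> ?K" using that by blast
    then show ?thesis using True by (simp del: mem_Collect_eq)
  qed simp
  show ?thesis
    unfolding path_algebra_def monoid.simps
    by (rule keys_sum_subset, rule keys_sum_subset, rule *)
qed

section \<open>Paths as walks, and the path algebra as an algebra\<close>

context wf_digraph
begin

lemma paths_iff:
  "p \<in> paths G \<longleftrightarrow> fst p \<in> verts G \<and> set (snd p) \<subseteq> arcs G \<and> cas (fst p) (snd p) (path_end G p)"
  by (auto simp: paths_def awalk_def path_end_def awlast_if_cas)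

lemma path_end_in_verts: "p \<in> paths G \<Longrightarrow> path_end G p \<in> verts G"
  using awlast_in_verts by (auto simp: paths_iff path_end_def)

lemma paths_append:
  "p \<in> paths G \<Longrightarrow> q \<in> paths G \<Longrightarrow> path_end G p = fst q \<Longrightarrow> (fst p, snd p @ snd q) \<in> paths G"
  by (simp add: paths_iff path_end_append path_end_def[symmetric])

lemma vertex_path: "v \<in> verts G \<Longrightarrow> (v, []) \<in> paths G"
  by (simp add: paths_iff)

lemma arrow_path: "a \<in> arcs G \<Longrightarrow> (tail G a, [a]) \<in> paths G"
  by (simp add: paths_iff)

lemma path_Nil_iff: "(u, []) \<in> paths G \<longleftrightarrow> u \<in> verts G"
  by (simp add: paths_iff)

lemma path_arrow_iff: "(u, [a]) \<in> paths G \<longleftrightarrow> a \<in> arcs G \<and> u = tail G a"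
  by (auto simp: paths_iff)

lemma path_Cons:
  "(u, a # es) \<in> paths G \<Longrightarrow> a \<in> arcs G \<and> u = tail G a \<and> (head G a, es) \<in> paths G"
  by (auto simp: paths_def awalk_def)

lemma path_snoc:
  "(u, es @ [a]) \<in> paths G \<Longrightarrow> a \<in> arcs G \<and> path_end G (u, es) = tail G a \<and> (u, es) \<in> paths G"
  by (auto simp: paths_iff path_end_def)

end

context fin_digraph
begin

abbreviation PA :: "('k::field, ('a, 'b) path \<Rightarrow>\<^sub>0 'k) module" where
  "PA \<equiv> path_algebra G"

lemma pmult_closed: "f \<in> carrier PA \<Longrightarrow> g \<in> carrier PA \<Longrightarrow> pmult G f g \<in> carrier PA"
  using keys_pmult[of G f g] paths_append by (fastforce simp: path_algebra_simps)

text \<open>Of the trivial paths that make up the unit, only the one at the end of a given path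
  composes with it from the left.\<close>

lemma pmult_one_left: "f \<in> carrier PA \<Longrightarrow> pmult G \<one>\<^bsub>PA\<^esub> f = f"
proof -
  assume "f \<in> carrier PA"
  then have "Poly_Mapping.keys f \<subseteq> paths G" by (simp add: path_algebra_simps)
  then show ?thesis
    by (induction f rule: poly_mapping_single_induct)
      (simp_all add: path_algebra_simps pmult_add_right pmult_sum_left pmult_single
        path_end_in_verts sum.delta sum.distrib)
qed

lemma pmult_one_right: "f \<in> carrier PA \<Longrightarrow> pmult G f \<one>\<^bsub>PA\<^esub> = f"
proof -
  assume "f \<in> carrier PA"
  then have "Poly_Mapping.keys f \<subseteq> paths G" by (simp add: path_algebra_simps)
  then show ?thesis
    by (induction f rule: poly_mapping_single_induct)
      (simp_all add: path_algebra_simps pmult_add_left pmult_sum_right pmult_single paths_iff sum.delta sum.distrib)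
qed

lemma kalgebra_PA: "kalgebra (PA :: ('k::field, ('a, 'b) path \<Rightarrow>\<^sub>0 'k) module)"
proof -
  have "ring (PA :: ('k, ('a, 'b) path \<Rightarrow>\<^sub>0 'k) module)"
  proof (rule ringI)
    show "abelian_group (PA :: ('k, ('a, 'b) path \<Rightarrow>\<^sub>0 'k) module)"
    proof (rule abelian_groupI)
      fix f :: "('a, 'b) path \<Rightarrow>\<^sub>0 'k" assume "f \<in> carrier PA"
      then have "- f \<in> carrier PA" by (simp add: path_algebra_simps)
      moreover have "- f \<oplus>\<^bsub>PA\<^esub> f = \<zero>\<^bsub>PA\<^esub>" by (simp add: path_algebra_simps)
      ultimately show "\<exists>g\<in>carrier PA. g \<oplus>\<^bsub>PA\<^esub> f = \<zero>\<^bsub>PA\<^esub>" by blast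
    qed (auto simp: path_algebra_simps add_ac intro: subset_trans[OF keys_add] dest: subsetD[OF keys_add])
    show "monoid (PA :: ('k, ('a, 'b) path \<Rightarrow>\<^sub>0 'k) module)"
    proof (rule monoidI)
      have "Poly_Mapping.keys (\<Sum>v\<in>verts G. Poly_Mapping.single (v, []) (1::'k)) \<subseteq> paths G"
        by (rule keys_sum_subset) (simp add: vertex_path)
      then show "\<one>\<^bsub>PA\<^esub> \<in> carrier (PA :: ('k, ('a, 'b) path \<Rightarrow>\<^sub>0 'k) module)"
        by (simp add: path_algebra_simps)
    qed (simp_all add: pmult_closed pmult_assoc pmult_one_left pmult_one_right)
  qed (simp_all add: path_algebra_simps(4) pmult_add_left pmult_add_right)
  then interpret ring "PA :: ('k, ('a, 'b) path \<Rightarrow>\<^sub>0 'k) module" .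
  show ?thesis
  proof
    fix f g :: "('a, 'b) path \<Rightarrow>\<^sub>0 'k" and c d
    assume f: "f \<in> carrier PA"
    show "c \<odot>\<^bsub>PA\<^esub> f \<in> carrier PA"
      using f keys_map_mult[of c f] by (auto simp: path_algebra_simps)
    show "(c + d) \<odot>\<^bsub>PA\<^esub> f = c \<odot>\<^bsub>PA\<^esub> f \<oplus>\<^bsub>PA\<^esub> d \<odot>\<^bsub>PA\<^esub> f"
      by (rule poly_mapping_eqI) (simp add: path_algebra_simps lookup_map_mult lookup_add distrib_right)
    show "c \<odot>\<^bsub>PA\<^esub> (d \<odot>\<^bsub>PA\<^esub> f) = (c * d) \<odot>\<^bsub>PA\<^esub> f"
      by (rule poly_mapping_eqI) (simp add: path_algebra_simps lookup_map_mult mult.assoc)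
    show "1 \<odot>\<^bsub>PA\<^esub> f = f"
      by (rule poly_mapping_eqI) (simp add: path_algebra_simps lookup_map_mult)
    show "c \<odot>\<^bsub>PA\<^esub> (f \<oplus>\<^bsub>PA\<^esub> g) = c \<odot>\<^bsub>PA\<^esub> f \<oplus>\<^bsub>PA\<^esub> c \<odot>\<^bsub>PA\<^esub> g"
      by (simp add: path_algebra_simps map_mult_add)
    show "(c \<odot>\<^bsub>PA\<^esub> f) \<otimes>\<^bsub>PA\<^esub> g = c \<odot>\<^bsub>PA\<^esub> (f \<otimes>\<^bsub>PA\<^esub> g)"
      "f \<otimes>\<^bsub>PA\<^esub> (c \<odot>\<^bsub>PA\<^esub> g) = c \<odot>\<^bsub>PA\<^esub> (f \<otimes>\<^bsub>PA\<^esub> g)"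
      by (simp_all add: path_algebra_simps(5) pmult_smult)
  qed
qed

end

section \<open>Algebras of homogeneous bound quivers\<close>

text \<open>The component of degree \<open>t\<close> in the grading by path length.\<close>

definition hcomp :: "nat \<Rightarrow> (('v, 'a) path \<Rightarrow>\<^sub>0 'k::field) \<Rightarrow> (('v, 'a) path \<Rightarrow>\<^sub>0 'k)" where
  "hcomp t f = (\<Sum>p | p \<in> Poly_Mapping.keys f \<and> path_length p = t.
    Poly_Mapping.single p (Poly_Mapping.lookup f p))"

lemma lookup_hcomp:
  "Poly_Mapping.lookup (hcomp t f) p = (if path_length p = t then Poly_Mapping.lookup f p else 0)"
proof -
  have "Poly_Mapping.lookup (hcomp t f) p = (\<Sum>q | q \<in> Poly_Mapping.keys f \<and> path_length q = t.
      if q = p then Poly_Mapping.lookup f q else 0)"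
    by (simp add: hcomp_def lookup_sum lookup_single when_def)
  then show ?thesis by (simp add: sum.delta in_keys_iff)
qed

lemma hcomp_simps:
  "hcomp t 0 = 0" "hcomp t (f + g) = hcomp t f + hcomp t g"
  "hcomp t (Poly_Mapping.map ((*) c) f) = Poly_Mapping.map ((*) c) (hcomp t f)"
  "hcomp t (Poly_Mapping.single p c) = (if path_length p = t then Poly_Mapping.single p c else 0)"
  by (rule poly_mapping_eqI;
      auto simp: lookup_hcomp lookup_add lookup_map_mult lookup_single when_def)+

lemma keys_hcomp: "Poly_Mapping.keys (hcomp t f) \<subseteq> Poly_Mapping.keys f"
  by (auto simp: in_keys_iff lookup_hcomp split: if_splits)

text \<open>Multiplication by a path shifts degrees by its length. The case distinction keeps the
  subtraction of natural numbers from being truncated.\<close>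

lemma hcomp_pmult_single:
  "hcomp t (pmult Q f (Poly_Mapping.single p c)) =
    (if path_length p \<le> t then pmult Q (hcomp (t - path_length p) f) (Poly_Mapping.single p c) else 0)"
  "hcomp t (pmult Q (Poly_Mapping.single p c) f) =
    (if path_length p \<le> t then pmult Q (Poly_Mapping.single p c) (hcomp (t - path_length p) f) else 0)"
  using subset_UNIV[of "Poly_Mapping.keys f"]
  by (induction f rule: poly_mapping_single_induct;
      auto simp: hcomp_simps pmult_single pmult_add_left pmult_add_right)+

locale bound_quiver = fin_digraph Q for Q :: "('v, 'a) pre_digraph" +
  fixes \<rho> :: "(('v, 'a) path \<Rightarrow>\<^sub>0 'k::field) set"
  assumes homogeneous: "homogeneous_bound_quiver Q \<rho>"
begin

abbreviation KQ :: "('k, ('v, 'a) path \<Rightarrow>\<^sub>0 'k) module" where "KQ \<equiv> path_algebra Q"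
abbreviation I where "I \<equiv> relation_ideal Q \<rho>"
abbreviation R where "R \<equiv> residue Q \<rho>"
abbreviation \<Lambda> where "\<Lambda> \<equiv> bound_quiver_algebra Q \<rho>"

sublocale KQ: kalgebra KQ by (rule kalgebra_PA)

sublocale I: ideal I KQ
  using homogeneous unfolding relation_ideal_def homogeneous_bound_quiver_def
  by (intro KQ.genideal_ideal) auto

lemmas KQ_simps = path_algebra_simps

lemma single_closed: "p \<in> paths Q \<Longrightarrow> Poly_Mapping.single p c \<in> carrier KQ"
  by (simp add: KQ_simps)

lemma zero_closed: "0 \<in> carrier KQ"
  by (simp add: KQ_simps)

lemma add_closed: "f \<in> carrier KQ \<Longrightarrow> g \<in> carrier KQ \<Longrightarrow> f + g \<in> carrier KQ"
  using KQ.add.m_closed by (simp add: KQ_simps(4))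

lemma KQ_minus: "f \<in> carrier KQ \<Longrightarrow> g \<in> carrier KQ \<Longrightarrow> f \<ominus>\<^bsub>KQ\<^esub> g = f - g"
proof -
  assume fg: "f \<in> carrier KQ" "g \<in> carrier KQ"
  have "- g \<in> carrier KQ" "- g \<oplus>\<^bsub>KQ\<^esub> g = \<zero>\<^bsub>KQ\<^esub>" using fg by (simp_all add: KQ_simps)
  then have "\<ominus>\<^bsub>KQ\<^esub> g = - g" using fg KQ.minus_equality by blast
  then show ?thesis using fg by (simp add: KQ.minus_eq KQ_simps(4))
qed

lemma I_closed:
  "0 \<in> I" "f \<in> I \<Longrightarrow> g \<in> I \<Longrightarrow> f + g \<in> I" "f \<in> I \<Longrightarrow> Poly_Mapping.map ((*) c) f \<in> I"
proof -
  show "0 \<in> I" using I.zero_closed by (simp add: KQ_simps(3))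
  show "f \<in> I \<Longrightarrow> g \<in> I \<Longrightarrow> f + g \<in> I" using I.a_closed by (simp add: KQ_simps(4))
  assume f: "f \<in> I"
  then have "(c \<odot>\<^bsub>KQ\<^esub> \<one>\<^bsub>KQ\<^esub>) \<otimes>\<^bsub>KQ\<^esub> f \<in> I" by (intro I.I_l_closed) auto
  then show "Poly_Mapping.map ((*) c) f \<in> I"
    using KQ.smult_eq_one_smult[OF I.a_Hcarr[OF f], of c] by (simp add: KQ_simps(5))
qed

text \<open>The \<open>n\<close>-th power of the arrow ideal, described through supports.\<close>

definition filt :: "nat \<Rightarrow> (('v, 'a) path \<Rightarrow>\<^sub>0 'k) set" where
  "filt n = {f \<in> carrier KQ. \<forall>p\<in>Poly_Mapping.keys f. n \<le> path_length p}"

lemma filt_keys: "f \<in> filt n \<longleftrightarrow> Poly_Mapping.keys f \<subseteq> {p \<in> paths Q. n \<le> path_length p}"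
  by (auto simp: filt_def KQ_simps)

lemma filt_closed: "f \<in> filt n \<Longrightarrow> f \<in> carrier KQ"
  by (simp add: filt_def)

lemma filt_0: "filt 0 = carrier KQ"
  by (auto simp: filt_def)

lemma filt_mult: "f \<in> filt m \<Longrightarrow> g \<in> filt n \<Longrightarrow> pmult Q f g \<in> filt (m + n)"
  using keys_pmult[of Q f g] pmult_closed[of f g] by (fastforce simp: filt_def)

lemma filt_add: "f \<in> filt n \<Longrightarrow> g \<in> filt n \<Longrightarrow> f + g \<in> filt n"
  unfolding filt_keys by (rule subset_trans[OF keys_add]) auto

lemma filt_ideal: "ideal (filt n) KQ"
proof (rule KQ.ideal_of_subspace)
  show "subspace KQ (filt n)"
    unfolding subspace_def
  proof (intro conjI ballI allI)
    show "c \<odot>\<^bsub>KQ\<^esub> f \<in> filt n" if "f \<in> filt n" for c f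
      using that keys_map_mult[of c f] by (auto simp: KQ_simps filt_keys)
    show "f \<oplus>\<^bsub>KQ\<^esub> g \<in> filt n" if "f \<in> filt n" "g \<in> filt n" for f g
      using that by (simp add: KQ_simps(4) filt_add)
    show "\<zero>\<^bsub>KQ\<^esub> \<in> filt n" by (simp add: KQ_simps(3) filt_keys)
  qed (auto simp: filt_closed)
  show "a \<otimes>\<^bsub>KQ\<^esub> f \<in> filt n" "f \<otimes>\<^bsub>KQ\<^esub> a \<in> filt n" if "f \<in> filt n" "a \<in> carrier KQ" for f a
    using filt_mult[of a 0 f n] filt_mult[of f n a 0] that by (simp_all add: filt_0)
qed

lemma I_minimal: "ideal J KQ \<Longrightarrow> \<rho> \<subseteq> J \<Longrightarrow> I \<subseteq> J"
  unfolding relation_ideal_def by (rule KQ.genideal_minimal)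

lemma \<rho>_I: "\<rho> \<subseteq> I"
  unfolding relation_ideal_def using homogeneous
  by (intro KQ.genideal_self) (simp add: homogeneous_bound_quiver_def)

lemma I_filt_2: "I \<subseteq> filt 2"
  using homogeneous by (intro I_minimal filt_ideal) (auto simp: filt_def homogeneous_bound_quiver_def)

text \<open>An ideal with homogeneous generators is homogeneous: the elements with all components in
  \<open>I\<close> form an ideal, and it contains each relation, whose components are zero or the
  relation itself.\<close>

lemma hcomp_I: "f \<in> I \<Longrightarrow> hcomp t f \<in> I"
proof -
  define K where "K = {f \<in> carrier KQ. \<forall>t. hcomp t f \<in> I}"
  have "ideal K KQ"
  proof (rule KQ.ideal_of_subspace)
    show "subspace KQ K"
      unfolding subspace_def
    proof (intro conjI ballI allI)
      show "c \<odot>\<^bsub>KQ\<^esub> f \<in> K" if "f \<in> K" for c f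
        using that KQ.smult_closed[of f c] by (simp add: K_def KQ_simps(5) hcomp_simps I_closed)
      show "f \<oplus>\<^bsub>KQ\<^esub> g \<in> K" if "f \<in> K" "g \<in> K" for f g
        using that by (simp add: K_def KQ_simps(4) hcomp_simps I_closed add_closed)
      show "\<zero>\<^bsub>KQ\<^esub> \<in> K"
        by (simp add: K_def KQ_simps(3) hcomp_simps I_closed zero_closed)
    qed (auto simp: K_def)
    fix f a assume f: "f \<in> K" and a: "a \<in> carrier KQ"
    have fc: "f \<in> carrier KQ" using f by (simp add: K_def)
    have "Poly_Mapping.keys a \<subseteq> paths Q" using a by (simp add: KQ_simps)
    then have "\<forall>t. hcomp t (pmult Q a f) \<in> I \<and> hcomp t (pmult Q f a) \<in> I"
    proof (induction a rule: poly_mapping_single_induct)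
      case (single p c)
      have "hcomp t f \<in> I" for t using f by (simp add: K_def)
      then show ?case
        using single_closed[OF single, of c]
        by (auto simp: hcomp_pmult_single I_closed intro: I.I_l_closed I.I_r_closed)
    qed (auto simp: hcomp_simps pmult_add_left pmult_add_right I_closed)
    then show "a \<otimes>\<^bsub>KQ\<^esub> f \<in> K" "f \<otimes>\<^bsub>KQ\<^esub> a \<in> K"
      using fc a by (auto simp: K_def)
  qed
  moreover have "\<rho> \<subseteq> K"
  proof
    fix f assume f: "f \<in> \<rho>"
    have "hcomp t f = 0 \<or> hcomp t f = f" for t
    proof (cases "\<exists>p\<in>Poly_Mapping.keys f. path_length p = t")
      case True
      then have "\<forall>q\<in>Poly_Mapping.keys f. path_length q = t"
        using f homogeneous unfolding homogeneous_bound_quiver_def by blast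
      then have "hcomp t f = f" by (intro poly_mapping_eqI) (auto simp: lookup_hcomp in_keys_iff)
      then show ?thesis by simp
    next
      case False
      then have "hcomp t f = 0" by (intro poly_mapping_eqI) (auto simp: lookup_hcomp in_keys_iff)
      then show ?thesis by simp
    qed
    then have "hcomp t f \<in> I" for t
      using f \<rho>_I I_closed(1) by (metis subsetD)
    then show "f \<in> K" using f \<rho>_I I.a_subset by (auto simp: K_def)
  qed
  ultimately have "I \<subseteq> K" by (rule I_minimal)
  then show "f \<in> I \<Longrightarrow> hcomp t f \<in> I" by (auto simp: K_def)
qed

section \<open>Residue classes modulo the relation ideal\<close>

lemma R_def: "R f = I +>\<^bsub>KQ\<^esub> f"
  by (simp add: residue_def)

lemma \<Lambda>_simps:
  "carrier \<Lambda> = carrier (KQ Quot I)" "mult \<Lambda> = mult (KQ Quot I)" "one \<Lambda> = one (KQ Quot I)"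
  "zero \<Lambda> = zero (KQ Quot I)" "add \<Lambda> = add (KQ Quot I)"
  "smult \<Lambda> = (\<lambda>c X. \<Union>f\<in>X. R (c \<odot>\<^bsub>KQ\<^esub> f))"
  by (simp_all add: bound_quiver_algebra_def quot_algebra_def residue_def ring.defs module.defs)

lemma R_closed [simp, intro]: "f \<in> carrier KQ \<Longrightarrow> R f \<in> carrier \<Lambda>"
  using ring_hom_closed[OF I.rcos_ring_hom] by (simp add: \<Lambda>_simps R_def)

lemma R_surj: "X \<in> carrier \<Lambda> \<Longrightarrow> \<exists>f\<in>carrier KQ. X = R f"
  by (auto simp: \<Lambda>_simps FactRing_def A_RCOSETS_def' R_def)

lemma R_add: "f \<in> carrier KQ \<Longrightarrow> g \<in> carrier KQ \<Longrightarrow> R f \<oplus>\<^bsub>\<Lambda>\<^esub> R g = R (f + g)"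
  using ring_hom_add[OF I.rcos_ring_hom, of f g] by (simp add: \<Lambda>_simps R_def KQ_simps(4))

lemma R_mult: "f \<in> carrier KQ \<Longrightarrow> g \<in> carrier KQ \<Longrightarrow> R f \<otimes>\<^bsub>\<Lambda>\<^esub> R g = R (pmult Q f g)"
  using ring_hom_mult[OF I.rcos_ring_hom, of f g] by (simp add: \<Lambda>_simps R_def)

lemma R_one: "\<one>\<^bsub>\<Lambda>\<^esub> = R \<one>\<^bsub>KQ\<^esub>"
  by (simp add: \<Lambda>_simps FactRing_def R_def)

lemma R_eq_iff: "f \<in> carrier KQ \<Longrightarrow> g \<in> carrier KQ \<Longrightarrow> R f = R g \<longleftrightarrow> f - g \<in> I"
  using KQ.quotient_eq_iff_same_a_r_cos[OF I.ideal_axioms, of f g] by (simp add: R_def KQ_minus)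

lemma R_zero: "\<zero>\<^bsub>\<Lambda>\<^esub> = R 0"
  using KQ.a_coset_add_zero[OF I.a_subset] by (simp add: \<Lambda>_simps FactRing_def R_def KQ_simps(3))

lemma R_eq_zero_iff: "f \<in> carrier KQ \<Longrightarrow> R f = \<zero>\<^bsub>\<Lambda>\<^esub> \<longleftrightarrow> f \<in> I"
  by (simp add: R_zero R_eq_iff zero_closed)

lemma R_self: "f \<in> carrier KQ \<Longrightarrow> f \<in> R f"
  by (simp add: R_def I.a_rcos_self)

lemma R_memD: "f \<in> carrier KQ \<Longrightarrow> g \<in> R f \<Longrightarrow> g \<in> carrier KQ \<and> g - f \<in> I"
proof -
  assume f: "f \<in> carrier KQ" and g: "g \<in> R f"
  then obtain h where "h \<in> I" "g = h + f" by (auto simp: R_def a_r_coset_def' KQ_simps(4))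
  then show ?thesis using f add_closed I.a_Hcarr by auto
qed

text \<open>Scalar multiplication on the quotient is a union of cosets over all representatives;
  these cosets coincide because the ideal is closed under scalars.\<close>

lemma R_smult:
  assumes f: "f \<in> carrier KQ"
  shows "c \<odot>\<^bsub>\<Lambda>\<^esub> R f = R (Poly_Mapping.map ((*) c) f)"
proof -
  have "R (c \<odot>\<^bsub>KQ\<^esub> g) = R (Poly_Mapping.map ((*) c) f)" if g: "g \<in> R f" for g
  proof -
    have gc: "g \<in> carrier KQ" and gf: "g - f \<in> I" using R_memD[OF f g] by auto
    have "Poly_Mapping.map ((*) c) g - Poly_Mapping.map ((*) c) f = Poly_Mapping.map ((*) c) (g - f)"
      by (rule poly_mapping_eqI) (simp add: lookup_minus lookup_map_mult right_diff_distrib)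
    then have "Poly_Mapping.map ((*) c) g - Poly_Mapping.map ((*) c) f \<in> I"
      using I_closed(3)[OF gf] by simp
    then show ?thesis
      using R_eq_iff KQ.smult_closed[OF gc, of c] KQ.smult_closed[OF f, of c] by (simp add: KQ_simps(5))
  qed
  then show ?thesis using R_self[OF f] unfolding \<Lambda>_simps by auto
qed

lemma kalgebra_\<Lambda>: "kalgebra \<Lambda>"
proof -
  have sm: "Poly_Mapping.map ((*) c) f \<in> carrier KQ" if "f \<in> carrier KQ" for c f
    using KQ.smult_closed[OF that, of c] by (simp add: KQ_simps(5))
  have "ring \<Lambda>"
  proof (rule ringI)
    show "abelian_group \<Lambda>"
    proof (rule abelian_groupI)
      fix X assume "X \<in> carrier \<Lambda>"
      then obtain f where f: "f \<in> carrier KQ" "X = R f" using R_surj by blast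
      have "- f \<in> carrier KQ" using f by (simp add: KQ_simps)
      then show "\<exists>Y\<in>carrier \<Lambda>. Y \<oplus>\<^bsub>\<Lambda>\<^esub> X = \<zero>\<^bsub>\<Lambda>\<^esub>"
        using f by (intro bexI[of _ "R (- f)"]) (auto simp: R_add R_zero)
    qed (auto dest!: R_surj simp: R_add R_zero add_closed zero_closed add_ac)
    show "monoid \<Lambda>"
      by (rule monoidI) (auto dest!: R_surj
          simp: R_mult R_one pmult_closed pmult_assoc pmult_one_left pmult_one_right)
  qed (auto dest!: R_surj simp: R_mult R_add add_closed pmult_closed pmult_add_left pmult_add_right)
  then interpret ring \<Lambda> .
  show ?thesis
  proof
    fix X Y c d
    assume "X \<in> carrier \<Lambda>"
    then obtain f where f: "f \<in> carrier KQ" "X = R f" using R_surj by blast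
    show "c \<odot>\<^bsub>\<Lambda>\<^esub> X \<in> carrier \<Lambda>" using f by (simp add: R_smult sm R_closed)
    show "(c + d) \<odot>\<^bsub>\<Lambda>\<^esub> X = c \<odot>\<^bsub>\<Lambda>\<^esub> X \<oplus>\<^bsub>\<Lambda>\<^esub> d \<odot>\<^bsub>\<Lambda>\<^esub> X"
      using f KQ.smult_l_distr[OF f(1), of c d] by (simp add: R_smult R_add sm KQ_simps(4,5))
    show "c \<odot>\<^bsub>\<Lambda>\<^esub> (d \<odot>\<^bsub>\<Lambda>\<^esub> X) = (c * d) \<odot>\<^bsub>\<Lambda>\<^esub> X"
      using f KQ.smult_smult[OF f(1), of c d] by (simp add: R_smult sm KQ_simps(5))
    show "1 \<odot>\<^bsub>\<Lambda>\<^esub> X = X"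
      using f KQ.smult_one[OF f(1)] by (simp add: R_smult KQ_simps(5))
    assume "Y \<in> carrier \<Lambda>"
    then obtain g where g: "g \<in> carrier KQ" "Y = R g" using R_surj by blast
    show "c \<odot>\<^bsub>\<Lambda>\<^esub> (X \<oplus>\<^bsub>\<Lambda>\<^esub> Y) = c \<odot>\<^bsub>\<Lambda>\<^esub> X \<oplus>\<^bsub>\<Lambda>\<^esub> c \<odot>\<^bsub>\<Lambda>\<^esub> Y"
      using f g by (simp add: R_smult R_add sm add_closed map_mult_add)
    show "(c \<odot>\<^bsub>\<Lambda>\<^esub> X) \<otimes>\<^bsub>\<Lambda>\<^esub> Y = c \<odot>\<^bsub>\<Lambda>\<^esub> (X \<otimes>\<^bsub>\<Lambda>\<^esub> Y)"
      "X \<otimes>\<^bsub>\<Lambda>\<^esub> (c \<odot>\<^bsub>\<Lambda>\<^esub> Y) = c \<odot>\<^bsub>\<Lambda>\<^esub> (X \<otimes>\<^bsub>\<Lambda>\<^esub> Y)"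
      using f g by (simp_all add: R_smult R_mult sm pmult_closed pmult_smult)
  qed
qed

sublocale \<Lambda>: kalgebra \<Lambda> by (rule kalgebra_\<Lambda>)

text \<open>Well defined on residue classes for \<open>p\<close> of length at most 1 only, since \<open>I \<subseteq> filt 2\<close>.\<close>

definition coef :: "('v, 'a) path \<Rightarrow> (('v, 'a) path \<Rightarrow>\<^sub>0 'k) set \<Rightarrow> 'k" where
  "coef p X = Poly_Mapping.lookup (SOME f. f \<in> X) p"

lemma coef_R:
  assumes f: "f \<in> carrier KQ" and p: "path_length p < 2"
  shows "coef p (R f) = Poly_Mapping.lookup f p"
proof -
  have "(SOME g. g \<in> R f) \<in> R f" using R_self[OF f] by (rule someI)
  then have "(SOME g. g \<in> R f) - f \<in> filt 2" using R_memD[OF f] I_filt_2 by blast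
  then have "p \<notin> Poly_Mapping.keys ((SOME g. g \<in> R f) - f)" using p by (auto simp: filt_def)
  then show ?thesis by (simp add: coef_def in_keys_iff lookup_minus)
qed

lemma functional_coef: "path_length p < 2 \<Longrightarrow> functional \<Lambda> (coef p)"
proof -
  assume p: "path_length p < 2"
  have sm: "Poly_Mapping.map ((*) c) f \<in> carrier KQ" if "f \<in> carrier KQ" for c f
    using KQ.smult_closed[OF that, of c] by (simp add: KQ_simps(5))
  show ?thesis
    by (auto dest!: R_surj simp: functional_def R_add R_smult coef_R p add_closed sm lookup_add lookup_map_mult)
qed

text \<open>A trivial path is a product of two paths only when both are that same trivial path. This
  makes the coefficient at a vertex a character.\<close>

lemma lookup_pmult_vertex:
  "Poly_Mapping.lookup (pmult Q f g) (i, []) = Poly_Mapping.lookup f (i, []) * Poly_Mapping.lookup g (i, [])"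
  by (rule pmult_bilinear_induct[of f UNIV g UNIV])
    (auto simp: pmult_single pmult_add_left pmult_add_right lookup_add lookup_single when_def algebra_simps)

lemma filt_1I:
  assumes "f \<in> carrier KQ" "\<And>i. i \<in> verts Q \<Longrightarrow> Poly_Mapping.lookup f (i, []) = 0"
  shows "f \<in> filt 1"
proof -
  have "path_length p \<noteq> 0" if p: "p \<in> Poly_Mapping.keys f" for p
  proof
    assume "path_length p = 0"
    then have "p = (fst p, [])" by (cases p) simp
    moreover have "p \<in> paths Q" using assms(1) p by (auto simp: KQ_simps)
    ultimately have "Poly_Mapping.lookup f p = 0" using assms(2) path_Nil_iff by metis
    then show False using p by (simp add: in_keys_iff)
  qed
  then show ?thesis using assms(1) by (auto simp: filt_def Suc_le_eq)
qed

lemma filt_2I: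
  assumes "f \<in> filt 1" "\<And>a. a \<in> arcs Q \<Longrightarrow> Poly_Mapping.lookup f (tail Q a, [a]) = 0"
  shows "f \<in> filt 2"
proof -
  have "path_length p \<noteq> 1" if p: "p \<in> Poly_Mapping.keys f" for p
  proof
    assume "path_length p = 1"
    then obtain u a where ua: "p = (u, [a])" by (cases p) (auto simp: length_Suc_conv)
    moreover have "p \<in> paths Q" using assms(1) p by (auto simp: filt_keys)
    ultimately have "Poly_Mapping.lookup f p = 0" using assms(2) path_arrow_iff by metis
    then show False using p by (simp add: in_keys_iff)
  qed
  then show ?thesis using assms(1) by (fastforce simp: filt_def)
qed

text \<open>
  Only finitely many path lengths occur in representatives of a spanning set, so by homogeneity of
  the relation ideal all longer paths vanish.
\<close>

lemma filt_subset_I: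
  assumes "finite_dimensional \<Lambda>"
  shows "\<exists>N. filt N \<subseteq> I"
proof -
  obtain B where B: "finite B" "B \<subseteq> carrier \<Lambda>"
    and span: "\<forall>X\<in>carrier \<Lambda>. \<exists>c. X = (\<Oplus>\<^bsub>\<Lambda>\<^esub>b\<in>B. c b \<odot>\<^bsub>\<Lambda>\<^esub> b)"
    using assms unfolding finite_dimensional_def by blast
  define S where "S N = {f \<in> carrier KQ. \<forall>p\<in>Poly_Mapping.keys f. path_length p < N}" for N
  have "\<exists>N. B \<subseteq> R ` S N"
    using B
  proof (induction B rule: finite_induct)
    case (insert b B)
    then obtain N where N: "B \<subseteq> R ` S N" by auto
    obtain f where f: "f \<in> carrier KQ" "b = R f" using insert.prems R_surj by blast
    have "finite (path_length ` Poly_Mapping.keys f)" by simp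
    then obtain M where M: "\<And>p. p \<in> Poly_Mapping.keys f \<Longrightarrow> path_length p < M"
      using finite_nat_set_iff_bounded by (metis imageI)
    have "S N \<subseteq> S (N + M)" by (fastforce simp: S_def)
    moreover have "f \<in> S (N + M)" using f M by (fastforce simp: S_def)
    ultimately show ?case using N f by blast
  qed simp
  then obtain N where N: "B \<subseteq> R ` S N" by blast
  have "subspace \<Lambda> (R ` S N)"
    unfolding subspace_def
  proof (intro conjI ballI allI)
    show "R ` S N \<subseteq> carrier \<Lambda>" by (auto simp: S_def)
    have "0 \<in> S N" by (simp add: S_def zero_closed)
    then show "\<zero>\<^bsub>\<Lambda>\<^esub> \<in> R ` S N" by (auto simp: R_zero)
    fix X assume "X \<in> R ` S N"
    then obtain f where f: "f \<in> S N" "X = R f" by blast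
    have "Poly_Mapping.map ((*) c) f \<in> S N" for c
      using f KQ.smult_closed[of f c] keys_map_mult[of c f] by (auto simp: S_def KQ_simps(5))
    then show "c \<odot>\<^bsub>\<Lambda>\<^esub> X \<in> R ` S N" for c using f by (auto simp: R_smult S_def)
    fix Y assume "Y \<in> R ` S N"
    then obtain g where g: "g \<in> S N" "Y = R g" by blast
    have "f + g \<in> S N"
      using f g keys_add[of f g] add_closed by (auto simp: S_def dest!: subsetD)
    then show "X \<oplus>\<^bsub>\<Lambda>\<^esub> Y \<in> R ` S N" using f g by (auto simp: R_add S_def)
  qed
  then have RS: "X \<in> R ` S N" if "X \<in> carrier \<Lambda>" for X
    using span that B(1) N \<Lambda>.subspace_finsum[of "R ` S N" B] subspaceD(4)[of \<Lambda> "R ` S N"]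
    by (smt (verit, best) Pi_I subset_iff)
  have single: "Poly_Mapping.single p c \<in> I" if p: "p \<in> paths Q" "N \<le> path_length p" for p c
  proof -
    obtain g where g: "g \<in> S N" "R (Poly_Mapping.single p c) = R g"
      using RS[OF R_closed[OF single_closed[OF p(1)]]] by blast
    then have "Poly_Mapping.single p c - g \<in> I" using R_eq_iff single_closed p by (auto simp: S_def)
    \<comment> \<open>All paths in \<open>g\<close> are shorter than \<open>p\<close>, so taking the
      component in the degree of \<open>p\<close> removes \<open>g\<close> and leaves the multiple
      of \<open>p\<close>.\<close>
    then have "hcomp (path_length p) (Poly_Mapping.single p c - g) \<in> I" by (rule hcomp_I)
    moreover have "hcomp (path_length p) (Poly_Mapping.single p c - g) = Poly_Mapping.single p c"
    proof (rule poly_mapping_eqI)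
      fix q
      have "q \<notin> Poly_Mapping.keys g" if "path_length q = path_length p"
        using g(1) that p(2) by (auto simp: S_def)
      then show "Poly_Mapping.lookup (hcomp (path_length p) (Poly_Mapping.single p c - g)) q =
          Poly_Mapping.lookup (Poly_Mapping.single p c) q"
        by (auto simp: lookup_hcomp lookup_minus lookup_single when_def in_keys_iff)
    qed
    ultimately show ?thesis by simp
  qed
  have "f \<in> I" if "f \<in> filt N" for f
    using that unfolding filt_keys
    by (induction f rule: poly_mapping_single_induct) (auto simp: I_closed single)
  then show ?thesis by blast
qed

text \<open>Yields nilpotency of the arrow ideal modulo relations, as \<open>filt n\<close> is
  contained in the relation ideal for some \<open>n\<close>.\<close>

lemma R_pow: "f \<in> filt 1 \<Longrightarrow> \<exists>g\<in>filt n. R f [^]\<^bsub>\<Lambda>\<^esub> n = R g"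
proof (induction n)
  case 0
  show ?case using KQ.one_closed by (intro bexI[of _ "\<one>\<^bsub>KQ\<^esub>"]) (auto simp: R_one filt_0)
next
  case (Suc n)
  then obtain g where g: "g \<in> filt n" "R f [^]\<^bsub>\<Lambda>\<^esub> n = R g" by blast
  have "pmult Q g f \<in> filt (Suc n)" using filt_mult[OF g(1) Suc.prems] by simp
  then show ?case using g Suc.prems by (auto simp: R_mult filt_closed)
qed

lemma R_sum:
  "finite S \<Longrightarrow> (\<And>i. i \<in> S \<Longrightarrow> f i \<in> carrier KQ) \<Longrightarrow>
    (\<Oplus>\<^bsub>\<Lambda>\<^esub>i\<in>S. R (f i)) = R (\<Sum>i\<in>S. f i) \<and> (\<Sum>i\<in>S. f i) \<in> carrier KQ"
  by (induction S rule: finite_induct) (auto simp: R_zero zero_closed R_add add_closed Pi_iff)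

text \<open>The characters are the coefficients at the trivial paths. An element killed by all of
  them is represented in the arrow ideal, and a high power of it is represented by long paths, which
  vanish in finite dimension.\<close>

lemma split_basic_algebra_\<Lambda>:
  assumes "finite_dimensional \<Lambda>"
  shows "split_basic_algebra \<Lambda> (verts Q) (vertex_idem Q \<rho>) (\<lambda>i. coef (i, []))"
proof
  fix i j assume ij: "i \<in> verts Q" "j \<in> verts Q"
  note sc = single_closed[OF vertex_path[OF ij(1)], of 1] single_closed[OF vertex_path[OF ij(2)], of 1]
  show "vertex_idem Q \<rho> i \<in> carrier \<Lambda>" using sc by (simp add: path_class_def R_closed)
  show "vertex_idem Q \<rho> i \<otimes>\<^bsub>\<Lambda>\<^esub> vertex_idem Q \<rho> j = (if i = j then vertex_idem Q \<rho> i else \<zero>\<^bsub>\<Lambda>\<^esub>)"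
    using sc by (auto simp: path_class_def R_mult pmult_single R_zero)
  show "functional \<Lambda> (coef (i, []))" by (simp add: functional_coef)
  show "coef (i, []) (vertex_idem Q \<rho> j) = (if i = j then 1 else 0)"
    using sc by (simp add: path_class_def coef_R lookup_single when_def)
next
  fix i X Y assume "X \<in> carrier \<Lambda>" "Y \<in> carrier \<Lambda>"
  then show "coef (i, []) (X \<otimes>\<^bsub>\<Lambda>\<^esub> Y) = coef (i, []) X * coef (i, []) Y"
    by (auto dest!: R_surj simp: R_mult coef_R pmult_closed lookup_pmult_vertex)
next
  fix X assume X: "X \<in> carrier \<Lambda>" "\<And>i. i \<in> verts Q \<Longrightarrow> coef (i, []) X = 0"
  then obtain f where f: "f \<in> carrier KQ" "X = R f" using R_surj by blast
  then have f1: "f \<in> filt 1" using X(2) by (intro filt_1I) (simp_all add: coef_R)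
  obtain N where N: "filt N \<subseteq> I" using filt_subset_I[OF assms] by blast
  obtain g where "g \<in> filt N" "X [^]\<^bsub>\<Lambda>\<^esub> N = R g" using R_pow[OF f1] f by blast
  then have "X [^]\<^bsub>\<Lambda>\<^esub> N = \<zero>\<^bsub>\<Lambda>\<^esub>" using N R_eq_zero_iff filt_closed by auto
  then show "\<exists>n::nat. X [^]\<^bsub>\<Lambda>\<^esub> n = \<zero>\<^bsub>\<Lambda>\<^esub>" by blast
next
  show "(\<Oplus>\<^bsub>\<Lambda>\<^esub>i\<in>verts Q. vertex_idem Q \<rho> i) = \<one>\<^bsub>\<Lambda>\<^esub>"
    using R_sum[of "verts Q" "\<lambda>v. Poly_Mapping.single (v, []) 1"]
    by (simp add: path_class_def R_one KQ_simps(2) single_closed vertex_path)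
qed simp

end

section \<open>Radical, radical square and socle of a finite-dimensional bound quiver
  algebra\<close>

locale fin_dim_bound_quiver = bound_quiver Q \<rho>
  for Q :: "('v, 'a) pre_digraph" and \<rho> :: "(('v, 'a) path \<Rightarrow>\<^sub>0 'k::field) set" +
  assumes fin_dim: "finite_dimensional (bound_quiver_algebra Q \<rho>)"
begin

sublocale S: split_basic_algebra \<Lambda> "verts Q" "vertex_idem Q \<rho>" "\<lambda>i. coef (i, [])"
  by (rule split_basic_algebra_\<Lambda>[OF fin_dim])

abbreviation x where "x a \<equiv> path_class Q \<rho> (tail Q a, [a])"
abbreviation \<alpha> where "\<alpha> a \<equiv> coef (tail Q a, [a])"

lemma rad_iff: "X \<in> S.rad \<longleftrightarrow> X \<in> R ` filt 1"
proof
  assume "X \<in> S.rad"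
  then have X: "X \<in> carrier \<Lambda>" "\<And>i. i \<in> verts Q \<Longrightarrow> coef (i, []) X = 0" by (auto simp: S.rad_def)
  then obtain f where f: "f \<in> carrier KQ" "X = R f" using R_surj by blast
  then have "f \<in> filt 1" using X(2) by (intro filt_1I) (simp_all add: coef_R)
  then show "X \<in> R ` filt 1" using f by blast
next
  assume "X \<in> R ` filt 1"
  then obtain f where f: "f \<in> filt 1" "X = R f" by blast
  have "(i, []) \<notin> Poly_Mapping.keys f" for i using f(1) by (auto simp: filt_def)
  then show "X \<in> S.rad"
    using f filt_closed by (simp add: S.rad_def coef_R in_keys_iff R_closed)
qed

lemma x_R: "x a = R (Poly_Mapping.single (tail Q a, [a]) 1)"
  by (simp add: path_class_def)

lemma x_in_rad: "a \<in> arcs Q \<Longrightarrow> x a \<in> S.rad"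
  unfolding rad_iff x_R by (auto simp: filt_keys arrow_path)

text \<open>Composition from right to left makes the first arrow of a path the rightmost factor; in
  \<open>R_single_snoc\<close> the last arrow is the leftmost one.\<close>

lemma R_single_Cons:
  assumes "(u, a # es) \<in> paths Q"
  shows "a \<in> arcs Q" "R (Poly_Mapping.single (u, a # es) c) =
    R (Poly_Mapping.single (head Q a, es) c) \<otimes>\<^bsub>\<Lambda>\<^esub> x a"
    "R (Poly_Mapping.single (head Q a, es) c) \<in> carrier \<Lambda>"
proof -
  have p: "a \<in> arcs Q" "u = tail Q a" "(head Q a, es) \<in> paths Q" using path_Cons[OF assms] by auto
  note sc = single_closed[OF p(3)] single_closed[OF arrow_path[OF p(1)]]
  show "a \<in> arcs Q" "R (Poly_Mapping.single (head Q a, es) c) \<in> carrier \<Lambda>" using p sc by auto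
  show "R (Poly_Mapping.single (u, a # es) c) = R (Poly_Mapping.single (head Q a, es) c) \<otimes>\<^bsub>\<Lambda>\<^esub> x a"
    using p sc unfolding x_R by (simp add: R_mult pmult_single)
qed

lemma R_single_snoc:
  assumes "(u, es @ [a]) \<in> paths Q"
  shows "a \<in> arcs Q" "R (Poly_Mapping.single (u, es @ [a]) c) =
    x a \<otimes>\<^bsub>\<Lambda>\<^esub> R (Poly_Mapping.single (u, es) c)"
    "R (Poly_Mapping.single (u, es) c) \<in> carrier \<Lambda>"
proof -
  have p: "a \<in> arcs Q" "path_end Q (u, es) = tail Q a" "(u, es) \<in> paths Q"
    using path_snoc[OF assms] by auto
  note sc = single_closed[OF p(3)] single_closed[OF arrow_path[OF p(1)]]
  show "a \<in> arcs Q" "R (Poly_Mapping.single (u, es) c) \<in> carrier \<Lambda>" using p sc by auto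
  show "R (Poly_Mapping.single (u, es @ [a]) c) = x a \<otimes>\<^bsub>\<Lambda>\<^esub> R (Poly_Mapping.single (u, es) c)"
    using p sc unfolding x_R by (simp add: R_mult pmult_single)
qed

text \<open>Both sides are the image of \<open>filt 2\<close>: a path of length at least 2 splits
  into its first arrow and a nonempty remainder, and the coefficients at arrows do not depend on the
  representative because relations have length at least 2.\<close>

lemma rad_square: "ideal_prod \<Lambda> S.rad S.rad = {Y \<in> S.rad. \<forall>a\<in>arcs Q. \<alpha> a Y = 0}"
proof (intro subset_antisym subsetI)
  fix X assume "X \<in> ideal_prod \<Lambda> S.rad S.rad"
  then have "X \<in> R ` filt 2"
  proof (induction X rule: ideal_prod.induct)
    case (prod X Y)
    then obtain f g where fg: "f \<in> filt 1" "X = R f" "g \<in> filt 1" "Y = R g" unfolding rad_iff by blast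
    have "pmult Q f g \<in> filt (1 + 1)" using fg by (intro filt_mult)
    then have "pmult Q f g \<in> filt 2" by (simp only: one_add_one)
    then show ?case using fg filt_closed by (auto simp: R_mult)
  next
    case (sum X Y)
    then obtain f g where fg: "f \<in> filt 2" "X = R f" "g \<in> filt 2" "Y = R g" by blast
    then show ?case using filt_add[of f 2 g] filt_closed by (auto simp: R_add)
  qed
  then obtain f where f: "f \<in> filt 2" "X = R f" by blast
  have "f \<in> filt 1" using f by (auto simp: filt_def)
  moreover have "(u, [a]) \<notin> Poly_Mapping.keys f" for u a using f(1) by (auto simp: filt_def)
  ultimately show "X \<in> {Y \<in> S.rad. \<forall>a\<in>arcs Q. \<alpha> a Y = 0}"
    using f filt_closed unfolding rad_iff by (auto simp: coef_R in_keys_iff)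
next
  fix X assume X: "X \<in> {Y \<in> S.rad. \<forall>a\<in>arcs Q. \<alpha> a Y = 0}"
  then obtain f where f: "f \<in> filt 1" "X = R f" unfolding rad_iff by blast
  have "f \<in> filt 2"
    using X f filt_closed by (intro filt_2I) (auto simp: coef_R)
  then have "R f \<in> ideal_prod \<Lambda> S.rad S.rad"
    unfolding filt_keys
  proof (induction f rule: poly_mapping_single_induct)
    case zero
    show ?case using subspaceD(2)[OF S.subspace_ideal[OF S.ideal_prod_rad]] by (simp add: R_zero)
  next
    case (single p c)
    then obtain u a es where ua: "p = (u, a # es)" by (cases p; cases "snd p") auto
    then have "es \<noteq> []" using single by auto
    then have p: "p = (u, a # es)" "es \<noteq> []" "(u, a # es) \<in> paths Q" using ua single by auto
    have "(head Q a, es) \<in> paths Q" using path_Cons[OF p(3)] by blast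
    then have "Poly_Mapping.single (head Q a, es) c \<in> filt 1"
      using p(2) by (auto simp: filt_keys Suc_le_eq)
    then show ?case
      using p x_in_rad R_single_Cons[OF p(3)]
      by (auto simp: rad_iff intro!: ideal_prod.prod)
  next
    case (add g h)
    have "R g \<oplus>\<^bsub>\<Lambda>\<^esub> R h \<in> ideal_prod \<Lambda> S.rad S.rad" using add by (intro ideal_prod.sum)
    moreover have "g \<in> carrier KQ" "h \<in> carrier KQ" using add by (auto simp: KQ_simps)
    ultimately show ?case by (simp add: R_add)
  qed
  then show "X \<in> ideal_prod \<Lambda> S.rad S.rad" using f by simp
qed

text \<open>The radical is spanned by nontrivial paths, and each of them has an arrow as its
  outermost factor on either side.\<close>

lemma bisocleI:
  assumes Y: "Y \<in> carrier \<Lambda>"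
    and x0: "\<And>a. a \<in> arcs Q \<Longrightarrow> Y \<otimes>\<^bsub>\<Lambda>\<^esub> x a = \<zero>\<^bsub>\<Lambda>\<^esub> \<and> x a \<otimes>\<^bsub>\<Lambda>\<^esub> Y = \<zero>\<^bsub>\<Lambda>\<^esub>"
  shows "Y \<in> S.bisocle"
proof -
  have "Y \<otimes>\<^bsub>\<Lambda>\<^esub> R f = \<zero>\<^bsub>\<Lambda>\<^esub> \<and> R f \<otimes>\<^bsub>\<Lambda>\<^esub> Y = \<zero>\<^bsub>\<Lambda>\<^esub>" if "f \<in> filt 1" for f
    using that unfolding filt_keys
  proof (induction f rule: poly_mapping_single_induct)
    case zero
    then show ?case using Y by (simp add: R_zero[symmetric])
  next
    case (single p c)
    then obtain u a es where p: "p = (u, a # es)" "(u, a # es) \<in> paths Q"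
      by (cases p; cases "snd p") auto
    \<comment> \<open>Multiplied from the left, \<open>Y\<close> meets the last arrow
      \<open>b\<close> of the path; multiplied from the right, it meets the first arrow
      \<open>a\<close>. Hence both decompositions are needed.\<close>
    obtain es' b where p': "p = (u, es' @ [b])" using p(1) by (metis list.distinct(1) rev_exhaust)
    have "(u, es' @ [b]) \<in> paths Q" using p p' by simp
    note snoc = R_single_snoc[OF this] and cons = R_single_Cons[OF p(2)]
    have xc: "x a \<in> carrier \<Lambda>" "x b \<in> carrier \<Lambda>" using x_in_rad S.rad_closed snoc(1) cons(1) by auto
    have "Y \<otimes>\<^bsub>\<Lambda>\<^esub> R (Poly_Mapping.single p c) = Y \<otimes>\<^bsub>\<Lambda>\<^esub> x b \<otimes>\<^bsub>\<Lambda>\<^esub> R (Poly_Mapping.single (u, es') c)"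
      unfolding p' snoc(2) using Y xc snoc(3) by (simp add: \<Lambda>.m_assoc)
    moreover have "R (Poly_Mapping.single p c) \<otimes>\<^bsub>\<Lambda>\<^esub> Y =
        R (Poly_Mapping.single (head Q a, es) c) \<otimes>\<^bsub>\<Lambda>\<^esub> (x a \<otimes>\<^bsub>\<Lambda>\<^esub> Y)"
      unfolding p(1) cons(2) using Y xc cons(3) by (simp add: \<Lambda>.m_assoc)
    ultimately show ?case using x0[OF snoc(1)] x0[OF cons(1)] snoc(3) cons(3) by simp
  next
    case (add g h)
    then have "g \<in> carrier KQ" "h \<in> carrier KQ" by (auto simp: KQ_simps)
    then show ?case using add Y by (simp add: R_add[symmetric] \<Lambda>.l_distr \<Lambda>.r_distr R_closed)
  qed
  then have "Y \<otimes>\<^bsub>\<Lambda>\<^esub> Z = \<zero>\<^bsub>\<Lambda>\<^esub> \<and> Z \<otimes>\<^bsub>\<Lambda>\<^esub> Y = \<zero>\<^bsub>\<Lambda>\<^esub>" if "Z \<in> S.rad" for Z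
    using that unfolding rad_iff by blast
  then show ?thesis using Y by (simp add: S.bisocle_def)
qed

text \<open>Compression by the vertex idempotents keeps only paths from \<open>i\<close> to
  \<open>j\<close>, and the arrow \<open>a\<close> is not among them.\<close>

lemma \<alpha>_corner:
  assumes "a \<in> arcs Q" "i \<in> verts Q" "j \<in> verts Q" "Y \<in> carrier \<Lambda>"
    "\<not> (tail Q a = i \<and> head Q a = j)"
  shows "\<alpha> a (vertex_idem Q \<rho> j \<otimes>\<^bsub>\<Lambda>\<^esub> Y \<otimes>\<^bsub>\<Lambda>\<^esub> vertex_idem Q \<rho> i) = 0"
proof -
  obtain f where f: "f \<in> carrier KQ" "Y = R f" using R_surj assms(4) by blast
  have "Poly_Mapping.lookup (pmult Q (pmult Q (Poly_Mapping.single (j, []) 1) f)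
      (Poly_Mapping.single (i, []) 1)) (tail Q a, [a]) = 0"
    using subset_UNIV[of "Poly_Mapping.keys f"]
  proof (induction f rule: poly_mapping_single_induct)
    case (single p c)
    then show ?case
      using assms(5) by (cases p) (auto simp: pmult_single lookup_single when_def)
  qed (auto simp: pmult_add_left pmult_add_right lookup_add)
  then show ?thesis
    using f single_closed[OF vertex_path[OF assms(2)], of 1] single_closed[OF vertex_path[OF assms(3)], of 1]
    by (simp add: path_class_def R_mult pmult_closed coef_R)
qed

lemma x_corner:
  assumes a: "a \<in> arcs Q"
  shows "vertex_idem Q \<rho> (head Q a) \<otimes>\<^bsub>\<Lambda>\<^esub> x a \<otimes>\<^bsub>\<Lambda>\<^esub> vertex_idem Q \<rho> (tail Q a) = x a"
  using a single_closed[OF arrow_path[OF a], of 1] single_closed[OF vertex_path, of _ 1]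
  by (simp add: path_class_def R_mult pmult_closed pmult_single)

text \<open>An arrow multiplied at either end either does not fit, or it produces a properly longer
  path, which is zero by maximality.\<close>

lemma maximal_bound_path_bisocle:
  assumes p: "maximal_bound_path Q \<rho> p"
  shows "path_class Q \<rho> p \<in> S.bisocle"
proof (rule bisocleI)
  have pp: "p \<in> paths Q" using p by (simp add: maximal_bound_path_def bound_path_def)
  have pc: "Poly_Mapping.single p 1 \<in> carrier KQ" using pp by (rule single_closed)
  then show "path_class Q \<rho> p \<in> carrier \<Lambda>" by (simp add: path_class_def R_closed)
  have zero: "path_class Q \<rho> p' = \<zero>\<^bsub>\<Lambda>\<^esub>" if "p' \<in> paths Q" "subpath Q p p'" "p' \<noteq> p" for p'
    using p that unfolding maximal_bound_path_def bound_path_def by blast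
  fix a assume a: "a \<in> arcs Q"
  note ac = single_closed[OF arrow_path[OF a], of 1]
  have "path_class Q \<rho> p \<otimes>\<^bsub>\<Lambda>\<^esub> x a = \<zero>\<^bsub>\<Lambda>\<^esub>"
  proof (cases "head Q a = fst p")
    case True
    let ?p = "(tail Q a, [a] @ snd p)"
    have "?p \<in> paths Q" using paths_append[OF arrow_path[OF a] pp] True by simp
    moreover have "subpath Q p ?p"
      unfolding subpath_def
      by (rule exI[of _ "(tail Q a, [a])"], rule exI[of _ "[]"]) (simp add: True)
    moreover have "?p \<noteq> p" by (cases p) auto
    ultimately have "path_class Q \<rho> ?p = \<zero>\<^bsub>\<Lambda>\<^esub>" by (rule zero)
    then show ?thesis using pc ac True by (simp add: path_class_def R_mult pmult_single)
  next
    case False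
    then show ?thesis using pc ac by (simp add: path_class_def R_mult pmult_single R_zero)
  qed
  moreover have "x a \<otimes>\<^bsub>\<Lambda>\<^esub> path_class Q \<rho> p = \<zero>\<^bsub>\<Lambda>\<^esub>"
  proof (cases "path_end Q p = tail Q a")
    case True
    let ?p = "(fst p, snd p @ [a])"
    have "?p \<in> paths Q" using paths_append[OF pp arrow_path[OF a]] True by simp
    moreover have "subpath Q p ?p"
      unfolding subpath_def
      by (rule exI[of _ "(fst p, [])"], rule exI[of _ "[a]"]) simp
    moreover have "?p \<noteq> p" by (cases p) auto
    ultimately have "path_class Q \<rho> ?p = \<zero>\<^bsub>\<Lambda>\<^esub>" by (rule zero)
    then show ?thesis using pc ac True by (simp add: path_class_def R_mult pmult_single)
  next
    case False
    then show ?thesis using pc ac by (simp add: path_class_def R_mult pmult_single R_zero)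
  qed
  ultimately show "path_class Q \<rho> p \<otimes>\<^bsub>\<Lambda>\<^esub> x a = \<zero>\<^bsub>\<Lambda>\<^esub> \<and> x a \<otimes>\<^bsub>\<Lambda>\<^esub> path_class Q \<rho> p = \<zero>\<^bsub>\<Lambda>\<^esub>" by blast
qed

text \<open>Stability provides a maximal bound path from \<open>\<tau> i\<close> to \<open>i\<close>
  for each vertex, and its class serves as \<open>s i\<close>: boundness makes it nonzero,
  maximality places it in the two-sided socle, and its end points determine its corner.\<close>

lemma nakayama_algebra_\<Lambda>:
  assumes stable: "stable_bound_quiver Q \<rho> \<tau> l"
    and inj: "injective_left_module \<Lambda> (regular_left_module \<Lambda>)"
  shows "\<exists>s. nakayama_algebra \<Lambda> Q (vertex_idem Q \<rho>) (\<lambda>i. coef (i, [])) x \<alpha> \<tau> s"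
proof -
  have "\<forall>i\<in>verts Q. \<exists>p. maximal_bound_path Q \<rho> p \<and> fst p = \<tau> i \<and> path_end Q p = i"
    using stable by (simp add: stable_bound_quiver_def)
  then obtain p where p: "\<And>i. i \<in> verts Q \<Longrightarrow> maximal_bound_path Q \<rho> (p i)"
    "\<And>i. i \<in> verts Q \<Longrightarrow> fst (p i) = \<tau> i" "\<And>i. i \<in> verts Q \<Longrightarrow> path_end Q (p i) = i"
    by metis
  have bij: "bij_betw \<tau> (verts Q) (verts Q)" using stable by (simp add: stable_bound_quiver_def)
  have "nakayama_algebra \<Lambda> Q (vertex_idem Q \<rho>) (\<lambda>i. coef (i, [])) x \<alpha> \<tau> (\<lambda>i. path_class Q \<rho> (p i))"
  proof
    show "injective_left_module \<Lambda> (regular_left_module \<Lambda>)" by (rule inj)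
    show "bij_betw \<tau> (verts Q) (verts Q)" by (rule bij)
    show "ideal_prod \<Lambda> S.rad S.rad = {Y \<in> S.rad. \<forall>a\<in>arcs Q. \<alpha> a Y = 0}" by (rule rad_square)
  next
    fix a assume a: "a \<in> arcs Q"
    show "x a \<in> S.rad" using a by (rule x_in_rad)
    show "functional \<Lambda> (\<alpha> a)" by (simp add: functional_coef)
    show "vertex_idem Q \<rho> (head Q a) \<otimes>\<^bsub>\<Lambda>\<^esub> x a \<otimes>\<^bsub>\<Lambda>\<^esub> vertex_idem Q \<rho> (tail Q a) = x a"
      using a by (rule x_corner)
    fix b assume b: "b \<in> arcs Q"
    show "\<alpha> a (x b) = (if a = b then 1 else 0)"
      using single_closed[OF arrow_path[OF b], of 1]
      by (auto simp: path_class_def coef_R lookup_single when_def)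
  next
    fix i assume i: "i \<in> verts Q"
    have bp: "bound_path Q \<rho> (p i)" using p(1)[OF i] by (simp add: maximal_bound_path_def)
    then have pp: "p i \<in> paths Q" by (simp add: bound_path_def)
    show "path_class Q \<rho> (p i) \<in> S.bisocle" using p(1)[OF i] by (rule maximal_bound_path_bisocle)
    show "path_class Q \<rho> (p i) \<noteq> \<zero>\<^bsub>\<Lambda>\<^esub>" using bp by (simp add: bound_path_def)
    have "\<tau> i \<in> verts Q" using bij i by (auto simp: bij_betw_def)
    moreover have "p i = (\<tau> i, snd (p i))" using p(2)[OF i] by (metis prod.collapse)
    then obtain es where "p i = (\<tau> i, es)" by blast
    ultimately show "vertex_idem Q \<rho> i \<otimes>\<^bsub>\<Lambda>\<^esub> path_class Q \<rho> (p i) \<otimes>\<^bsub>\<Lambda>\<^esub> vertex_idem Q \<rho> (\<tau> i) = path_class Q \<rho> (p i)"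
      using single_closed[OF pp, of 1] single_closed[OF vertex_path, of _ 1] i p(3)[OF i]
      by (simp add: path_class_def R_mult pmult_closed pmult_single)
  next
    fix a i j Y
    assume "a \<in> arcs Q" "i \<in> verts Q" "j \<in> verts Q" "Y \<in> carrier \<Lambda>"
      "\<not> (tail Q a = i \<and> head Q a = j)"
    then show "\<alpha> a (vertex_idem Q \<rho> j \<otimes>\<^bsub>\<Lambda>\<^esub> Y \<otimes>\<^bsub>\<Lambda>\<^esub> vertex_idem Q \<rho> i) = 0" by (rule \<alpha>_corner)
  next
    fix Y
    assume "Y \<in> carrier \<Lambda>"
      "\<And>a. a \<in> arcs Q \<Longrightarrow> Y \<otimes>\<^bsub>\<Lambda>\<^esub> x a = \<zero>\<^bsub>\<Lambda>\<^esub> \<and> x a \<otimes>\<^bsub>\<Lambda>\<^esub> Y = \<zero>\<^bsub>\<Lambda>\<^esub>"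
    then show "Y \<in> S.bisocle" by (rule bisocleI)
  qed (rule fin_dim)
  then show ?thesis by blast
qed

end

section \<open>The quivers of the twisted and the untwisted trivial extension\<close>

theorem proposition2p5:
  fixes Q :: "('v, 'a) pre_digraph"
    and \<rho> :: "(('v, 'a) path \<Rightarrow>\<^sub>0 'k::field) set"
    and \<tau> :: "'v \<Rightarrow> 'v"
    and l :: nat
    and \<Lambda> :: "('k, (('v, 'a) path \<Rightarrow>\<^sub>0 'k) set) module"
    and \<sigma> :: "(('v, 'a) path \<Rightarrow>\<^sub>0 'k) set \<Rightarrow> (('v, 'a) path \<Rightarrow>\<^sub>0 'k) set"
  assumes "l \<ge> 1"
    and "stable_bound_quiver Q \<rho> \<tau> l"
    and "\<Lambda> = bound_quiver_algebra Q \<rho>"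
    and "self_injective_algebra \<Lambda>"
    and "graded_automorphism \<Lambda> (degree_part Q \<rho>) \<sigma>"
    and "\<forall>i\<in>verts Q. \<sigma> (vertex_idem Q \<rho> i) = vertex_idem Q \<rho> i"
  shows "is_quiver_of (returning_quiver Q \<tau>)
           (trivial_extension \<Lambda> (twist \<sigma> (dual_bimodule \<Lambda>)))
           (\<lambda>i. (vertex_idem Q \<rho> i, \<zero>\<^bsub>dual_bimodule \<Lambda>\<^esub>))
       \<and> is_quiver_of (returning_quiver Q \<tau>)
           (trivial_extension \<Lambda> (dual_bimodule \<Lambda>))
           (\<lambda>i. (vertex_idem Q \<rho> i, \<zero>\<^bsub>dual_bimodule \<Lambda>\<^esub>))"
proof -
  have hom: "homogeneous_bound_quiver Q \<rho>" using assms(2) by (simp add: stable_bound_quiver_def)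
  then have "fin_digraph Q" by (simp add: homogeneous_bound_quiver_def)
  then interpret bound_quiver Q \<rho> using hom by (simp add: bound_quiver_def bound_quiver_axioms_def)
  have si: "finite_dimensional (bound_quiver_algebra Q \<rho>)"
    "injective_left_module (bound_quiver_algebra Q \<rho>) (regular_left_module (bound_quiver_algebra Q \<rho>))"
    using assms(3,4) by (auto simp: self_injective_algebra_def)
  interpret fin_dim_bound_quiver Q \<rho> by unfold_locales (rule si(1))
  obtain s where "nakayama_algebra \<Lambda> Q (vertex_idem Q \<rho>) (\<lambda>i. coef (i, [])) x \<alpha> \<tau> s"
    using nakayama_algebra_\<Lambda>[OF assms(2) si(2)] assms(3) by blast
  then interpret N: nakayama_algebra \<Lambda> Q "vertex_idem Q \<rho>" "\<lambda>i. coef (i, [])" x \<alpha> \<tau> s .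
  have zero: "\<zero>\<^bsub>dual_bimodule \<Lambda>\<^esub> = (\<lambda>X\<in>carrier \<Lambda>. 0)" by (simp add: dual_bimodule_def)
  \<comment> \<open>Kept general in the automorphism \<open>\<phi>\<close>: it is applied to
    \<open>\<sigma>\<close> and to the identity, whose twist leaves the dual bimodule
    unchanged.\<close>
  have quiver: "is_quiver_of (returning_quiver Q \<tau>) (trivial_extension \<Lambda> (twist \<phi> (dual_bimodule \<Lambda>)))
      (\<lambda>i. (vertex_idem Q \<rho> i, \<zero>\<^bsub>dual_bimodule \<Lambda>\<^esub>))"
    if "\<phi> \<in> ring_iso \<Lambda> \<Lambda>" "\<And>c X. X \<in> carrier \<Lambda> \<Longrightarrow> \<phi> (c \<odot>\<^bsub>\<Lambda>\<^esub> X) = c \<odot>\<^bsub>\<Lambda>\<^esub> \<phi> X"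
      "\<And>i. i \<in> verts Q \<Longrightarrow> \<phi> (vertex_idem Q \<rho> i) = vertex_idem Q \<rho> i" for \<phi>
  proof -
    interpret twisted_nakayama_algebra \<Lambda> Q "vertex_idem Q \<rho>" "\<lambda>i. coef (i, [])" x \<alpha> \<tau> s \<phi>
      using that by unfold_locales (auto simp: ring_iso_def assms(3))
    show ?thesis using is_quiver_of_T by (simp only: zero)
  qed
  have id: "twist (\<lambda>X. X) (dual_bimodule \<Lambda>) = dual_bimodule \<Lambda>"
    by (simp add: twist_def)
  have "(\<lambda>X. X) \<in> ring_iso \<Lambda> \<Lambda>" by (simp add: ring_iso_def ring_hom_def bij_betw_def inj_on_def)
  then have "is_quiver_of (returning_quiver Q \<tau>) (trivial_extension \<Lambda> (dual_bimodule \<Lambda>))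
      (\<lambda>i. (vertex_idem Q \<rho> i, \<zero>\<^bsub>dual_bimodule \<Lambda>\<^esub>))"
    using quiver[of "\<lambda>X. X"] by (simp add: id)
  moreover have "is_quiver_of (returning_quiver Q \<tau>) (trivial_extension \<Lambda> (twist \<sigma> (dual_bimodule \<Lambda>)))
      (\<lambda>i. (vertex_idem Q \<rho> i, \<zero>\<^bsub>dual_bimodule \<Lambda>\<^esub>))"
    using assms(5,6) by (intro quiver) (auto simp: graded_automorphism_def)
  ultimately show ?thesis by blast
qed

end
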